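(* Let $d>4$. There exists $\lambda_0>0$ such that for every $\lambda\in[0,1]$ with $\lambda<\lambda_0$, $$B(\beta_c):=\sum_{x\in\mathbb Z^d}G_{\beta_c}(0,x)^2<\infty.$$
   Context: Weakly self-avoiding walk on $\mathbb Z^d$ with parameter $\lambda\in[0,1]$ (the dependence on $\lambda$ is dropped from the notation): for a finite nearest-neighbour path $\gamma=(\gamma(0),\dots,\gamma(|\gamma|))$ in $\mathbb Z^d$ with $|\gamma|$ edges, $\rho(\gamma):=\prod_{0\le s<t\le|\gamma|}(1-\lambda\mathbf 1_{\gamma(s)=\gamma(t)})$. For $\beta\ge0$ and $x,y\in\mathbb Z^d$, $G_\beta(x,y):=\sum_{\gamma:x\to y}\beta^{|\gamma|}\rho(\gamma)$, the sum being over finite paths from $x$ to $y$ (the zero-length path is included if $x=y$). $\chi(\beta):=\sum_{x\in\mathbb Z^d}G_\beta(0,x)$ and $\beta_c=\beta_c(\lambda):=\sup\{\beta\ge0:\chi(\beta)<\infty\}$. *)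

theory Defs
  imports "HOL-Analysis.Analysis"
begin

definition nearest_neighbour :: "int ^ 'd::finite \<Rightarrow> int ^ 'd \<Rightarrow> bool" where
  "nearest_neighbour x y \<longleftrightarrow> (\<Sum>i\<in>UNIV. \<bar>x $ i - y $ i\<bar>) = 1"

text \<open>A path is the nonempty list of its vertices, so a zero-length path is a singleton list.\<close>

definition paths :: "int ^ 'd::finite \<Rightarrow> int ^ 'd \<Rightarrow> (int ^ 'd) list set" where
  "paths x y = {\<gamma>. \<gamma> \<noteq> [] \<and> hd \<gamma> = x \<and> last \<gamma> = y \<and> successively nearest_neighbour \<gamma>}"

definition num_edges :: "'a list \<Rightarrow> nat" where
  "num_edges \<gamma> = length \<gamma> - 1"

definition wsaw_weight :: "real \<Rightarrow> 'a list \<Rightarrow> real" where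
  "wsaw_weight lam \<gamma> = (\<Prod>t\<le>num_edges \<gamma>. \<Prod>s<t. 1 - lam * of_bool (\<gamma> ! s = \<gamma> ! t))"

text \<open>
  The sums below have nonnegative terms and may diverge, so they are taken in
  \<^typ>\<open>ennreal\<close>, where \<^const>\<open>infsum\<close> always is the true (possibly infinite) value.
  Nonnegativity of the real summand needs \<open>0 \<le> \<beta>\<close> and \<open>lam \<le> 1\<close>.
\<close>

definition wsaw_green ::
    "real \<Rightarrow> real \<Rightarrow> int ^ 'd::finite \<Rightarrow> int ^ 'd \<Rightarrow> ennreal" where
  "wsaw_green lam \<beta> x y =
     (\<Sum>\<^sub>\<infinity>\<gamma>\<in>paths x y. ennreal (\<beta> ^ num_edges \<gamma> * wsaw_weight lam \<gamma>))"

definition wsaw_susceptibility :: "'d::finite itself \<Rightarrow> real \<Rightarrow> real \<Rightarrow> ennreal" where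
  "wsaw_susceptibility TYPE('d) lam \<beta> = (\<Sum>\<^sub>\<infinity>x::int ^ 'd. wsaw_green lam \<beta> 0 x)"

text \<open>
  The supremum is over a nonempty bounded set of reals: it contains 0, and for \<open>\<beta> \<ge> 1\<close> the
  straight paths alone (one of each length, all of weight 1) make the susceptibility infinite.
\<close>

definition wsaw_critical :: "'d::finite itself \<Rightarrow> real \<Rightarrow> real" where
  "wsaw_critical TYPE('d) lam = Sup {\<beta>. 0 \<le> \<beta> \<and> wsaw_susceptibility TYPE('d) lam \<beta> < \<infinity>}"

definition wsaw_bubble :: "'d::finite itself \<Rightarrow> real \<Rightarrow> real \<Rightarrow> ennreal" where
  "wsaw_bubble TYPE('d) lam \<beta> = (\<Sum>\<^sub>\<infinity>x::int ^ 'd. (wsaw_green lam \<beta> 0 x)\<^sup>2)"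

end

(*
The lace expansion writes the Green function g as the convolution inverse of J = delta - beta D - Pi,
where D is the nearest-neighbour kernel. Expanding at the last vertex that interacts with the current
memory gives Pi as an alternating series of ladder diagrams, and the N-th diagram is of order
(lam B)^N, where B is the sum of g^2. The second moments of Pi are of order lam (sup x_j^2 g(x)).

If B <= C, x_j^2 g(x) <= C and lam is small depending on C, then the Fourier transform of J is at least a
multiple of E(k) = sum_j (1 - cos k_j). Hence the transform of g is at most a multiple of 1/E, which
is square integrable for d > 4. This bounds B by a constant that does not depend on C.
Multiplication by x_j is a derivation of the convolution algebra, so the transform of x_j^2 g is
2 G^3 F(x_j J)^2 - G^2 F(x_j^2 J), where G = F(g); since |F(x_j J)|^2 is at most a multiple of 1/G, the
whole is of order G^2, and x_j^2 g(x) is bounded by the same kind of constant K.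

So C = 2K improves to K. Both quantities are continuous in beta below the critical point and bounded
by K at beta = 0, hence bounded by K on all of [0, beta_c), and B(beta_c) <= K by monotone convergence.
*)

theory Submission
  imports Defs "HOL-Probability.Probability_Measure"
begin

section \<open>Sums in the extended nonnegative reals\<close>

text \<open>The bubble alone does not close the argument: the lower bound on the transform of J
  compares \<open>1 - cos (pairing k x)\<close> with \<open>energy k\<close> and so consumes second
  moments of Pi. In a ladder of given displacement some line has to carry the weight; removing that
  line in supremum norm leaves a chain of bubbles. This is why sup x_j^2 g(x) is the second
  bootstrap quantity. Both quantities are bounded by integrals of G^2.

  The memory is only the most recent piece of the walk, so no lace graphs are enumerated: one
  identity, Green function = remainder + one step, is iterated. It lives in \<open>ennreal\<close>
  with every term on its positive side; signs and real numbers enter once summability is known.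

  Transforming x_j^2 g needs its summability, and continuity in \<beta> of a supremum over x is not
  automatic. Both are settled by comparison with a larger \<open>b1\<close> of finite
  susceptibility: polynomials in the path length are absorbed by powers of the ratio. The continuity
  has a uniform step size, so a finite induction does the work of a connectedness argument.\<close>

definition esum :: "('a \<Rightarrow> ennreal) \<Rightarrow> ennreal" (binder "\<Sum>\<^sup>+" 10) where
  "esum f = (\<integral>\<^sup>+x. f x \<partial>count_space UNIV)"

lemma esum_swap: "(\<Sum>\<^sup>+x. \<Sum>\<^sup>+y. f x y) = (\<Sum>\<^sup>+y. \<Sum>\<^sup>+x. f x y)"
proof -
  have "(\<Sum>\<^sup>+x. \<Sum>\<^sup>+y. f x y) = (\<integral>\<^sup>+p. (case p of (x, y) \<Rightarrow> f x y) \<partial>count_space UNIV)"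
    unfolding esum_def by (subst nn_integral_fst_count_space[symmetric]) simp
  also have "\<dots> = (\<Sum>\<^sup>+y. \<Sum>\<^sup>+x. f x y)"
    unfolding esum_def by (subst nn_integral_snd_count_space[symmetric]) simp
  finally show ?thesis .
qed

lemma esum_add: "(\<Sum>\<^sup>+x. f x + g x) = esum f + esum g"
  unfolding esum_def by (rule nn_integral_add) auto

lemma esum_cmult: "(\<Sum>\<^sup>+x. c * f x) = c * esum f"
  unfolding esum_def by (rule nn_integral_cmult) auto

lemma esum_multc: "(\<Sum>\<^sup>+x. f x * c) = esum f * c"
  unfolding esum_def by (rule nn_integral_multc) auto

lemma esum_mono: "(\<And>x. f x \<le> g x) \<Longrightarrow> esum f \<le> esum g"
  unfolding esum_def by (rule nn_integral_mono) auto

lemma esum_cong: "(\<And>x. f x = g x) \<Longrightarrow> esum f = esum g"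
  by presburger

lemma esum_finite_support:
  assumes "finite A" "\<And>x. x \<notin> A \<Longrightarrow> f x = 0"
  shows "esum f = sum f A"
  unfolding esum_def using assms by (subst nn_integral_count_space'[of A]) auto

lemma esum_single:
  assumes "\<And>x. x \<noteq> a \<Longrightarrow> f x = 0"
  shows "esum f = f a"
  using esum_finite_support[of "{a}" f] assms by simp

lemma esum_delta [simp]: "(\<Sum>\<^sup>+x. of_bool (x = a) * f x) = f a" "(\<Sum>\<^sup>+x. of_bool (a = x) * f x) = f a"
  "(\<Sum>\<^sup>+x. f x * of_bool (x = a)) = f a" "(\<Sum>\<^sup>+x. f x * of_bool (a = x)) = f a"
  "(\<Sum>\<^sup>+x. of_bool (x = a)) = 1" "(\<Sum>\<^sup>+x. of_bool (a = x)) = 1"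
  by (subst esum_single[of a]; simp)+

lemma esum_bij: "bij h \<Longrightarrow> (\<Sum>\<^sup>+x. f (h x)) = esum f"
  unfolding esum_def by (rule nn_integral_bij_count_space)

lemma esum_inj:
  assumes "inj h" shows "(\<Sum>\<^sup>+x. f (h x)) = (\<Sum>\<^sup>+y. f y * of_bool (y \<in> range h))"
proof -
  have "(\<Sum>\<^sup>+x. f (h x)) = (\<integral>\<^sup>+y. f y \<partial>count_space (range h))"
    unfolding esum_def using assms by (intro nn_integral_bij_count_space) (simp add: bij_betw_def)
  also have "\<dots> = (\<Sum>\<^sup>+y. f y * of_bool (y \<in> range h))"
    unfolding esum_def
    by (subst nn_integral_count_space_indicator) (auto intro!: nn_integral_cong simp: indicator_def)
  finally show ?thesis .
qed

lemma esum_inj_le: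
  assumes "inj h" shows "(\<Sum>\<^sup>+x. f (h x)) \<le> esum f"
  unfolding esum_inj[OF assms] by (intro esum_mono) simp

lemma esum_ge: "f a \<le> esum f"
proof -
  have "f a = (\<Sum>\<^sup>+x. of_bool (x = a) * f x)" by simp
  also have "\<dots> \<le> esum f" by (intro esum_mono) simp
  finally show ?thesis .
qed

lemma esum_nat: "esum (f :: nat \<Rightarrow> ennreal) = (\<Sum>n. f n)"
  unfolding esum_def by (rule nn_integral_count_space_nat)

lemma esum_SUP:
  assumes "incseq F" shows "(\<Sum>\<^sup>+x. SUP n::nat. F n x) = (SUP n. esum (F n))"
  unfolding esum_def using assms by (intro nn_integral_monotone_convergence_SUP) auto

text \<open>The sets of points with code below n are finite and exhaust a countable type, so
  monotone convergence gives one inequality; the other holds for each finite partial sum. From here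
  on Tonelli and monotone convergence are available for the sums of the definitions.\<close>

lemma infsum_eq_esum:
  fixes f :: "'a::countable \<Rightarrow> ennreal"
  shows "infsum f UNIV = esum f"
proof -
  define A where "A n = {x::'a. to_nat x < n}" for n
  have fin: "finite (A n)" for n
  proof -
    have "finite (to_nat -` {..<n} :: 'a set)" by (rule finite_vimageI) auto
    then show ?thesis by (simp add: A_def vimage_def)
  qed
  have "esum f = (\<Sum>\<^sup>+x. SUP n. f x * of_bool (x \<in> A n))"
  proof (intro esum_cong antisym)
    fix x
    have "f x = f x * of_bool (x \<in> A (Suc (to_nat x)))" by (simp add: A_def)
    also have "\<dots> \<le> (SUP n. f x * of_bool (x \<in> A n))" by (rule SUP_upper) auto
    finally show "f x \<le> (SUP n. f x * of_bool (x \<in> A n))" .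
    show "(SUP n. f x * of_bool (x \<in> A n)) \<le> f x" by (rule SUP_least) simp
  qed
  also have "\<dots> = (SUP n. \<Sum>\<^sup>+x. f x * of_bool (x \<in> A n))"
    by (rule esum_SUP) (auto simp: incseq_def le_fun_def A_def)
  also have "\<dots> = (SUP n. sum f (A n))"
    by (intro SUP_cong refl) (subst esum_finite_support[OF fin], auto intro!: sum.cong)
  also have "\<dots> \<le> (SUP F\<in>{F. finite F \<and> F \<subseteq> UNIV}. sum f F)"
    using fin by (intro SUP_mono) auto
  finally have "esum f \<le> infsum f UNIV" by (subst nonneg_infsum_complete) auto
  moreover have "infsum f UNIV \<le> esum f"
  proof (subst nonneg_infsum_complete, simp, rule SUP_least)
    fix F assume "F \<in> {F. finite F \<and> F \<subseteq> (UNIV::'a set)}"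
    then have "sum f F = (\<Sum>\<^sup>+x. f x * of_bool (x \<in> F))"
      by (subst esum_finite_support[of F]) (auto intro!: sum.cong)
    also have "\<dots> \<le> esum f" by (intro esum_mono) simp
    finally show "sum f F \<le> esum f" .
  qed
  ultimately show ?thesis by (rule antisym[rotated])
qed

lemma infsum_eq_esum_on:
  fixes f :: "'a::countable \<Rightarrow> ennreal"
  shows "infsum f A = (\<Sum>\<^sup>+x. of_bool (x \<in> A) * f x)"
proof -
  have "infsum f A = infsum (\<lambda>x. of_bool (x \<in> A) * f x) UNIV"
    by (rule infsum_cong_neutral) auto
  then show ?thesis by (simp add: infsum_eq_esum)
qed

text \<open>A subtraction-free substitute for the inequality of the means. The lost factor 1/2 is
  the origin of the 2 in \<open>2 * bubble\<close> below.\<close>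

lemma ennreal_mult_le_squares: "a * b \<le> a\<^sup>2 + (b::ennreal)\<^sup>2"
proof (cases "a \<le> b")
  case True
  then have "a * b \<le> b\<^sup>2" by (simp add: power2_eq_square mult_right_mono)
  then show ?thesis by (simp add: add_increasing)
next
  case False
  then have "a * b \<le> a\<^sup>2" by (simp add: power2_eq_square mult_left_mono)
  then show ?thesis by (simp add: add_increasing2)
qed

lemma esum_swap4:
  "(\<Sum>\<^sup>+r. \<Sum>\<^sup>+z. \<Sum>\<^sup>+t. \<Sum>\<^sup>+w. f r z t w) = (\<Sum>\<^sup>+w. \<Sum>\<^sup>+r. \<Sum>\<^sup>+z. \<Sum>\<^sup>+t. f r z t w)"
proof -
  have "(\<Sum>\<^sup>+r. \<Sum>\<^sup>+z. \<Sum>\<^sup>+t. \<Sum>\<^sup>+w. f r z t w) = (\<Sum>\<^sup>+r. \<Sum>\<^sup>+z. \<Sum>\<^sup>+w. \<Sum>\<^sup>+t. f r z t w)"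
    by (rule esum_cong, rule esum_cong, rule esum_swap)
  also have "\<dots> = (\<Sum>\<^sup>+r. \<Sum>\<^sup>+w. \<Sum>\<^sup>+z. \<Sum>\<^sup>+t. f r z t w)"
    by (rule esum_cong, rule esum_swap)
  also have "\<dots> = (\<Sum>\<^sup>+w. \<Sum>\<^sup>+r. \<Sum>\<^sup>+z. \<Sum>\<^sup>+t. f r z t w)"
    by (rule esum_swap)
  finally show ?thesis .
qed

text \<open>A list \<open>w\<close> is of the form \<open>r @ z # t\<close> once for each position
  of \<open>z\<close>, so a sum over triples is a sum over lists with a marked position. It serves
  both to cut a walk at the vertex that ends an expansion step and to count visits to a
  point.\<close>

lemma esum_split:
  "(\<Sum>\<^sup>+r. \<Sum>\<^sup>+z. \<Sum>\<^sup>+t. F (r @ z # t) * c r z) = (\<Sum>\<^sup>+w. F w * (\<Sum>i<length w. c (take i w) (w ! i)))"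
proof -
  have "(\<Sum>\<^sup>+r. \<Sum>\<^sup>+z. \<Sum>\<^sup>+t. F (r @ z # t) * c r z)
      = (\<Sum>\<^sup>+r. \<Sum>\<^sup>+z. \<Sum>\<^sup>+t. \<Sum>\<^sup>+w. of_bool (w = r @ z # t) * (F w * c r z))"
    by simp
  also have "\<dots> = (\<Sum>\<^sup>+w. \<Sum>\<^sup>+r. \<Sum>\<^sup>+z. \<Sum>\<^sup>+t. of_bool (w = r @ z # t) * (F w * c r z))"
    by (rule esum_swap4)
  also have "\<dots> = (\<Sum>\<^sup>+w. F w * (\<Sum>\<^sup>+r. \<Sum>\<^sup>+z. \<Sum>\<^sup>+t. of_bool (w = r @ z # t) * c r z))"
    by (simp add: esum_cmult[symmetric] mult_ac)
  also have "\<dots> = (\<Sum>\<^sup>+w. F w * (\<Sum>i<length w. c (take i w) (w ! i)))"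
  proof (intro esum_cong arg_cong2[where f="(*)"] refl)
    fix w :: "'a list"
    have inj: "inj_on (\<lambda>i. (take i w, w ! i, drop (Suc i) w)) {..<length w}"
    proof (rule inj_onI)
      fix i j assume ij: "i \<in> {..<length w}" "j \<in> {..<length w}"
        and "(take i w, w ! i, drop (Suc i) w) = (take j w, w ! j, drop (Suc j) w)"
      then have "length (take i w) = length (take j w)" by simp
      then show "i = j" using ij by simp
    qed
    have "(\<Sum>\<^sup>+r. \<Sum>\<^sup>+z. \<Sum>\<^sup>+t. of_bool (w = r @ z # t) * c r z)
        = (\<Sum>\<^sup>+p. case p of (r, z, t) \<Rightarrow> of_bool (w = r @ z # t) * c r z)"
      unfolding esum_def nn_integral_fst_count_space[symmetric] by simp
    also have "\<dots> = (\<Sum>p\<in>(\<lambda>i. (take i w, w ! i, drop (Suc i) w)) ` {..<length w}. 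
        case p of (r, z, t) \<Rightarrow> of_bool (w = r @ z # t) * c r z)"
    proof (rule esum_finite_support)
      fix p :: "'a list \<times> 'a \<times> 'a list" 
      assume p: "p \<notin> (\<lambda>i. (take i w, w ! i, drop (Suc i) w)) ` {..<length w}"
      obtain r z t where prt: "p = (r, z, t)" by (cases p) auto
      have "w \<noteq> r @ z # t"
      proof
        assume "w = r @ z # t"
        then have "p = (take (length r) w, w ! length r, drop (Suc (length r)) w)" "length r < length w"
          by (auto simp: prt)
        then show False using p by blast
      qed
      then show "(case p of (r, z, t) \<Rightarrow> of_bool (w = r @ z # t) * c r z) = 0"
        by (simp add: prt)
    qed simp
    also have "\<dots> = (\<Sum>i<length w. c (take i w) (w ! i))"
      by (subst sum.reindex[OF inj]) (auto intro!: sum.cong simp: id_take_nth_drop[symmetric])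
    finally show "(\<Sum>\<^sup>+r. \<Sum>\<^sup>+z. \<Sum>\<^sup>+t. of_bool (w = r @ z # t) * c r z) = (\<Sum>i<length w. c (take i w) (w ! i))" .
  qed
  finally show ?thesis .
qed

section \<open>Path weights\<close>

definition repel :: "real \<Rightarrow> 'a \<Rightarrow> 'a \<Rightarrow> real" where
  "repel lam a b = 1 - lam * of_bool (a = b)"

lemma prod_list_map_nth: "(\<Prod>b\<leftarrow>w. f b) = (\<Prod>t<length w. f (w ! t) :: 'a::comm_monoid_mult)"
  by (induction w) (auto simp: prod.lessThan_Suc_shift simp del: prod.lessThan_Suc)

definition cross :: "real \<Rightarrow> 'a list \<Rightarrow> 'a list \<Rightarrow> real" where
  "cross lam u v = (\<Prod>a\<leftarrow>u. \<Prod>b\<leftarrow>v. repel lam a b)"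

lemma cross_Nil [simp]: "cross lam [] v = 1" "cross lam u [] = 1"
  by (simp_all add: cross_def map_replicate_const)

lemma cross_append_left: "cross lam (u @ u') v = cross lam u v * cross lam u' v"
  by (simp add: cross_def)

lemma cross_append_right: "cross lam u (v @ v') = cross lam u v * cross lam u v'"
  by (induction u) (auto simp: cross_def algebra_simps)

lemma cross_Cons_left: "cross lam (a # u) v = cross lam [a] v * cross lam u v"
  using cross_append_left[of lam "[a]" u v] by simp

lemma cross_Cons_right: "cross lam u (b # v) = cross lam u [b] * cross lam u v"
  using cross_append_right[of lam u "[b]" v] by simp

lemma wsaw_weight_altdef:
  "wsaw_weight lam w = (\<Prod>t<length w. \<Prod>s<t. repel lam (w ! s) (w ! t))"
proof (cases "w = []")
  case False
  then have "{..num_edges w} = {..<length w}"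
    by (cases w) (auto simp: num_edges_def lessThan_Suc_atMost)
  then show ?thesis by (simp add: wsaw_weight_def repel_def)
qed (simp add: wsaw_weight_def num_edges_def)

lemma wsaw_weight_Nil [simp]: "wsaw_weight lam [] = 1"
  by (simp add: wsaw_weight_altdef)

lemma wsaw_weight_Cons: "wsaw_weight lam (a # w) = cross lam [a] w * wsaw_weight lam w"
proof -
  have "wsaw_weight lam (a # w) = (\<Prod>t<length w. repel lam a (w ! t) * (\<Prod>s<t. repel lam (w ! s) (w ! t)))"
    unfolding wsaw_weight_altdef
    by (simp only: list.size prod.lessThan_Suc_shift o_def add.right_neutral add_Suc_right) simp
  also have "\<dots> = (\<Prod>t<length w. repel lam a (w ! t)) * wsaw_weight lam w"
    by (simp add: prod.distrib wsaw_weight_altdef)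
  also have "(\<Prod>t<length w. repel lam a (w ! t)) = cross lam [a] w"
    by (simp add: cross_def prod_list_map_nth)
  finally show ?thesis .
qed

lemma wsaw_weight_singleton [simp]: "wsaw_weight lam [a] = 1"
  by (simp add: wsaw_weight_Cons)

lemma wsaw_weight_append:
  "wsaw_weight lam (u @ v) = wsaw_weight lam u * wsaw_weight lam v * cross lam u v"
proof (induction u)
  case (Cons a u)
  then show ?case
    by (simp add: wsaw_weight_Cons cross_append_right cross_Cons_left[of lam a u])
qed simp

lemma num_edges_simps [simp]:
  "num_edges [a] = 0" "num_edges (a # b # w) = Suc (num_edges (b # w))"
  by (auto simp: num_edges_def)

lemma num_edges_append: "num_edges (u @ a # v) = num_edges (u @ [a]) + num_edges (a # v)"
  by (simp add: num_edges_def)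

lemma count_list_eq_sum: "of_nat (count_list w z) = (\<Sum>i<length w. of_bool (w ! i = z) :: 'a::semiring_1)"
  by (induction w) (auto simp: sum.lessThan_Suc_shift simp del: sum.lessThan_Suc)

section \<open>Path weights in [0,1], cutting a path at a vertex, and one step of the
  expansion\<close>

locale wsaw =
  fixes lam \<beta> :: real
  assumes lam: "0 \<le> lam" "lam \<le> 1" and beta: "0 \<le> \<beta>"
begin

lemma repel_01: "0 \<le> repel lam a b" "repel lam a b \<le> 1"
  using lam by (auto simp: repel_def)

lemma cross_01: "0 \<le> cross lam u v \<and> cross lam u v \<le> 1"
proof -
  have *: "0 \<le> (\<Prod>b\<leftarrow>v. f b) \<and> (\<Prod>b\<leftarrow>v. f b) \<le> (1::real)" if "\<And>b. 0 \<le> f b \<and> f b \<le> 1" for f and v :: "'b list"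
    using that by (induction v) (auto intro!: mult_le_one)
  show ?thesis unfolding cross_def by (rule *, rule *) (simp add: repel_01)
qed

lemmas cross_nonneg = cross_01[THEN conjunct1]
lemmas cross_le_1 = cross_01[THEN conjunct2]

lemma weight_01: "0 \<le> wsaw_weight lam w \<and> wsaw_weight lam w \<le> 1"
  by (induction w) (auto simp: wsaw_weight_Cons cross_nonneg cross_le_1 intro!: mult_le_one)

text \<open>Union bound for a product of factors \<open>1 - lam\<close>. It is the source of all
  smallness: every expansion step yields one factor \<open>lam\<close> and a visit to be
  counted.\<close>

lemma cross_singleton_ge: "1 - cross lam u [z] \<le> lam * real (count_list u z)"
proof -
  have "1 - lam * real (count_list u z) \<le> cross lam u [z]"
  proof (induction u)
    case (Cons a u)
    show ?case
    proof (cases "a = z")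
      case True
      have "lam * cross lam u [z] \<le> lam" using lam cross_le_1[of u "[z]"] by (simp add: mult_left_le)
      then show ?thesis using True Cons 
        by (simp add: cross_Cons_left[of lam a u]) (simp add: cross_def repel_def algebra_simps)
    next
      case False
      then show ?thesis using Cons by (simp add: cross_Cons_left[of lam a u]) (simp add: cross_def repel_def)
    qed
  qed simp
  then show ?thesis by simp
qed

text \<open>Lists that are not paths get weight 0, the empty list included. Sums can then run over
  all lists, and cutting or joining needs no side conditions.\<close>

definition wt :: "(int ^ 'd::finite) list \<Rightarrow> ennreal" where
  "wt w = of_bool (w \<noteq> [] \<and> successively nearest_neighbour w) * ennreal (\<beta> ^ num_edges w * wsaw_weight lam w)"

lemma wt_Nil [simp]: "wt [] = 0"
  by (simp add: wt_def)

lemma wt_singleton [simp]: "wt [a] = 1"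
  by (simp add: wt_def)

text \<open>The cut vertex \<open>z\<close> belongs to both pieces, so edges add up exactly, and
  every pair of positions lies within the first piece, within the second, or in \<open>u\<close>
  times \<open>v\<close>.\<close>

lemma wt_append: "wt (u @ z # v) = wt (u @ [z]) * wt (z # v) * ennreal (cross lam u v)"
proof -
  have "wsaw_weight lam (u @ z # v) = wsaw_weight lam (u @ [z]) * wsaw_weight lam (z # v) * cross lam u v"
    by (simp add: wsaw_weight_append[of lam u] wsaw_weight_Cons[of lam z v] cross_Cons_right[of lam u z v])
  moreover have "successively nearest_neighbour (u @ z # v) \<longleftrightarrow>
      successively nearest_neighbour (u @ [z]) \<and> successively nearest_neighbour (z # v)"
    by (auto simp: successively_append_iff)
  moreover have "ennreal (\<beta> ^ (m + n) * (a * b * c)) = ennreal (\<beta> ^ m * a) * ennreal (\<beta> ^ n * b) * ennreal c"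
    if "0 \<le> a" "0 \<le> b" "0 \<le> c" for a b c m n
    using that beta by (simp add: ennreal_mult[symmetric] power_add mult_ac)
  ultimately show ?thesis
    using weight_01[of "u @ [z]"] weight_01[of "z # v"] cross_nonneg[of u v]
    by (simp add: wt_def of_bool_conj num_edges_append[of u z v])
qed

lemma wt_append_le: "wt (u @ z # v) \<le> wt (u @ [z]) * wt (z # v)"
  using wt_append[of u z v] cross_le_1[of u v]
  by (metis ennreal_le_1 mult.right_neutral mult_left_mono zero_le)

definition green :: "int ^ 'd::finite \<Rightarrow> int ^ 'd \<Rightarrow> ennreal" where
  "green x y = (\<Sum>\<^sup>+w. wt w * of_bool (hd w = x \<and> last w = y))"

lemma wsaw_green_eq: "wsaw_green lam \<beta> x y = green x y"
  unfolding wsaw_green_def green_def infsum_eq_esum_on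
  by (intro esum_cong) (simp add: wt_def paths_def of_bool_conj mult_ac)

lemma esum_hd:
  fixes v :: 'z
  shows "(\<Sum>\<^sup>+r. f (v # r)) = (\<Sum>\<^sup>+w. f w * of_bool (w \<noteq> [] \<and> hd w = v))"
proof -
  have "w \<in> range ((#) v) \<longleftrightarrow> w \<noteq> [] \<and> hd w = v" for w :: "'z list"
    by (cases w) auto
  then show ?thesis by (subst esum_inj[of "(#) v"]) (auto simp: inj_def)
qed

lemma green_Cons: "green v y = (\<Sum>\<^sup>+t. wt (v # t) * of_bool (last (v # t) = y))"
  unfolding green_def esum_hd[where f="\<lambda>w. wt w * of_bool (last w = y)"]
  by (intro esum_cong) (auto simp: of_bool_def)

text \<open>
  The list \<open>\<eta>\<close> is the memory: the part of the past that still repels the walk started at \<open>v\<close>, without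
  the common vertex \<open>v\<close>. In \<open>lace_step\<close> the vertex \<open>z\<close> is the last one that feels the memory; the
  piece \<open>v # r\<close> walked up to there is the memory of what follows.
\<close>

definition remainder :: "(int ^ 'd::finite) list \<Rightarrow> int ^ 'd \<Rightarrow> int ^ 'd \<Rightarrow> ennreal" where
  "remainder \<eta> v y = (\<Sum>\<^sup>+t. wt (v # t) * ennreal (cross lam \<eta> t) * of_bool (last (v # t) = y))"

definition lace_step :: "((int ^ 'd::finite) list \<Rightarrow> int ^ 'd \<Rightarrow> ennreal) \<Rightarrow> (int ^ 'd) list \<Rightarrow> int ^ 'd \<Rightarrow> ennreal" where
  "lace_step \<Phi> \<eta> v =
    (\<Sum>\<^sup>+r. \<Sum>\<^sup>+z. wt (v # r @ [z]) * ennreal (cross lam \<eta> r * (1 - cross lam \<eta> [z])) * \<Phi> (v # r) z)"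

text \<open>In the i-th term earlier vertices keep their interaction with the memory, the i-th one
  contributes the defect \<open>1 - cross\<close>, and later ones carry the factor 1: the walk after
  the marked vertex has forgotten \<open>\<eta>\<close>.\<close>

lemma cross_telescope:
  "(\<Sum>i<length w. cross lam \<eta> (take i w) * (1 - cross lam \<eta> [w ! i])) = 1 - cross lam \<eta> w"
proof -
  have "cross lam \<eta> (take i w) * (1 - cross lam \<eta> [w ! i]) 
      = cross lam \<eta> (take i w) - cross lam \<eta> (take (Suc i) w)" if "i < length w" for i
    using that by (simp add: take_Suc_conv_app_nth cross_append_right algebra_simps)
  then have "(\<Sum>i<length w. cross lam \<eta> (take i w) * (1 - cross lam \<eta> [w ! i])) =
      (\<Sum>i<length w. cross lam \<eta> (take i w) - cross lam \<eta> (take (Suc i) w))"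
    by (intro sum.cong) auto
  also have "\<dots> = 1 - cross lam \<eta> w"
    by (subst sum_lessThan_telescope') simp
  finally show ?thesis .
qed

text \<open>Insert \<open>1 = cross + (1 - cross)\<close> for the interaction with
  \<open>\<eta>\<close> and telescope the second part. When the walk is cut at \<open>z\<close>,
  \<open>wt_append\<close> leaves \<open>cross lam (v # r) t\<close>, which is exactly the repulsion
  by the new memory \<open>v # r\<close>. So the correction again consists of remainders, and the
  identity can be iterated.\<close>

lemma green_expansion: "green v y = remainder \<eta> v y + lace_step (\<lambda>\<eta> v. remainder \<eta> v y) \<eta> v"
proof -
  let ?F = "\<lambda>t. wt (v # t) * of_bool (last (v # t) = y)"
  let ?c = "\<lambda>r z. cross lam \<eta> r * (1 - cross lam \<eta> [z])"
  have c: "0 \<le> ?c r z" for r z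
    by (intro mult_nonneg_nonneg) (simp_all add: cross_nonneg cross_le_1)
  have "lace_step (\<lambda>\<eta> v. remainder \<eta> v y) \<eta> v = (\<Sum>\<^sup>+r. \<Sum>\<^sup>+z. \<Sum>\<^sup>+t. ?F (r @ z # t) * ennreal (?c r z))"
    unfolding lace_step_def remainder_def esum_cmult[symmetric]
  proof (intro esum_cong)
    fix r z t
    show "wt (v # r @ [z]) * ennreal (?c r z) * (wt (z # t) * ennreal (cross lam (v # r) t) * of_bool (last (z # t) = y))
        = ?F (r @ z # t) * ennreal (?c r z)"
      using wt_append[of "v # r" z t] by (simp add: mult_ac)
  qed
  also have "\<dots> = (\<Sum>\<^sup>+t. ?F t * (\<Sum>i<length t. ennreal (?c (take i t) (t ! i))))"
    by (rule esum_split)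
  also have "\<dots> = (\<Sum>\<^sup>+t. ?F t * ennreal (1 - cross lam \<eta> t))"
    by (simp only: sum_ennreal c cross_telescope)
  finally have "remainder \<eta> v y + lace_step (\<lambda>\<eta> v. remainder \<eta> v y) \<eta> v =
      (\<Sum>\<^sup>+t. ?F t * (ennreal (cross lam \<eta> t) + ennreal (1 - cross lam \<eta> t)))"
    by (simp add: remainder_def esum_add[symmetric] distrib_left mult_ac)
  also have "\<dots> = green v y"
  proof -
    have "ennreal (cross lam \<eta> t) + ennreal (1 - cross lam \<eta> t) = 1" for t
      using cross_nonneg[of \<eta> t] cross_le_1[of \<eta> t] by (subst ennreal_plus[symmetric]) auto
    then show ?thesis by (simp only: green_Cons mult.right_neutral)
  qed
  finally show ?thesis by simp
qed

end

section \<open>The lace expansion\<close>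

lemma esum_list: "esum f = f [] + (\<Sum>\<^sup>+a. \<Sum>\<^sup>+w. f (a # w))"
proof -
  have "(\<Sum>\<^sup>+a. \<Sum>\<^sup>+w. f (a # w)) = (\<Sum>\<^sup>+p. case p of (a, w) \<Rightarrow> f (a # w))"
    unfolding esum_def nn_integral_fst_count_space[symmetric] by simp
  also have "\<dots> = (\<Sum>\<^sup>+p. f (fst p # snd p))"
    by (simp add: case_prod_beta)
  also have "\<dots> = (\<Sum>\<^sup>+w. f w * of_bool (w \<in> range (\<lambda>p. fst p # snd p)))"
    by (rule esum_inj) (auto simp: inj_def)
  also have "\<dots> = (\<Sum>\<^sup>+w. f w * of_bool (w \<noteq> []))"
    by (intro esum_cong) (auto simp: neq_Nil_conv image_iff)
  also have "f [] + \<dots> = (\<Sum>\<^sup>+w. f w * of_bool (w = []) + f w * of_bool (w \<noteq> []))"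
    by (simp only: esum_add esum_delta)
  also have "\<dots> = esum f"
    by (intro esum_cong) auto
  finally show ?thesis by simp
qed

lemma esum_nat_Suc: "esum f = f 0 + (\<Sum>\<^sup>+n. f (Suc n))"
proof -
  have "(\<Sum>\<^sup>+n. f (Suc n)) = (\<Sum>\<^sup>+n. f n * of_bool (n \<in> range Suc))"
    by (rule esum_inj) simp
  also have "f 0 + \<dots> = (\<Sum>\<^sup>+n. f n * of_bool (n = 0) + f n * of_bool (n \<in> range Suc))"
    by (simp only: esum_add esum_delta)
  also have "\<dots> = esum f"
    by (intro esum_cong) (auto simp: image_iff gr0_conv_Suc)
  finally show ?thesis by simp
qed

definition sq :: "'d \<Rightarrow> int ^ 'd \<Rightarrow> ennreal" where
  "sq j x = ennreal ((real_of_int (x $ j))\<^sup>2)"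

lemma sq_0 [simp]: "sq j 0 = 0"
  by (simp add: sq_def)

lemma sq_add_le: "sq j (x + y) \<le> 2 * sq j x + 2 * sq j y"
proof -
  have "(real_of_int ((x + y) $ j))\<^sup>2 \<le> 2 * (real_of_int (x $ j))\<^sup>2 + 2 * (real_of_int (y $ j))\<^sup>2"
    using sum_squares_bound[of "real_of_int (x $ j)" "real_of_int (y $ j)"] by (simp add: power2_sum)
  then have "sq j (x + y) \<le> ennreal (2 * (real_of_int (x $ j))\<^sup>2 + 2 * (real_of_int (y $ j))\<^sup>2)"
    unfolding sq_def by (rule ennreal_leI)
  also have "\<dots> = 2 * sq j x + 2 * sq j y"
    by (simp add: sq_def ennreal_mult'')
  finally show ?thesis .
qed

definition neighbours :: "(int ^ 'd::finite) set" where
  "neighbours = {e. nearest_neighbour 0 e}"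

lemma zero_notin_neighbours [simp]: "0 \<notin> neighbours"
  by (simp add: neighbours_def nearest_neighbour_def)

lemma neighbours_coord_le:
  assumes "e \<in> neighbours" shows "\<bar>e $ i\<bar> \<le> 1"
proof -
  have "\<bar>e $ i\<bar> \<le> (\<Sum>i\<in>UNIV. \<bar>e $ i\<bar>)" by (rule member_le_sum) auto
  then show ?thesis using assms by (simp add: neighbours_def nearest_neighbour_def)
qed

lemma finite_neighbours [simp]: "finite (neighbours :: (int ^ 'd::finite) set)"
proof -
  have "finite (vec_nth ` (neighbours :: (int ^ 'd) set))"
  proof (rule finite_subset)
    show "vec_nth ` (neighbours :: (int ^ 'd) set) \<subseteq> (UNIV \<rightarrow>\<^sub>E {-1..1})"
      using neighbours_coord_le by (force simp: PiE_def extensional_def abs_le_iff)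
  qed (auto intro: finite_PiE)
  then show ?thesis
    by (rule finite_imageD) (auto simp: inj_on_def vec_nth_inject)
qed

lemma nearest_neighbour_translate [simp]: "nearest_neighbour (x + a) (y + a) = nearest_neighbour x y"
  by (simp add: nearest_neighbour_def)

lemma wsaw_weight_map: "inj h \<Longrightarrow> wsaw_weight lam (map h w) = wsaw_weight lam w"
  unfolding wsaw_weight_altdef by (auto intro!: prod.cong simp: repel_def inj_eq)

context wsaw begin

lemma lace_step_add: "lace_step (\<lambda>\<eta> v. \<Phi> \<eta> v + \<Psi> \<eta> v) \<eta> v = lace_step \<Phi> \<eta> v + lace_step \<Psi> \<eta> v"
  by (simp add: lace_step_def distrib_left esum_add)

lemma lace_step_esum:
  "lace_step (\<lambda>\<eta> v. \<Sum>\<^sup>+x. \<Phi> x \<eta> v * c x) \<eta> v = (\<Sum>\<^sup>+x. lace_step (\<Phi> x) \<eta> v * c x)"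
proof -
  let ?k = "\<lambda>r z. wt (v # r @ [z]) * ennreal (cross lam \<eta> r * (1 - cross lam \<eta> [z]))"
  have "lace_step (\<lambda>\<eta> v. \<Sum>\<^sup>+x. \<Phi> x \<eta> v * c x) \<eta> v = (\<Sum>\<^sup>+r. \<Sum>\<^sup>+z. \<Sum>\<^sup>+x. ?k r z * \<Phi> x (v # r) z * c x)"
    by (simp only: lace_step_def esum_cmult[symmetric] mult.assoc)
  also have "\<dots> = (\<Sum>\<^sup>+r. \<Sum>\<^sup>+x. \<Sum>\<^sup>+z. ?k r z * \<Phi> x (v # r) z * c x)"
    by (rule esum_cong, rule esum_swap)
  also have "\<dots> = (\<Sum>\<^sup>+x. \<Sum>\<^sup>+r. \<Sum>\<^sup>+z. ?k r z * \<Phi> x (v # r) z * c x)"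
    by (rule esum_swap)
  finally show ?thesis
    by (simp add: lace_step_def esum_multc)
qed

text \<open>The lace expansion coefficients with memory and starting point still open. Stopping with
  a delta at level 0 means that a free Green function starts at \<open>x\<close>.\<close>

primrec lace :: "nat \<Rightarrow> (int ^ 'd::finite) list \<Rightarrow> int ^ 'd \<Rightarrow> int ^ 'd \<Rightarrow> ennreal" where
  "lace 0 \<eta> v x = of_bool (v = x)"
| "lace (Suc n) \<eta> v x = lace_step (\<lambda>\<eta> v. lace n \<eta> v x) \<eta> v"

primrec remainders :: "nat \<Rightarrow> (int ^ 'd::finite) list \<Rightarrow> int ^ 'd \<Rightarrow> int ^ 'd \<Rightarrow> ennreal" where
  "remainders 0 \<eta> v y = remainder \<eta> v y"
| "remainders (Suc n) \<eta> v y = lace_step (\<lambda>\<eta> v. remainders n \<eta> v y) \<eta> v"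

text \<open>Solved for \<open>remainders n\<close>, this shows the alternating sign. It is kept as a
  sum because differences in \<open>ennreal\<close> would need finiteness.\<close>

lemma remainders_add:
  "remainders n \<eta> v y + remainders (Suc n) \<eta> v y = (\<Sum>\<^sup>+x. lace n \<eta> v x * green x y)"
proof (induction n arbitrary: \<eta> v)
  case 0
  show ?case using green_expansion[of v y \<eta>] by simp
next
  case (Suc n)
  have "remainders (Suc n) \<eta> v y + remainders (Suc (Suc n)) \<eta> v y =
      lace_step (\<lambda>\<eta> v. remainders n \<eta> v y + remainders (Suc n) \<eta> v y) \<eta> v"
    by (simp add: lace_step_add)
  also have "\<dots> = (\<Sum>\<^sup>+x. lace_step (\<lambda>\<eta> v. lace n \<eta> v x) \<eta> v * green x y)"
    by (simp only: Suc lace_step_esum)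
  finally show ?case by simp
qed

text \<open>After the first step from the origin to \<open>e\<close>, the memory consists of the
  origin alone. With this normalisation coefficient number 0 is the random-walk kernel
  (\<open>lace_coeff_0\<close>) and the true corrections start at 1.\<close>

definition lace_coeff :: "nat \<Rightarrow> int ^ 'd::finite \<Rightarrow> ennreal" where
  "lace_coeff n x = ennreal \<beta> * (\<Sum>\<^sup>+e. of_bool (e \<in> neighbours) * lace n [0] e x)"

definition rem_coeff :: "nat \<Rightarrow> int ^ 'd::finite \<Rightarrow> ennreal" where
  "rem_coeff n y = ennreal \<beta> * (\<Sum>\<^sup>+e. of_bool (e \<in> neighbours) * remainders n [0] e y)"

lemma green_eq_delta_plus: "green 0 y = of_bool (y = 0) + rem_coeff 0 y"
proof -
  have wt2: "wt [0, e] = ennreal \<beta> * of_bool (e \<in> neighbours)" for e :: "int ^ 'd"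
  proof (cases "e \<in> neighbours")
    case True
    then have "e \<noteq> 0" using zero_notin_neighbours by blast
    then have "wsaw_weight lam [0, e] = 1" by (simp add: wsaw_weight_Cons cross_def repel_def)
    then show ?thesis using True by (simp add: wt_def neighbours_def)
  qed (simp add: wt_def neighbours_def)
  have "green 0 y = of_bool (y = 0) + (\<Sum>\<^sup>+e. \<Sum>\<^sup>+t. wt ([0] @ e # t) * of_bool (last (e # t) = y))"
    unfolding green_Cons by (subst esum_list) (simp add: eq_commute[of 0 y])
  also have "(\<Sum>\<^sup>+e. \<Sum>\<^sup>+t. wt ([0] @ e # t) * of_bool (last (e # t) = y)) = rem_coeff 0 y"
    unfolding rem_coeff_def remainders.simps remainder_def esum_cmult[symmetric]
  proof (intro esum_cong)
    fix e t
    show "wt ([0] @ e # t) * of_bool (last (e # t) = y) =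
        ennreal \<beta> * (of_bool (e \<in> neighbours) * (wt (e # t) * ennreal (cross lam [0] t) * of_bool (last (e # t) = y)))"
      unfolding wt_append[of "[0]" e t] by (simp add: wt2 mult_ac)
  qed
  finally show ?thesis .
qed

lemma rem_coeff_add:
  "rem_coeff n y + rem_coeff (Suc n) y = (\<Sum>\<^sup>+x. lace_coeff n x * green x y)"
proof -
  have "rem_coeff n y + rem_coeff (Suc n) y =
      ennreal \<beta> * (\<Sum>\<^sup>+e. of_bool (e \<in> neighbours) * (remainders n [0] e y + remainders (Suc n) [0] e y))"
    unfolding rem_coeff_def by (simp add: distrib_left esum_add del: remainders.simps)
  also have "\<dots> = ennreal \<beta> * (\<Sum>\<^sup>+e. \<Sum>\<^sup>+x. of_bool (e \<in> neighbours) * lace n [0] e x * green x y)"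
    by (simp only: remainders_add esum_cmult[symmetric] mult.assoc)
  also have "\<dots> = ennreal \<beta> * (\<Sum>\<^sup>+x. \<Sum>\<^sup>+e. of_bool (e \<in> neighbours) * lace n [0] e x * green x y)"
    by (subst esum_swap) simp
  also have "\<dots> = (\<Sum>\<^sup>+x. lace_coeff n x * green x y)"
    unfolding lace_coeff_def by (simp only: mult.assoc esum_cmult esum_multc[symmetric])
  finally show ?thesis .
qed

definition lace_even :: "int ^ 'd::finite \<Rightarrow> ennreal" where
  "lace_even x = (\<Sum>\<^sup>+n. lace_coeff (2 * n) x)"

definition lace_odd :: "int ^ 'd::finite \<Rightarrow> ennreal" where
  "lace_odd x = (\<Sum>\<^sup>+n. lace_coeff (2 * n + 1) x)"

text \<open>
  The alternating series over \<open>n\<close> is split into its even and odd parts, so that no subtraction occurs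
  and the identity holds without any finiteness assumption.
\<close>

lemma lace_expansion:
  "green 0 y + (\<Sum>\<^sup>+x. lace_odd x * green x y) = of_bool (y = 0) + (\<Sum>\<^sup>+x. lace_even x * green x y)"
proof -
  \<comment> \<open>Summing \<open>rem_coeff_add\<close> over the even indices gives all remainders
    from number 0 on, over the odd indices all from number 1 on. The excess is
    \<open>rem_coeff 0\<close>, the Green function without its delta; the rest occurs identically on
    both sides and is never cancelled.\<close>
  have *: "(\<Sum>\<^sup>+x. (\<Sum>\<^sup>+n. lace_coeff (f n) x) * green x y)
      = (\<Sum>\<^sup>+n. rem_coeff (f n) y) + (\<Sum>\<^sup>+n. rem_coeff (Suc (f n)) y)" for f :: "nat \<Rightarrow> nat"
  proof -
    have "(\<Sum>\<^sup>+x. (\<Sum>\<^sup>+n. lace_coeff (f n) x) * green x y) = (\<Sum>\<^sup>+n. \<Sum>\<^sup>+x. lace_coeff (f n) x * green x y)"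
      unfolding esum_multc[symmetric] by (rule esum_swap)
    then show ?thesis by (simp add: rem_coeff_add[symmetric] esum_add)
  qed
  have "(\<Sum>\<^sup>+n. rem_coeff (2 * n) y) = rem_coeff 0 y + (\<Sum>\<^sup>+n. rem_coeff (Suc (2 * n + 1)) y)"
    by (subst esum_nat_Suc) simp
  then show ?thesis
    unfolding lace_even_def lace_odd_def * green_eq_delta_plus by (simp add: add_ac)
qed

section \<open>Translation and reflection invariance\<close>

lemma wt_map_translate: "wt (map (\<lambda>v. v + a) w) = wt w"
proof -
  have "inj (\<lambda>v. v + a)" by (simp add: inj_def)
  then show ?thesis by (simp add: wt_def wsaw_weight_map successively_map num_edges_def)
qed

lemma green_translate:
  fixes x y :: "int ^ 'd::finite"
  shows "green x y = green 0 (y - x)"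
proof -
  have "bij (map (\<lambda>v. v + x))"
    by (rule bij_betw_byWitness[where f'="map (\<lambda>v. v - x)"]) (auto simp: o_def)
  then have "green x y = (\<Sum>\<^sup>+w. wt (map (\<lambda>v. v + x) w) * of_bool (hd (map (\<lambda>v. v + x) w) = x \<and> last (map (\<lambda>v. v + x) w) = y))"
    unfolding green_def by (rule esum_bij[symmetric])
  also have "\<dots> = green 0 (y - x)"
    unfolding green_def
  proof (rule esum_cong)
    fix w :: "(int ^ 'd) list"
    show "wt (map (\<lambda>v. v + x) w) * of_bool (hd (map (\<lambda>v. v + x) w) = x \<and> last (map (\<lambda>v. v + x) w) = y) =
      wt w * of_bool (hd w = 0 \<and> last w = y - x)"
      unfolding wt_map_translate by (cases "w = []") (auto simp: hd_map last_map)
  qed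
  finally show ?thesis .
qed

lemma green_uminus:
  fixes x :: "int ^ 'd::finite"
  shows "green 0 (- x) = green 0 x"
proof -
  have "bij (map uminus :: (int ^ 'd) list \<Rightarrow> _)"
    by (rule bij_betw_byWitness[where f'="map uminus"]) (auto simp: o_def)
  then have "green 0 (- x) = (\<Sum>\<^sup>+w. wt (map uminus w) * of_bool (hd (map uminus w) = 0 \<and> last (map uminus w) = - x))"
    unfolding green_def by (rule esum_bij[symmetric])
  also have "\<dots> = green 0 x"
    unfolding green_def
  proof (rule esum_cong)
    fix w :: "(int ^ 'd) list"
    have "nearest_neighbour (- u) (- v) = nearest_neighbour u v" for u v :: "int ^ 'd"
      by (simp add: nearest_neighbour_def abs_minus_commute)
    then have "wt (map uminus w) = wt w"
      by (simp add: wt_def wsaw_weight_map successively_map num_edges_def)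
    then show "wt (map uminus w) * of_bool (hd (map uminus w) = 0 \<and> last (map uminus w) = - x) =
      wt w * of_bool (hd w = 0 \<and> last w = x)"
      by (cases "w = []") (auto simp: hd_map last_map)
  qed
  finally show ?thesis .
qed

end

section \<open>Diagrammatic bounds\<close>

context wsaw begin

text \<open>The list \<open>w\<close> is the memory at the moment when the walk stands at
  \<open>v\<close>; it omits the common vertex \<open>v\<close>, as the memory argument of
  \<open>lace\<close> requires. Summing over it replaces a list-valued memory by its two
  endpoints.\<close>

definition diagram :: "nat \<Rightarrow> int ^ 'd::finite \<Rightarrow> int ^ 'd \<Rightarrow> int ^ 'd \<Rightarrow> ennreal" where
  "diagram n u v x = (\<Sum>\<^sup>+w. wt (w @ [v]) * of_bool (w \<noteq> [] \<and> hd w = u) * lace n w v x)"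

text \<open>The repulsion of \<open>r\<close> by the memory is dropped and the defect at
  \<open>z\<close> is bounded by the number of visits. What remains, a walk
  \<open>v # r @ [z]\<close> about to serve as memory, is the summand of the next diagram.\<close>

lemma lace_Suc_le: "lace (Suc n) \<eta> v x \<le> (\<Sum>\<^sup>+z. ennreal lam * of_nat (count_list \<eta> z) * diagram n v z x)"
proof -
  have "lace (Suc n) \<eta> v x \<le> (\<Sum>\<^sup>+r. \<Sum>\<^sup>+z. ennreal lam * of_nat (count_list \<eta> z) * (wt ((v # r) @ [z]) * lace n (v # r) z x))"
    unfolding lace.simps lace_step_def
  proof (intro esum_mono)
    fix r z
    have "cross lam \<eta> r * (1 - cross lam \<eta> [z]) \<le> 1 * (lam * real (count_list \<eta> z))"
      by (intro mult_mono cross_singleton_ge) (simp_all add: cross_nonneg cross_le_1)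
    then have le: "ennreal (cross lam \<eta> r * (1 - cross lam \<eta> [z])) \<le> ennreal lam * of_nat (count_list \<eta> z)"
      using lam by (simp add: ennreal_leI ennreal_mult[symmetric] ennreal_of_nat_eq_real_of_nat)
    then show "wt (v # r @ [z]) * ennreal (cross lam \<eta> r * (1 - cross lam \<eta> [z])) * lace n (v # r) z x
        \<le> ennreal lam * of_nat (count_list \<eta> z) * (wt ((v # r) @ [z]) * lace n (v # r) z x)"
      using mult_right_mono[OF le, of "wt (v # r @ [z]) * lace n (v # r) z x"] by (simp add: mult_ac)
  qed
  also have "\<dots> = (\<Sum>\<^sup>+z. \<Sum>\<^sup>+r. ennreal lam * of_nat (count_list \<eta> z) * (wt ((v # r) @ [z]) * lace n (v # r) z x))"
    by (rule esum_swap)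
  also have "\<dots> = (\<Sum>\<^sup>+z. ennreal lam * of_nat (count_list \<eta> z) * diagram n v z x)"
  proof (rule esum_cong)
    fix z
    have "(\<Sum>\<^sup>+r. wt ((v # r) @ [z]) * lace n (v # r) z x) = diagram n v z x"
      unfolding esum_hd[where f="\<lambda>w. wt (w @ [z]) * lace n w z x"] diagram_def
      by (simp only: mult_ac)
    then show "(\<Sum>\<^sup>+r. ennreal lam * of_nat (count_list \<eta> z) * (wt ((v # r) @ [z]) * lace n (v # r) z x))
        = ennreal lam * of_nat (count_list \<eta> z) * diagram n v z x"
      by (simp only: esum_cmult)
  qed
  finally show ?thesis .
qed

text \<open>Cut at each visit to \<open>z\<close> and drop the repulsion between the two pieces. The
  remaining sums run over injective images of lists, hence are at most full Green functions.\<close>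

lemma count_paths_le:
  "(\<Sum>\<^sup>+w. wt (w @ [v]) * of_bool (w \<noteq> [] \<and> hd w = u) * of_nat (count_list w z)) \<le> green u z * green z v"
proof -
  let ?F = "\<lambda>w. wt (w @ [v]) * of_bool (w \<noteq> [] \<and> hd w = u)"
  have "(\<Sum>\<^sup>+w. ?F w * of_nat (count_list w z)) = (\<Sum>\<^sup>+r. \<Sum>\<^sup>+z'. \<Sum>\<^sup>+t. ?F (r @ z' # t) * of_bool (z' = z))"
    unfolding count_list_eq_sum esum_split[of ?F "\<lambda>_ z'. of_bool (z' = z)"] ..
  also have "\<dots> = (\<Sum>\<^sup>+r. \<Sum>\<^sup>+t. ?F (r @ z # t))"
    by (simp only: esum_multc esum_delta)
  also have "\<dots> \<le> (\<Sum>\<^sup>+r. \<Sum>\<^sup>+t. (wt (r @ [z]) * of_bool (hd (r @ [z]) = u \<and> last (r @ [z]) = z)) *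
      (wt (z # t @ [v]) * of_bool (hd (z # t @ [v]) = z \<and> last (z # t @ [v]) = v)))"
  proof (intro esum_mono)
    fix r t
    have "hd (r @ z # t) = hd (r @ [z])" by (cases r) auto
    then show "?F (r @ z # t) \<le> (wt (r @ [z]) * of_bool (hd (r @ [z]) = u \<and> last (r @ [z]) = z)) *
        (wt (z # t @ [v]) * of_bool (hd (z # t @ [v]) = z \<and> last (z # t @ [v]) = v))"
      using wt_append_le[of r z "t @ [v]"] by (simp add: of_bool_def)
  qed
  also have "\<dots> = (\<Sum>\<^sup>+r. wt (r @ [z]) * of_bool (hd (r @ [z]) = u \<and> last (r @ [z]) = z)) *
      (\<Sum>\<^sup>+t. wt (z # t @ [v]) * of_bool (hd (z # t @ [v]) = z \<and> last (z # t @ [v]) = v))"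
    by (simp only: esum_cmult esum_multc)
  also have "\<dots> \<le> green u z * green z v"
    unfolding green_def
    by (intro mult_mono esum_inj_le[where h="\<lambda>r. r @ [z]"] esum_inj_le[where h="\<lambda>t. z # t @ [v]"])
       (auto simp: inj_def)
  finally show ?thesis .
qed

lemma diagram_0_le: "diagram 0 u v x \<le> of_bool (v = x) * green u v"
proof -
  have "diagram 0 u v x = of_bool (v = x) * (\<Sum>\<^sup>+w. wt (w @ [v]) * of_bool (w \<noteq> [] \<and> hd w = u))"
    unfolding diagram_def lace.simps esum_multc by (simp only: mult.commute)
  also have "\<dots> \<le> of_bool (v = x) * (\<Sum>\<^sup>+w. wt (w @ [v]) * of_bool (hd (w @ [v]) = u \<and> last (w @ [v]) = v))"
    by (intro mult_left_mono esum_mono) auto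
  also have "\<dots> \<le> of_bool (v = x) * green u v"
    unfolding green_def by (intro mult_left_mono esum_inj_le[where h="\<lambda>w. w @ [v]"]) (auto simp: inj_def)
  finally show ?thesis .
qed

text \<open>One more cell of the ladder: the line from \<open>u\<close> to \<open>v\<close> is
  broken at \<open>z\<close>, and the next diagram opens from \<open>v\<close> to
  \<open>z\<close>.\<close>

lemma diagram_Suc_le:
  "diagram (Suc n) u v x \<le> (\<Sum>\<^sup>+z. ennreal lam * (green u z * green z v) * diagram n v z x)"
proof -
  have "diagram (Suc n) u v x \<le> (\<Sum>\<^sup>+w. wt (w @ [v]) * of_bool (w \<noteq> [] \<and> hd w = u) *
      (\<Sum>\<^sup>+z. ennreal lam * of_nat (count_list w z) * diagram n v z x))"
    unfolding diagram_def[of "Suc n"] by (intro esum_mono mult_left_mono lace_Suc_le) simp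
  also have "\<dots> = (\<Sum>\<^sup>+w. \<Sum>\<^sup>+z. ennreal lam * (wt (w @ [v]) * of_bool (w \<noteq> [] \<and> hd w = u) * of_nat (count_list w z)) * diagram n v z x)"
    unfolding esum_cmult[symmetric] by (simp only: mult_ac)
  also have "\<dots> = (\<Sum>\<^sup>+z. \<Sum>\<^sup>+w. ennreal lam * (wt (w @ [v]) * of_bool (w \<noteq> [] \<and> hd w = u) * of_nat (count_list w z)) * diagram n v z x)"
    by (rule esum_swap)
  also have "\<dots> = (\<Sum>\<^sup>+z. ennreal lam * (\<Sum>\<^sup>+w. wt (w @ [v]) * of_bool (w \<noteq> [] \<and> hd w = u) * of_nat (count_list w z)) * diagram n v z x)"
    by (simp only: esum_cmult esum_multc)
  also have "\<dots> \<le> (\<Sum>\<^sup>+z. ennreal lam * (green u z * green z v) * diagram n v z x)"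
    by (intro esum_mono mult_left_mono mult_right_mono count_paths_le) auto
  finally show ?thesis .
qed

lemma lace_coeff_0: "lace_coeff 0 x = ennreal \<beta> * of_bool (x \<in> neighbours)"
  by (simp add: lace_coeff_def)

lemma lace_coeff_Suc_le:
  "lace_coeff (Suc n) x \<le> ennreal (\<beta> * lam) * (\<Sum>\<^sup>+e. of_bool (e \<in> neighbours) * diagram n e 0 x)"
proof -
  have "lace (Suc n) [0] e x \<le> ennreal lam * diagram n e 0 x" for e
  proof -
    have "lace (Suc n) [0] e x \<le> (\<Sum>\<^sup>+z. ennreal lam * of_nat (count_list [0] z) * diagram n e z x)"
      by (rule lace_Suc_le)
    \<comment> \<open>The memory is just the origin, so the first marked vertex must be a return to
      0; the piece that becomes memory leads from \<open>e\<close> to 0.\<close>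
    also have "\<dots> = (\<Sum>\<^sup>+z. of_bool (0 = z) * (ennreal lam * diagram n e z x))"
      by (intro esum_cong) auto
    finally show ?thesis by simp
  qed
  then have "lace_coeff (Suc n) x \<le> ennreal \<beta> * (\<Sum>\<^sup>+e. of_bool (e \<in> neighbours) * (ennreal lam * diagram n e 0 x))"
    unfolding lace_coeff_def by (intro mult_left_mono esum_mono) auto
  also have "\<dots> = ennreal \<beta> * (ennreal lam * (\<Sum>\<^sup>+e. of_bool (e \<in> neighbours) * diagram n e 0 x))"
    unfolding esum_cmult[symmetric] by (simp only: mult_ac)
  finally show ?thesis using lam beta by (simp add: ennreal_mult mult_ac)
qed

section \<open>Bubble bounds for ladders without weights\<close>

definition bubble :: "'d::finite itself \<Rightarrow> ennreal" where
  "bubble TYPE('d) = (\<Sum>\<^sup>+x::int ^ 'd. (green 0 x)\<^sup>2)"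

lemma green_le_bubble: "green 0 (x :: int ^ 'd::finite) \<le> 1 + bubble TYPE('d)"
proof -
  have "green 0 x \<le> 1 + (green 0 x)\<^sup>2"
    using ennreal_mult_le_squares[of 1 "green 0 x"] by simp
  also have "\<dots> \<le> 1 + bubble TYPE('d)"
    unfolding bubble_def by (intro add_left_mono esum_ge)
  finally show ?thesis .
qed

lemma bij_minus: "bij (\<lambda>z. x - z :: 'a::ab_group_add)"
  by (rule bij_betw_byWitness[where f'="\<lambda>z. x - z"]) auto

lemma bij_plus: "bij (\<lambda>z. x + z :: 'a::ab_group_add)"
  by (rule bij_betw_byWitness[where f'="\<lambda>z. z - x"]) auto

lemma esum_green_mult_le: "(\<Sum>\<^sup>+z. green 0 z * green 0 (x - z)) \<le> 2 * bubble TYPE('d)"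
  for x :: "int ^ 'd::finite"
proof -
  have "(\<Sum>\<^sup>+z. green 0 z * green 0 (x - z)) \<le> (\<Sum>\<^sup>+z. (green 0 z)\<^sup>2 + (green 0 (x - z))\<^sup>2)"
    by (intro esum_mono ennreal_mult_le_squares)
  also have "\<dots> = 2 * bubble TYPE('d)"
    using esum_bij[OF bij_minus, of "\<lambda>z. (green 0 z)\<^sup>2" x] by (simp add: esum_add bubble_def mult_2)
  finally show ?thesis .
qed

lemma esum_green_green_le: "(\<Sum>\<^sup>+z. green u z * green z v) \<le> 2 * bubble TYPE('d)"
  for u v :: "int ^ 'd::finite"
proof -
  have "(\<Sum>\<^sup>+z. green u z * green z v) = (\<Sum>\<^sup>+z. green u (u + z) * green (u + z) v)"
    by (rule esum_bij[OF bij_plus, symmetric])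
  also have "\<dots> = (\<Sum>\<^sup>+z. green 0 z * green 0 (v - u - z))"
    unfolding green_translate[of u] green_translate[of "u + _"] by (simp add: algebra_simps)
  also have "\<dots> \<le> 2 * bubble TYPE('d)"
    by (rule esum_green_mult_le)
  finally show ?thesis .
qed

text \<open>Majorant of the total mass of a diagram as a function of the displacement of its
  endpoints alone. The next endpoints are \<open>v\<close> and \<open>z\<close>, hence the argument
  \<open>z - x\<close> when \<open>z\<close> and \<open>x\<close> are measured from
  \<open>u\<close>.\<close>

primrec mass :: "nat \<Rightarrow> int ^ 'd::finite \<Rightarrow> ennreal" where
  "mass 0 x = green 0 x"
| "mass (Suc n) x = ennreal lam * (\<Sum>\<^sup>+z. green 0 z * green 0 (x - z) * mass n (z - x))"

lemma esum_diagram_le: "(\<Sum>\<^sup>+x. diagram n u v x) \<le> mass n (v - u)"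
proof (induction n arbitrary: u v)
  case 0
  have "(\<Sum>\<^sup>+x. diagram 0 u v x) \<le> (\<Sum>\<^sup>+x. of_bool (v = x) * green u v)"
    by (intro esum_mono diagram_0_le)
  then show ?case by (simp add: green_translate[of u])
next
  case (Suc n)
  have "(\<Sum>\<^sup>+x. diagram (Suc n) u v x) \<le> (\<Sum>\<^sup>+x. \<Sum>\<^sup>+z. ennreal lam * (green u z * green z v) * diagram n v z x)"
    by (intro esum_mono diagram_Suc_le)
  also have "\<dots> = (\<Sum>\<^sup>+z. \<Sum>\<^sup>+x. ennreal lam * (green u z * green z v) * diagram n v z x)"
    by (rule esum_swap)
  also have "\<dots> = (\<Sum>\<^sup>+z. ennreal lam * (green u z * green z v) * (\<Sum>\<^sup>+x. diagram n v z x))"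
    by (simp only: esum_cmult)
  also have "\<dots> \<le> (\<Sum>\<^sup>+z. ennreal lam * (green u z * green z v) * mass n (z - v))"
    by (intro esum_mono mult_left_mono Suc) auto
  also have "\<dots> = (\<Sum>\<^sup>+z. ennreal lam * (green u (u + z) * green (u + z) v) * mass n (u + z - v))"
    by (rule esum_bij[OF bij_plus, symmetric])
  also have "\<dots> = mass (Suc n) (v - u)"
    unfolding green_translate[of u] green_translate[of "u + _"] mass.simps esum_cmult[symmetric]
    by (simp add: algebra_simps)
  finally show ?case .
qed

text \<open>The cost of one cell: \<open>lam\<close> for the contact and a convolution of two Green
  functions for the lines.\<close>

definition rate :: "'d::finite itself \<Rightarrow> ennreal" where
  "rate TYPE('d) = ennreal lam * (2 * bubble TYPE('d))"

lemma mass_le: "mass n x \<le> rate TYPE('d) ^ n * (1 + bubble TYPE('d))" for x :: "int ^ 'd::finite"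
proof (induction n arbitrary: x)
  case 0
  show ?case using green_le_bubble[of x] by simp
next
  case (Suc n)
  have "mass (Suc n) x \<le> ennreal lam * (\<Sum>\<^sup>+z. green 0 z * green 0 (x - z) * (rate TYPE('d) ^ n * (1 + bubble TYPE('d))))"
    unfolding mass.simps by (intro mult_left_mono esum_mono Suc) auto
  also have "\<dots> \<le> ennreal lam * (2 * bubble TYPE('d) * (rate TYPE('d) ^ n * (1 + bubble TYPE('d))))"
    unfolding esum_multc by (intro mult_left_mono mult_right_mono esum_green_mult_le) auto
  finally show ?case by (simp add: rate_def mult_ac)
qed

text \<open>A ladder closed by one additional line. This is what is left of a weighted ladder after
  the weighted line has been taken out.\<close>

lemma esum_green_mass_le:
  "(\<Sum>\<^sup>+x::int ^ 'd::finite. green 0 x * mass n x) \<le> rate TYPE('d) ^ n * bubble TYPE('d)"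
proof (induction n)
  case 0
  show ?case by (simp add: bubble_def power2_eq_square)
next
  case (Suc n)
  have eq: "(\<Sum>\<^sup>+x::int ^ 'd. green 0 x * mass (Suc n) x) =
      ennreal lam * (\<Sum>\<^sup>+x::int ^ 'd. \<Sum>\<^sup>+z. green 0 x * (green 0 z * green 0 (x - z) * mass n (z - x)))"
    unfolding mass.simps esum_cmult[symmetric] by (simp only: mult_ac)
  have "(\<Sum>\<^sup>+x::int ^ 'd. \<Sum>\<^sup>+z. green 0 x * (green 0 z * green 0 (x - z) * mass n (z - x))) =
      (\<Sum>\<^sup>+x::int ^ 'd. \<Sum>\<^sup>+y. green 0 x * (green 0 (x + y) * green 0 (x - (x + y)) * mass n (x + y - x)))"
    by (rule esum_cong, rule esum_bij[OF bij_plus, symmetric])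
  \<comment> \<open>In the variables \<open>x\<close> and \<open>y\<close>, where
    \<open>z = x + y\<close>, just two lines contain \<open>x\<close>; by reflection they form a
    convolution, and the third line stays attached to \<open>mass n y\<close>, which restores the
    shape of the statement.\<close>
  also have "\<dots> = (\<Sum>\<^sup>+x::int ^ 'd. \<Sum>\<^sup>+y. green 0 x * green 0 (- y - x) * (green 0 y * mass n y))"
  proof (intro esum_cong)
    fix x y :: "int ^ 'd"
    have "green 0 (x + y) = green 0 (- y - x)" by (subst green_uminus[symmetric]) simp
    then show "green 0 x * (green 0 (x + y) * green 0 (x - (x + y)) * mass n (x + y - x)) =
        green 0 x * green 0 (- y - x) * (green 0 y * mass n y)"
      by (simp add: green_uminus mult_ac)
  qed
  also have "\<dots> = (\<Sum>\<^sup>+y::int ^ 'd. (\<Sum>\<^sup>+x. green 0 x * green 0 (- y - x)) * (green 0 y * mass n y))"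
    unfolding esum_multc[symmetric] by (rule esum_swap)
  also have "\<dots> \<le> (\<Sum>\<^sup>+y::int ^ 'd. 2 * bubble TYPE('d) * (green 0 y * mass n y))"
    by (intro esum_mono mult_right_mono esum_green_mult_le) auto
  also have "\<dots> \<le> 2 * bubble TYPE('d) * (rate TYPE('d) ^ n * bubble TYPE('d))"
    unfolding esum_cmult by (intro mult_left_mono Suc) auto
  finally have "(\<Sum>\<^sup>+x::int ^ 'd. green 0 x * mass (Suc n) x)
      \<le> ennreal lam * (2 * bubble TYPE('d) * (rate TYPE('d) ^ n * bubble TYPE('d)))"
    unfolding eq by (rule mult_left_mono) simp
  then show ?case by (simp add: rate_def mult_ac)
qed

text \<open>
  The displacement from \<open>u\<close> is measured along one side of the ladder of the diagram, and the one from
  \<open>v\<close> along the other. Since the sides alternate, both bounds are proved together; only one line per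
  step carries the weight \<open>sq j\<close>, and it is removed at the price of \<open>h\<close>.
\<close>

lemma weighted_diagram_le:
  fixes j :: "'d::finite" and h :: ennreal
  assumes h: "\<And>x. sq j x * green 0 x \<le> h"
  shows "(\<Sum>\<^sup>+x. sq j (x - u) * diagram n u v x) \<le> h * (3 * rate TYPE('d)) ^ n \<and>
    (\<Sum>\<^sup>+x. sq j (x - v) * diagram n u v x) \<le> h * (3 * rate TYPE('d)) ^ n"
proof (induction n arbitrary: u v)
  case 0
  have "(\<Sum>\<^sup>+x. sq j (x - u) * diagram 0 u v x) \<le> (\<Sum>\<^sup>+x. sq j (x - u) * (of_bool (v = x) * green u v))"
    by (intro esum_mono mult_left_mono diagram_0_le) auto
  also have "\<dots> = (\<Sum>\<^sup>+x. of_bool (v = x) * (sq j (x - u) * green u v))"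
    by (simp only: mult_ac)
  also have "\<dots> \<le> h" using h[of "v - u"] by (simp add: green_translate[of u])
  finally have 1: "(\<Sum>\<^sup>+x. sq j (x - u) * diagram 0 u v x) \<le> h" .
  have "(\<Sum>\<^sup>+x. sq j (x - v) * diagram 0 u v x) \<le> (\<Sum>\<^sup>+x. sq j (x - v) * (of_bool (v = x) * green u v))"
    by (intro esum_mono mult_left_mono diagram_0_le) auto
  also have "\<dots> = (\<Sum>\<^sup>+x. of_bool (v = x) * (sq j (x - v) * green u v))"
    by (simp only: mult_ac)
  also have "\<dots> \<le> h" by simp
  finally show ?case using 1 by simp
next
  case (Suc n)
  let ?q = "rate TYPE('d)"
  let ?H = "h * (3 * ?q) ^ n"
  have *: "(\<Sum>\<^sup>+x. f x * diagram (Suc n) u v x) \<le>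
      ennreal lam * (\<Sum>\<^sup>+z. green u z * green z v * (\<Sum>\<^sup>+x. f x * diagram n v z x))" for f
  proof -
    have "(\<Sum>\<^sup>+x. f x * diagram (Suc n) u v x) \<le> (\<Sum>\<^sup>+x. f x * (\<Sum>\<^sup>+z. ennreal lam * (green u z * green z v) * diagram n v z x))"
      by (intro esum_mono mult_left_mono diagram_Suc_le) auto
    also have "\<dots> = (\<Sum>\<^sup>+x. \<Sum>\<^sup>+z. ennreal lam * (green u z * green z v * (f x * diagram n v z x)))"
      unfolding esum_cmult[symmetric] by (simp only: mult_ac)
    also have "\<dots> = (\<Sum>\<^sup>+z. \<Sum>\<^sup>+x. ennreal lam * (green u z * green z v * (f x * diagram n v z x)))"
      by (rule esum_swap)
    finally show ?thesis by (simp only: esum_cmult)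
  qed
  have **: "ennreal lam * (\<Sum>\<^sup>+z. green u z * green z v * H) \<le> ?q * H" for H
    unfolding esum_multc rate_def mult.assoc[symmetric]
    by (intro mult_right_mono mult_left_mono) (use esum_green_green_le[of u v] in \<open>auto simp: mult.assoc intro: mult_left_mono\<close>)
  \<comment> \<open>The point \<open>v\<close> is the first endpoint of the remaining diagram, so
    this displacement passes to the induction hypothesis without being split.\<close>
  have V: "(\<Sum>\<^sup>+x. sq j (x - v) * diagram (Suc n) u v x) \<le> ?q * ?H"
  proof -
    note *
    also have "ennreal lam * (\<Sum>\<^sup>+z. green u z * green z v * (\<Sum>\<^sup>+x. sq j (x - v) * diagram n v z x)) \<le>
        ennreal lam * (\<Sum>\<^sup>+z. green u z * green z v * ?H)"
      by (intro mult_left_mono esum_mono Suc[THEN conjunct1]) auto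
    also note **
    finally show ?thesis .
  qed
  \<comment> \<open>Here \<open>x - u\<close> is split at \<open>z\<close>, with a factor 2 on each
    part. The part \<open>x - z\<close> goes to the second half of the hypothesis and gives
    \<open>2 * ?q * ?H\<close>. The part \<open>z - u\<close> is absorbed with its line into
    \<open>h\<close>; the rest closes to \<open>esum_green_mass_le\<close>, where the 2 is part of
    the rate, so it adds one more \<open>?q * ?H\<close>. The sum explains the 3.\<close>
  have W: "(\<Sum>\<^sup>+x. sq j (x - u) * diagram (Suc n) u v x) \<le> 3 * ?q * ?H"
  proof -
    note *
    also have "ennreal lam * (\<Sum>\<^sup>+z. green u z * green z v * (\<Sum>\<^sup>+x. sq j (x - u) * diagram n v z x)) \<le>
        ennreal lam * (\<Sum>\<^sup>+z. green u z * green z v * (2 * ?H) + 2 * h * (green z v * mass n (z - v)))"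
    proof (intro mult_left_mono esum_mono)
      fix z
      have "(\<Sum>\<^sup>+x. sq j (x - u) * diagram n v z x) \<le> (\<Sum>\<^sup>+x. 2 * (sq j (x - z) * diagram n v z x) + 2 * sq j (z - u) * diagram n v z x)"
      proof (intro esum_mono)
        fix x
        have "sq j (x - u) \<le> 2 * sq j (x - z) + 2 * sq j (z - u)"
          using sq_add_le[of j "x - z" "z - u"] by simp
        then have "sq j (x - u) * diagram n v z x \<le> (2 * sq j (x - z) + 2 * sq j (z - u)) * diagram n v z x"
          by (rule mult_right_mono) simp
        then show "sq j (x - u) * diagram n v z x \<le> 2 * (sq j (x - z) * diagram n v z x) + 2 * sq j (z - u) * diagram n v z x"
          by (simp add: distrib_right mult.assoc)
      qed
      also have "\<dots> \<le> 2 * ?H + 2 * sq j (z - u) * mass n (z - v)"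
        unfolding esum_add esum_cmult
        by (intro add_mono mult_left_mono Suc[THEN conjunct2] esum_diagram_le) auto
      finally have "green u z * green z v * (\<Sum>\<^sup>+x. sq j (x - u) * diagram n v z x) \<le>
          green u z * green z v * (2 * ?H + 2 * sq j (z - u) * mass n (z - v))"
        by (rule mult_left_mono) simp
      also have "\<dots> = green u z * green z v * (2 * ?H) + 2 * (sq j (z - u) * green 0 (z - u)) * (green z v * mass n (z - v))"
        unfolding green_translate[of u z] by (simp only: distrib_left mult_ac)
      also have "\<dots> \<le> green u z * green z v * (2 * ?H) + 2 * h * (green z v * mass n (z - v))"
        by (intro add_left_mono mult_right_mono mult_left_mono h) auto
      finally show "green u z * green z v * (\<Sum>\<^sup>+x. sq j (x - u) * diagram n v z x) \<le>
          green u z * green z v * (2 * ?H) + 2 * h * (green z v * mass n (z - v))" .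
    qed simp
    also have "\<dots> = ennreal lam * (\<Sum>\<^sup>+z. green u z * green z v * (2 * ?H)) + ennreal lam * (2 * h * (\<Sum>\<^sup>+z. green z v * mass n (z - v)))"
      unfolding esum_add esum_cmult by (rule distrib_left)
    also have "(\<Sum>\<^sup>+z. green z v * mass n (z - v)) = (\<Sum>\<^sup>+z. green (v + z) v * mass n (v + z - v))"
      by (rule esum_bij[OF bij_plus, symmetric])
    also have "\<dots> = (\<Sum>\<^sup>+z::int ^ 'd. green 0 z * mass n z)"
      unfolding green_translate[of "v + _"] by (simp add: green_uminus)
    also have "ennreal lam * (\<Sum>\<^sup>+z. green u z * green z v * (2 * ?H)) + ennreal lam * (2 * h * (\<Sum>\<^sup>+z::int ^ 'd. green 0 z * mass n z))
        \<le> ?q * (2 * ?H) + ennreal lam * (2 * h * (?q ^ n * bubble TYPE('d)))"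
      by (intro add_mono ** mult_left_mono esum_green_mass_le) auto
    also have "\<dots> = 2 * ?q * ?H + h * ?q ^ n * ?q"
      by (simp add: rate_def mult_ac)
    also have "\<dots> \<le> 2 * ?q * ?H + h * (3 * ?q) ^ n * ?q"
    proof -
      have "1 * ?q \<le> 3 * ?q" by (intro mult_right_mono) auto
      then show ?thesis by (intro add_left_mono mult_right_mono mult_left_mono power_mono) auto
    qed
    also have "h * (3 * ?q) ^ n * ?q = 1 * ?q * ?H"
      by (simp add: mult_ac)
    also have "2 * ?q * ?H + 1 * ?q * ?H = (2 + 1) * ?q * ?H"
      by (simp only: distrib_right)
    also have "2 + 1 = (3 :: ennreal)"
      by simp
    finally show ?thesis .
  qed
  have "?q * ?H \<le> 3 * ?q * ?H"
  proof -
    have "1 * ?q \<le> 3 * ?q" by (intro mult_right_mono) auto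
    then show ?thesis by (intro mult_right_mono) auto
  qed
  then show ?case using V W by (simp add: mult_ac)
qed

end

section \<open>Fourier series on the torus\<close>

abbreviation summable_fun :: "('a \<Rightarrow> real) \<Rightarrow> bool" where
  "summable_fun f \<equiv> integrable (count_space UNIV) f"

lemma summable_fun_iff: "summable_fun f \<longleftrightarrow> (\<Sum>\<^sup>+x. ennreal \<bar>f x\<bar>) < \<infinity>"
  by (simp add: integrable_iff_bounded esum_def)

definition pairing :: "('d::finite \<Rightarrow> real) \<Rightarrow> int ^ 'd \<Rightarrow> real" where
  "pairing k x = (\<Sum>j\<in>UNIV. k j * real_of_int (x $ j))"

lemma pairing_simps [simp]: "pairing k 0 = 0" "pairing k (x + y) = pairing k x + pairing k y"
  "pairing k (x - y) = pairing k x - pairing k y" "pairing k (- x) = - pairing k x"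
  by (auto simp: pairing_def algebra_simps sum.distrib sum_subtractf sum_negf)

text \<open>Momenta are plain functions on the index type, so that the torus can be a finite product
  measure.\<close>

definition fourier :: "(int ^ 'd::finite \<Rightarrow> real) \<Rightarrow> ('d \<Rightarrow> real) \<Rightarrow> complex" where
  "fourier f k = (\<integral>x. complex_of_real (f x) * cis (pairing k x) \<partial>count_space UNIV)"

definition conv :: "(int ^ 'd::finite \<Rightarrow> real) \<Rightarrow> (int ^ 'd \<Rightarrow> real) \<Rightarrow> int ^ 'd \<Rightarrow> real" where
  "conv f g x = (\<integral>y. f y * g (x - y) \<partial>count_space UNIV)"

lemma integrable_fourier:
  assumes "summable_fun f"
  shows "integrable (count_space UNIV) (\<lambda>x. complex_of_real (f x) * cis (pairing k x))"
  using assms by (rule Bochner_Integration.integrable_bound) (auto simp: norm_mult)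

lemma fourier_add: "summable_fun f \<Longrightarrow> summable_fun g \<Longrightarrow> fourier (\<lambda>x. f x + g x) k = fourier f k + fourier g k"
  unfolding fourier_def by (simp add: distrib_right integrable_fourier)

lemma pair_sigma_finite_count_space:
  "pair_sigma_finite (count_space (UNIV :: 'a::countable set)) (count_space (UNIV :: 'b::countable set))"
  by (intro pair_sigma_finite.intro sigma_finite_measure_count_space_countable) auto

lemma fourier_conv:
  fixes f g :: "int ^ 'd::finite \<Rightarrow> real"
  assumes f: "summable_fun f" and g: "summable_fun g"
  shows "fourier (conv f g) k = fourier f k * fourier g k" (is ?th1)
    and "summable_fun (conv f g)" (is ?th2)
    and "summable_fun (\<lambda>y. f y * g (x - y))" (is ?th3)
proof -
  interpret P: pair_sigma_finite "count_space (UNIV :: (int ^ 'd) set)" "count_space (UNIV :: (int ^ 'd) set)"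
    by (rule pair_sigma_finite_count_space)
  have bij: "bij (\<lambda>x. x - y)" for y :: "int ^ 'd"
    by (rule bij_betw_byWitness[where f'="\<lambda>x. x + y"]) auto
  have shift: "(\<integral>x. h (x - y) \<partial>count_space UNIV) = (\<integral>x. h x \<partial>count_space UNIV)"
    for h :: "int ^ 'd \<Rightarrow> 'z::{banach, second_countable_topology}" and y
    by (rule integral_bij_count_space[OF bij])
  have ishift: "integrable (count_space UNIV) (\<lambda>x. h (x - y)) \<longleftrightarrow> integrable (count_space UNIV) h"
    for h :: "int ^ 'd \<Rightarrow> 'z::{banach, second_countable_topology}" and y
    by (rule integrable_bij_count_space[OF bij])
  \<comment> \<open>Absolute integrability for an arbitrary unimodular factor: \<open>c = 1\<close>
    over the reals gives summability of the convolution, \<open>c = cis\<close> the interchange of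
    sums in its transform.\<close>
  have main: "integrable (count_space UNIV \<Otimes>\<^sub>M count_space UNIV) (\<lambda>(y, x). of_real (f y) * of_real (g (x - y)) * c x :: 'z)"
    if c: "\<And>x. norm (c x) = 1" for c :: "int ^ 'd \<Rightarrow> 'z::{banach, second_countable_topology, real_normed_field}"
  proof (rule P.Fubini_integrable)
    show "(\<lambda>(y, x). of_real (f y) * of_real (g (x - y)) * c x) \<in> borel_measurable (count_space UNIV \<Otimes>\<^sub>M count_space UNIV)"
      by (simp add: pair_measure_countable)
    have "integrable (count_space UNIV) (\<lambda>y. \<bar>f y\<bar> * (\<integral>x. \<bar>g x\<bar> \<partial>count_space UNIV))"
      using f by (intro integrable_mult_left integrable_abs) auto
    then show "integrable (count_space UNIV) (\<lambda>y. LINT x|count_space UNIV. norm (case (y, x) of (y, x) \<Rightarrow> of_real (f y) * of_real (g (x - y)) * c x))"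
      using shift[of "\<lambda>x. \<bar>g x\<bar>"] by (simp add: norm_mult c)
    have "integrable (count_space UNIV) (\<lambda>x. of_real (f y) * of_real (g (x - y)) * c x)" for y
    proof (rule Bochner_Integration.integrable_bound)
      show "integrable (count_space UNIV) (\<lambda>x. f y * g (x - y))"
        using g ishift[of g] by (intro integrable_mult_right) auto
    qed (auto simp: norm_mult c abs_mult)
    then show "AE y in count_space UNIV. integrable (count_space UNIV) (\<lambda>x. case (y, x) of (y, x) \<Rightarrow> of_real (f y) * of_real (g (x - y)) * c x)"
      by simp
  qed
  have r: "integrable (count_space UNIV \<Otimes>\<^sub>M count_space UNIV) (\<lambda>(y, x). f y * g (x - y))"
    using main[of "\<lambda>_. 1 :: real"] by simp
  show ?th2
    using P.integrable_fst'[OF P.integrable_product_swap[OF r]] by (simp add: conv_def[abs_def])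
  \<comment> \<open>Fubini gives this for almost every \<open>x\<close>, which for counting measure
    means every \<open>x\<close>.\<close>
  show ?th3
    using P.AE_integrable_fst'[OF P.integrable_product_swap[OF r]] by (simp add: AE_count_space)
  have "fourier (conv f g) k = (\<integral>x. \<integral>y. of_real (f y) * of_real (g (x - y)) * cis (pairing k x) \<partial>count_space UNIV \<partial>count_space UNIV)"
    unfolding fourier_def conv_def by (simp flip: integral_complex_of_real)
  also have "\<dots> = (\<integral>y. \<integral>x. of_real (f y) * of_real (g (x - y)) * cis (pairing k x) \<partial>count_space UNIV \<partial>count_space UNIV)"
    by (rule P.Fubini_integral) (rule main, simp)
  also have "\<dots> = (\<integral>y. of_real (f y) * cis (pairing k y) * (\<integral>x. of_real (g (x - y)) * cis (pairing k (x - y)) \<partial>count_space UNIV) \<partial>count_space UNIV)"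
  proof (rule Bochner_Integration.integral_cong[OF refl])
    fix y :: "int ^ 'd"
    have "(\<integral>x. of_real (f y) * of_real (g (x - y)) * cis (pairing k x) \<partial>count_space UNIV) =
        (\<integral>x. (of_real (f y) * cis (pairing k y)) * (of_real (g (x - y)) * cis (pairing k (x - y))) \<partial>count_space UNIV)"
    proof (rule Bochner_Integration.integral_cong[OF refl])
      fix x
      have cis: "cis (pairing k x) = cis (pairing k y) * cis (pairing k (x - y))"
        by (simp add: cis_mult)
      show "of_real (f y) * of_real (g (x - y)) * cis (pairing k x) =
          (of_real (f y) * cis (pairing k y)) * (of_real (g (x - y)) * cis (pairing k (x - y)))"
        by (subst cis) (simp only: mult_ac)
    qed
    then show "(\<integral>x. of_real (f y) * of_real (g (x - y)) * cis (pairing k x) \<partial>count_space UNIV) =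
        of_real (f y) * cis (pairing k y) * (\<integral>x. of_real (g (x - y)) * cis (pairing k (x - y)) \<partial>count_space UNIV)"
      by (simp only: integral_mult_right_zero)
  qed
  also have "\<dots> = fourier f k * fourier g k"
    using shift[of "\<lambda>x. complex_of_real (g x) * cis (pairing k x)"] by (simp add: fourier_def)
  finally show ?th1 .
qed

section \<open>The normalised torus and Fourier inversion\<close>

lemma borel_measurable_cis [measurable]:
  "f \<in> borel_measurable M \<Longrightarrow> (\<lambda>x. cis (f x)) \<in> borel_measurable M"
  by (rule measurable_compose[OF _ borel_measurable_continuous_onI]) (auto intro!: continuous_intros)

definition circle_measure :: "real measure" where
  "circle_measure = density lborel (\<lambda>t. ennreal (indicator {-pi..pi} t / (2 * pi)))"

definition torus :: "('d::finite \<Rightarrow> real) measure" where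
  "torus = Pi\<^sub>M UNIV (\<lambda>_. circle_measure)"

lemma sets_circle_measure [simp, measurable_cong]: "sets circle_measure = sets borel"
  by (simp add: circle_measure_def)

lemma space_circle_measure [simp]: "space circle_measure = UNIV"
  by (simp add: circle_measure_def)

lemma prob_space_circle_measure: "prob_space circle_measure"
proof
  have "emeasure circle_measure (space circle_measure) = (\<integral>\<^sup>+t. ennreal (1 / (2 * pi)) * indicator {-pi..pi} t \<partial>lborel)"
    unfolding circle_measure_def
    by (subst emeasure_density) (auto intro!: nn_integral_cong simp: indicator_def)
  also have "\<dots> = ennreal (1 / (2 * pi)) * ennreal (2 * pi)"
    by (subst nn_integral_cmult_indicator) auto
  also have "\<dots> = 1"
    by (subst ennreal_mult[symmetric]) auto
  finally show "emeasure circle_measure (space circle_measure) = 1" .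
qed

interpretation circle: prob_space circle_measure
  by (rule prob_space_circle_measure)

interpretation torus: product_prob_space "\<lambda>_. circle_measure" UNIV
  by standard

lemma prob_space_torus: "prob_space (torus :: ('d::finite \<Rightarrow> real) measure)"
proof -
  interpret finite_product_prob_space "\<lambda>_. circle_measure" "UNIV :: 'd::finite set"
    by standard simp
  show "prob_space (torus :: ('d \<Rightarrow> real) measure)"
    unfolding torus_def by (rule prob_space_axioms)
qed

lemma integral_circle_cis:
  "(\<integral>t. cis (t * real_of_int n) \<partial>circle_measure) = of_bool (n = 0)"
proof -
  have "(\<integral>t. cis (t * real_of_int n) \<partial>circle_measure) = (\<integral>t. (indicator {-pi..pi} t / (2 * pi)) *\<^sub>R cis (t * real_of_int n) \<partial>lborel)"
    unfolding circle_measure_def by (subst integral_density) auto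
  also have "\<dots> = (\<integral>t. (1 / (2 * pi)) *\<^sub>R (indicator {-pi..pi} t *\<^sub>R cis (t * real_of_int n)) \<partial>lborel)"
    by (intro Bochner_Integration.integral_cong) (auto simp: indicator_def)
  also have "\<dots> = (1 / (2 * pi)) *\<^sub>R (\<integral>t. indicator {-pi..pi} t *\<^sub>R cis (t * real_of_int n) \<partial>lborel)"
    by (rule integral_scaleR_right)
  also have "(\<integral>t. indicator {-pi..pi} t *\<^sub>R cis (t * real_of_int n) \<partial>lborel) = 2 * pi * of_bool (n = 0)"
  proof (cases "n = 0")
    case True
    then show ?thesis by (simp add: scaleR_conv_of_real)
  next
    case False
    let ?F = "\<lambda>t. cis (t * real_of_int n) / (\<i> * of_int n)"
    have "(\<integral>t. indicator {-pi..pi} t *\<^sub>R cis (t * real_of_int n) \<partial>lborel) = ?F pi - ?F (-pi)"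
    proof (rule integral_FTC_atLeastAtMost)
      fix t :: real
      have "((\<lambda>t. exp (\<i> * of_int n * t) / (\<i> * of_int n)) has_field_derivative exp (\<i> * of_int n * of_real t)) (at (of_real t))"
        using False by (auto intro!: derivative_eq_intros simp: field_simps)
      from has_vector_derivative_real_field[OF this, of "{-pi..pi}"]
      show "(?F has_vector_derivative cis (t * real_of_int n)) (at t within {-pi..pi})"
        by (simp add: cis_conv_exp mult_ac)
    qed (auto intro!: continuous_intros)
    also have "cis (pi * real_of_int n) = cis (- pi * real_of_int n)"
      by (simp add: complex_eq_iff sin_times_pi_eq_0 mult.commute)
    finally show ?thesis using False by simp
  qed
  finally show ?thesis by (simp add: scaleR_conv_of_real)
qed

lemma integral_torus_cis: "(\<integral>k. cis (pairing k x) \<partial>torus) = of_bool (x = 0)" for x :: "int ^ 'd::finite"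
proof -
  have "cis (pairing k x) = (\<Prod>j\<in>UNIV. cis (k j * real_of_int (x $ j)))" for k
    unfolding pairing_def cis_conv_exp by (simp add: sum_distrib_left exp_sum)
  then have "(\<integral>k. cis (pairing k x) \<partial>torus) = (\<integral>k. (\<Prod>j\<in>UNIV. cis (k j * real_of_int (x $ j))) \<partial>torus)"
    by simp
  also have "\<dots> = (\<Prod>j\<in>UNIV. \<integral>t. cis (t * real_of_int (x $ j)) \<partial>circle_measure)"
    unfolding torus_def
    by (rule torus.product_integral_prod) (auto intro!: circle.integrable_const_bound[where B=1])
  also have "\<dots> = of_bool (x = 0)"
    unfolding integral_circle_cis by (auto simp: vec_eq_iff of_bool_def prod_zero_iff)
  finally show ?thesis .
qed

lemma measurable_pairing [measurable]: "(\<lambda>k. pairing k x) \<in> borel_measurable torus"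
  unfolding pairing_def torus_def by measurable

text \<open>Fourier inversion followed by the triangle inequality. Fubini applies because
  \<open>f\<close> is summable and the torus has mass 1. The bound gives uniqueness of the transform
  and turns momentum estimates into pointwise ones.\<close>

lemma fourier_coeff_le:
  fixes f :: "int ^ 'd::finite \<Rightarrow> real"
  assumes f: "summable_fun f"
  shows "ennreal \<bar>f y\<bar> \<le> (\<integral>\<^sup>+k. ennreal (norm (fourier f k)) \<partial>torus)"
proof -
  interpret T: prob_space "torus :: ('d \<Rightarrow> real) measure" by (rule prob_space_torus)
  interpret C: sigma_finite_measure "count_space (UNIV :: (int ^ 'd) set)"
    by (intro sigma_finite_measure_count_space_countable) auto
  interpret P: pair_sigma_finite "count_space (UNIV :: (int ^ 'd) set)" "torus :: ('d \<Rightarrow> real) measure" ..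
  have int: "integrable (count_space UNIV \<Otimes>\<^sub>M torus) (\<lambda>(x, k). complex_of_real (f x) * cis (pairing k (x - y)))"
  proof (rule P.Fubini_integrable)
    show "(\<lambda>(x, k). complex_of_real (f x) * cis (pairing k (x - y))) \<in> borel_measurable (count_space UNIV \<Otimes>\<^sub>M torus)"
      by (rule measurable_pair_measure_countable1) auto
    show "integrable (count_space UNIV) (\<lambda>x. LINT k|torus. norm (case (x, k) of (x, k) \<Rightarrow> complex_of_real (f x) * cis (pairing k (x - y))))"
      using f by (simp add: norm_mult T.prob_space)
    have "integrable torus (\<lambda>k. complex_of_real (f x) * cis (pairing k (x - y)))" for x
      by (intro T.integrable_const_bound[where B="\<bar>f x\<bar>"]) (auto simp: norm_mult)
    then show "AE x in count_space UNIV. integrable torus (\<lambda>k. case (x, k) of (x, k) \<Rightarrow> complex_of_real (f x) * cis (pairing k (x - y)))"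
      by simp
  qed
  have "(\<integral>k. fourier f k * cis (- pairing k y) \<partial>torus) = (\<integral>k. \<integral>x. complex_of_real (f x) * cis (pairing k (x - y)) \<partial>count_space UNIV \<partial>torus)"
    unfolding fourier_def by (simp add: cis_mult mult_ac flip: integral_mult_right_zero integral_mult_left_zero)
  also have "\<dots> = (\<integral>x. \<integral>k. complex_of_real (f x) * cis (pairing k (x - y)) \<partial>torus \<partial>count_space UNIV)"
    by (rule P.Fubini_integral[OF int])
  also have "\<dots> = (\<integral>x. complex_of_real (f x) * of_bool (x = y) \<partial>count_space UNIV)"
    by (simp add: integral_torus_cis del: pairing_simps)
  also have "\<dots> = complex_of_real (f y)"
  proof -
    have "{a. a = y \<and> f a \<noteq> 0} = (if f y = 0 then {} else {y})" by auto
    then show ?thesis by (subst lebesgue_integral_count_space_finite_support) auto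
  qed
  finally have "ennreal \<bar>f y\<bar> = ennreal (norm (\<integral>k. fourier f k * cis (- pairing k y) \<partial>torus))"
    by simp
  also have "\<dots> \<le> (\<integral>\<^sup>+k. ennreal (norm (fourier f k * cis (- pairing k y))) \<partial>torus)"
  proof (rule integral_norm_bound_ennreal)
    have "integrable torus (\<lambda>k. \<integral>x. complex_of_real (f x) * cis (pairing k (x - y)) \<partial>count_space UNIV)"
      using P.integrable_snd[of "\<lambda>x k. complex_of_real (f x) * cis (pairing k (x - y))"] int by simp
    then show "integrable torus (\<lambda>k. fourier f k * cis (- pairing k y))"
      unfolding fourier_def by (simp add: cis_mult mult_ac flip: integral_mult_right_zero integral_mult_left_zero)
  qed
  finally show ?thesis by (simp add: norm_mult)
qed

section \<open>The Green integral\<close>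

definition energy :: "('d::finite \<Rightarrow> real) \<Rightarrow> real" where
  "energy k = (\<Sum>j\<in>UNIV. 1 - cos (k j))"

lemma energy_nonneg: "0 \<le> energy k"
  unfolding energy_def by (intro sum_nonneg) simp

lemma energy_le: "energy (k :: 'd::finite \<Rightarrow> real) \<le> 2 * real CARD('d)"
proof -
  have "energy k \<le> (\<Sum>j\<in>(UNIV :: 'd set). 2)"
    unfolding energy_def
  proof (rule sum_mono)
    show "1 - cos (k j) \<le> 2" for j using cos_ge_minus_one[of "k j"] by linarith
  qed
  then show ?thesis by simp
qed

lemma one_minus_cos: "1 - cos t = 2 * (sin (t / 2))\<^sup>2" for t :: real
  using cos_double_sin[of "t / 2"] by simp

text \<open>For \<open>s = t / 2\<close> of modulus at most 2 the cubic Taylor error of sine is at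
  most two thirds of \<open>\<bar>s\<bar>\<close>. So \<open>\<bar>sin s\<bar>\<close> is at least a
  third of \<open>\<bar>s\<bar>\<close>, and doubling its square gives the 18.\<close>

lemma one_minus_cos_ge:
  fixes t :: real assumes "\<bar>t\<bar> \<le> pi"
  shows "t\<^sup>2 / 18 \<le> 1 - cos t"
proof -
  define s where "s = t / 2"
  have s: "\<bar>s\<bar> \<le> 2" using assms pi_less_4 by (simp add: s_def)
  have "\<bar>sin s - s\<bar> \<le> \<bar>s\<bar> ^ 3 / 6"
    using Maclaurin_sin_bound[of s 3]
    by (simp add: numeral_eq_Suc sin_coeff_def field_simps)
  also have "\<dots> \<le> \<bar>s\<bar> * (2 * 2) / 6"
  proof -
    have "\<bar>s\<bar> * (\<bar>s\<bar> * \<bar>s\<bar>) \<le> \<bar>s\<bar> * (2 * 2)" using s by (intro mult_mono) auto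
    then show ?thesis by (simp add: power3_eq_cube)
  qed
  finally have "\<bar>s\<bar> / 3 \<le> \<bar>sin s\<bar>" by linarith
  then have "(\<bar>s\<bar> / 3)\<^sup>2 \<le> \<bar>sin s\<bar>\<^sup>2" by (intro power_mono) auto
  then have "s\<^sup>2 / 9 \<le> (sin s)\<^sup>2" by (simp add: power_divide)
  then show ?thesis unfolding one_minus_cos by (simp add: s_def power_divide)
qed

lemma integral_circle_inverse_finite:
  assumes a: "0 < a" "2 * a < 1"
  shows "(\<integral>\<^sup>+t. inverse (ennreal ((1 - cos t) powr a)) \<partial>circle_measure) < \<infinity>"
proof -
  define b where "b = - 2 * a"
  have b: "b > -1" using a by (simp add: b_def)
  have "((\<lambda>t. t powr b) has_integral (pi powr (b + 1) / (b + 1))) {0..pi}"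
    using has_integral_powr_from_0[OF b] by simp
  then have R: "((\<lambda>t. \<bar>t\<bar> powr b) has_integral (pi powr (b + 1) / (b + 1))) {0..pi}"
    by (rule has_integral_eq[rotated]) auto
  then have L: "((\<lambda>t. \<bar>t\<bar> powr b) has_integral (pi powr (b + 1) / (b + 1))) {-pi..0}"
    using has_integral_reflect_real[of "\<lambda>t. \<bar>t\<bar> powr b" _ pi 0] by simp
  have LR: "((\<lambda>t. \<bar>t\<bar> powr b) has_integral (pi powr (b + 1) / (b + 1) + pi powr (b + 1) / (b + 1))) {-pi..pi}"
    using L R by (intro has_integral_combine[where c=0]) auto
  have fin: "(\<integral>\<^sup>+t. ennreal (indicator {-pi..pi} t * \<bar>t\<bar> powr b) \<partial>lborel) < \<infinity>"
    using nn_integral_has_integral_lebesgue[OF _ LR] by simp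
  have bound: "inverse (ennreal ((1 - cos t) powr a)) \<le> ennreal (18 powr a * \<bar>t\<bar> powr b)"
    if t: "\<bar>t\<bar> \<le> pi" "t \<noteq> 0" for t
  proof -
    have "0 < t\<^sup>2 / 18" using t by simp
    then have pos: "0 < 1 - cos t" using one_minus_cos_ge[OF t(1)] by linarith
    have "(t\<^sup>2 / 18) powr a \<le> (1 - cos t) powr a"
      using one_minus_cos_ge[OF t(1)] a by (intro powr_mono2) auto
    moreover have "(t\<^sup>2 / 18) powr a > 0" using t by simp
    ultimately have "inverse ((1 - cos t) powr a) \<le> inverse ((t\<^sup>2 / 18) powr a)"
      by (intro le_imp_inverse_le)
    also have "inverse ((t\<^sup>2 / 18) powr a) = 18 powr a * \<bar>t\<bar> powr b"
    proof -
      have "(t\<^sup>2) powr a = (\<bar>t\<bar> powr 2) powr a"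
        using t by (simp add: powr_numeral)
      also have "\<dots> = \<bar>t\<bar> powr (2 * a)"
        by (rule powr_powr)
      finally show ?thesis by (simp add: powr_divide b_def powr_minus field_simps)
    qed
    finally show ?thesis using pos by (simp add: inverse_ennreal ennreal_leI)
  qed
  have "(\<integral>\<^sup>+t. inverse (ennreal ((1 - cos t) powr a)) \<partial>circle_measure)
      = (\<integral>\<^sup>+t. ennreal (indicator {-pi..pi} t / (2 * pi)) * inverse (ennreal ((1 - cos t) powr a)) \<partial>lborel)"
    unfolding circle_measure_def by (subst nn_integral_density) auto
  also have "\<dots> \<le> (\<integral>\<^sup>+t. ennreal (18 powr a / (2 * pi)) * ennreal (indicator {-pi..pi} t * \<bar>t\<bar> powr b) \<partial>lborel)"
  proof (rule nn_integral_mono_AE)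
    \<comment> \<open>At \<open>t = 0\<close> the left side is infinite while
      \<open>0 powr b = 0\<close>, so the comparison holds only off this null set.\<close>
    have "AE t in lborel. t \<noteq> (0::real)"
      by (rule AE_lborel_singleton)
    then show "AE t in lborel. ennreal (indicator {-pi..pi} t / (2 * pi)) * inverse (ennreal ((1 - cos t) powr a))
        \<le> ennreal (18 powr a / (2 * pi)) * ennreal (indicator {-pi..pi} t * \<bar>t\<bar> powr b)"
    proof eventually_elim
      case (elim t)
      show ?case
      proof (cases "\<bar>t\<bar> \<le> pi")
        case True
        then have "ennreal (1 / (2 * pi)) * inverse (ennreal ((1 - cos t) powr a)) \<le> ennreal (1 / (2 * pi)) * ennreal (18 powr a * \<bar>t\<bar> powr b)"
          using elim by (intro mult_left_mono bound) auto
        also have "\<dots> = ennreal (18 powr a / (2 * pi)) * ennreal (\<bar>t\<bar> powr b)"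
          by (simp add: ennreal_mult[symmetric])
        finally show ?thesis using True by (auto simp: indicator_def abs_le_iff)
      qed (auto simp: indicator_def abs_le_iff)
    qed
  qed
  also have "\<dots> = ennreal (18 powr a / (2 * pi)) * (\<integral>\<^sup>+t. ennreal (indicator {-pi..pi} t * \<bar>t\<bar> powr b) \<partial>lborel)"
    by (rule nn_integral_cmult) auto
  also have "\<dots> < \<infinity>"
    using fin by (simp add: ennreal_mult_less_top)
  finally show ?thesis .
qed

lemma measurable_component_torus [measurable]: "(\<lambda>k. k j) \<in> borel_measurable torus"
  unfolding torus_def by measurable

lemma measurable_energy [measurable]: "energy \<in> borel_measurable torus"
  unfolding energy_def by measurable

lemma ennreal_inverse_prod:
  assumes "finite A" "\<And>x. x \<in> A \<Longrightarrow> f x < top"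
  shows "inverse (\<Prod>x\<in>A. f x :: ennreal) = (\<Prod>x\<in>A. inverse (f x))"
  using assms
proof (induction A)
  case (insert x A)
  then have "(\<Prod>x\<in>A. f x) < top" by (auto simp: less_top[symmetric] ennreal_prod_eq_top)
  then show ?case using insert by (simp add: ennreal_inverse_mult)
qed simp

lemma ennreal_inverse_antimono: "a \<le> b \<Longrightarrow> inverse b \<le> inverse (a :: ennreal)"
  including ennreal.lifting by transfer (simp add: ereal_inverse_antimono)

text \<open>
  Every coordinate contributes at most \<open>energy k\<close>, so \<open>(energy k)\<^sup>2\<close> dominates the product of the
  one-dimensional energies to the power \<open>2 / d\<close>, and the integral factorizes.
\<close>

lemma integral_inverse_energy_finite:
  assumes "CARD('d::finite) > 4"
  shows "(\<integral>\<^sup>+k. inverse (ennreal ((energy (k :: 'd \<Rightarrow> real))\<^sup>2)) \<partial>torus) < \<infinity>"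
proof -
  \<comment> \<open>With this exponent the d factors multiply to the second power of the energy.
    Integrability in one coordinate requires \<open>2 * a < 1\<close>, that is d > 4.\<close>
  define a where "a = 2 / real CARD('d)"
  have a: "0 < a" "2 * a < 1" using assms by (auto simp: a_def field_simps)
  let ?w = "\<lambda>t. inverse (ennreal ((1 - cos t) powr a))"
  have "inverse (ennreal ((energy k)\<^sup>2)) \<le> (\<Prod>j\<in>UNIV. ?w (k j))" for k :: "'d \<Rightarrow> real"
  proof -
    have "(\<Prod>j\<in>UNIV. (1 - cos (k j)) powr a) \<le> (\<Prod>j\<in>(UNIV :: 'd set). energy k powr a)"
    proof (rule prod_mono, safe)
      fix j
      have "1 - cos (k j) \<le> energy k"
        unfolding energy_def by (rule member_le_sum) auto
      then show "(1 - cos (k j)) powr a \<le> energy k powr a"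
        using a by (intro powr_mono2) auto
    qed simp
    also have "\<dots> = (energy k)\<^sup>2"
    proof (cases "energy k = 0")
      case False
      then have "0 < energy k" using energy_nonneg[of k] by simp
      then have "(energy k powr a) ^ CARD('d) = energy k powr (a * real CARD('d))"
        by (simp add: powr_powr[symmetric] powr_realpow)
      also have "a * real CARD('d) = 2" by (simp add: a_def)
      finally show ?thesis using energy_nonneg[of k] by simp
    qed simp
    finally have "ennreal (\<Prod>j\<in>UNIV. (1 - cos (k j)) powr a) \<le> ennreal ((energy k)\<^sup>2)"
      by (rule ennreal_leI)
    then have "inverse (ennreal ((energy k)\<^sup>2)) \<le> inverse (ennreal (\<Prod>j\<in>UNIV. (1 - cos (k j)) powr a))"
      by (rule ennreal_inverse_antimono)
    also have "\<dots> = (\<Prod>j\<in>UNIV. ?w (k j))"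
      by (subst prod_ennreal[symmetric]) (simp_all add: ennreal_inverse_prod)
    finally show ?thesis .
  qed
  then have "(\<integral>\<^sup>+k. inverse (ennreal ((energy (k :: 'd \<Rightarrow> real))\<^sup>2)) \<partial>torus) \<le> (\<integral>\<^sup>+k. (\<Prod>j\<in>(UNIV :: 'd set). ?w (k j)) \<partial>torus)"
    by (intro nn_integral_mono)
  also have "\<dots> = (\<Prod>j\<in>(UNIV :: 'd set). \<integral>\<^sup>+t. ?w t \<partial>circle_measure)"
  proof -
    have "?w \<in> borel_measurable borel" by measurable
    then show ?thesis
      unfolding torus_def by (intro torus.product_nn_integral_prod) (auto cong: measurable_cong_sets)
  qed
  also have "\<dots> < \<infinity>"
    using integral_circle_inverse_finite[OF a] by (simp add: power_less_top_ennreal)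
  finally show ?thesis .
qed

section \<open>Deconvolution\<close>

lemma abs_sin_add_le: "\<bar>sin (a + b)\<bar> \<le> \<bar>sin a\<bar> + \<bar>sin b\<bar>" for a b :: real
proof -
  have "\<bar>sin (a + b)\<bar> \<le> \<bar>sin a\<bar> * \<bar>cos b\<bar> + \<bar>cos a\<bar> * \<bar>sin b\<bar>"
    unfolding sin_add abs_mult[symmetric] by (rule abs_triangle_ineq)
  also have "\<dots> \<le> \<bar>sin a\<bar> * 1 + 1 * \<bar>sin b\<bar>"
    by (intro add_mono mult_mono) auto
  finally show ?thesis by simp
qed

lemma abs_sin_sum_le: "finite A \<Longrightarrow> \<bar>sin (\<Sum>i\<in>A. f i)\<bar> \<le> (\<Sum>i\<in>A. \<bar>sin (f i)\<bar>)" for f :: "'a \<Rightarrow> real"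
proof (induction A rule: finite_induct)
  case (insert x A)
  then show ?case using abs_sin_add_le[of "f x" "sum f A"] by simp
qed simp

lemma abs_sin_nat_mult_le: "\<bar>sin (real n * t)\<bar> \<le> real n * \<bar>sin t\<bar>"
proof (induction n)
  case (Suc n)
  have "\<bar>sin (real (Suc n) * t)\<bar> \<le> \<bar>sin (real n * t)\<bar> + \<bar>sin t\<bar>"
    using abs_sin_add_le[of "real n * t" t] by (simp add: distrib_right add.commute)
  then show ?case using Suc by (simp add: distrib_right)
qed simp

lemma abs_sin_int_mult_le: "\<bar>sin (real_of_int n * t)\<bar> \<le> \<bar>real_of_int n\<bar> * \<bar>sin t\<bar>"
proof (cases n rule: int_cases2)
  case (nonneg m)
  then show ?thesis using abs_sin_nat_mult_le[of m t] by simp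
next
  case (nonpos m)
  then show ?thesis using abs_sin_nat_mult_le[of m t] by simp
qed

lemma sin_half_pairing_le:
  "\<bar>sin (pairing k x / 2)\<bar> \<le> (\<Sum>i\<in>UNIV. \<bar>real_of_int (x $ i)\<bar> * \<bar>sin (k i / 2)\<bar>)"
proof -
  have "\<bar>sin (pairing k x / 2)\<bar> = \<bar>sin (\<Sum>i\<in>UNIV. real_of_int (x $ i) * (k i / 2))\<bar>"
    by (simp add: pairing_def sum_divide_distrib mult.commute)
  also have "\<dots> \<le> (\<Sum>i\<in>UNIV. \<bar>sin (real_of_int (x $ i) * (k i / 2))\<bar>)"
    by (rule abs_sin_sum_le) simp
  also have "\<dots> \<le> (\<Sum>i\<in>UNIV. \<bar>real_of_int (x $ i)\<bar> * \<bar>sin (k i / 2)\<bar>)"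
    by (intro sum_mono abs_sin_int_mult_le)
  finally show ?thesis .
qed

lemma sum_squared_le: "(\<Sum>i\<in>UNIV. a i)\<^sup>2 \<le> real CARD('d) * (\<Sum>i\<in>UNIV. (a i)\<^sup>2)" for a :: "'d::finite \<Rightarrow> real"
  using sum_squared_le_sum_of_squares[of a UNIV] by (simp add: mult.commute)

lemma energy_eq: "energy k = 2 * (\<Sum>i\<in>UNIV. (sin (k i / 2))\<^sup>2)"
  by (simp add: energy_def one_minus_cos sum_distrib_left)

text \<open>Subadditivity of the absolute sine at half angles, then Cauchy-Schwarz, whence the
  factor d. The bound holds for all momenta, and after summation against \<open>P\<close> its right
  side contains only second moments and one-dimensional energies.\<close>

lemma one_minus_cos_pairing_le:
  "1 - cos (pairing k x) \<le> real CARD('d) * (\<Sum>i\<in>UNIV. (real_of_int (x $ i))\<^sup>2 * (1 - cos (k i)))"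
  for x :: "int ^ 'd::finite"
proof -
  have "(sin (pairing k x / 2))\<^sup>2 \<le> (\<Sum>i\<in>UNIV. \<bar>real_of_int (x $ i)\<bar> * \<bar>sin (k i / 2)\<bar>)\<^sup>2"
    using power_mono[OF sin_half_pairing_le, of k x 2] by simp
  also have "\<dots> \<le> real CARD('d) * (\<Sum>i\<in>UNIV. (real_of_int (x $ i))\<^sup>2 * (sin (k i / 2))\<^sup>2)"
    using sum_squared_le[of "\<lambda>i. \<bar>real_of_int (x $ i)\<bar> * \<bar>sin (k i / 2)\<bar>"] by (simp add: power_mult_distrib)
  finally have "2 * (sin (pairing k x / 2))\<^sup>2 \<le> 2 * (real CARD('d) * (\<Sum>i\<in>UNIV. (real_of_int (x $ i))\<^sup>2 * (sin (k i / 2))\<^sup>2))"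
    by simp
  then show ?thesis
    unfolding one_minus_cos by (simp add: sum_distrib_left mult_ac)
qed

section \<open>Transforms of even and odd functions, uniqueness, and first moments\<close>

lemma summable_fun_bound: "summable_fun h \<Longrightarrow> (\<And>x. \<bar>f x\<bar> \<le> h x) \<Longrightarrow> summable_fun f"
  by (rule Bochner_Integration.integrable_bound[of _ h]) (auto intro: order_trans[OF _ abs_ge_self])

lemma summable_fun_finite_support:
  assumes "finite {x. f x \<noteq> 0}" shows "summable_fun f"
proof -
  have "(\<Sum>\<^sup>+x. ennreal \<bar>f x\<bar>) = (\<Sum>x | f x \<noteq> 0. ennreal \<bar>f x\<bar>)"
    using assms by (rule esum_finite_support) auto
  then show ?thesis by (simp add: summable_fun_iff)
qed

lemma Re_fourier: "summable_fun f \<Longrightarrow> Re (fourier f k) = (\<integral>x. f x * cos (pairing k x) \<partial>count_space UNIV)"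
  using integral_Re[OF integrable_fourier[of f k]] by (simp add: fourier_def)

lemma Im_fourier: "summable_fun f \<Longrightarrow> Im (fourier f k) = (\<integral>x. f x * sin (pairing k x) \<partial>count_space UNIV)"
  using integral_Im[OF integrable_fourier[of f k]] by (simp add: fourier_def)

lemma norm_fourier_le: "norm (fourier f k) \<le> (\<integral>x. \<bar>f x\<bar> \<partial>count_space UNIV)"
  using integral_norm_bound[of "count_space UNIV" "\<lambda>x. complex_of_real (f x) * cis (pairing k x)"]
  by (simp add: fourier_def norm_mult)

lemma integral_uminus: "(\<integral>x. h (- x) \<partial>count_space UNIV) = (\<integral>x. h x \<partial>count_space UNIV)"
  for h :: "'a::ab_group_add \<Rightarrow> real"
  by (rule integral_bij_count_space) (rule bij_betw_byWitness[where f'=uminus], auto)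

lemma integral_odd:
  fixes h :: "'a::ab_group_add \<Rightarrow> real"
  assumes "\<And>x. h (- x) = - h x"
  shows "(\<integral>x. h x \<partial>count_space UNIV) = 0"
  using integral_uminus[of h] assms by simp

lemma fourier_even_real:
  assumes "summable_fun f" "\<And>x. f (- x) = f x"
  shows "fourier f k = of_real (Re (fourier f k))"
proof -
  have "Im (fourier f k) = 0"
    unfolding Im_fourier[OF assms(1)] by (rule integral_odd) (simp add: assms)
  then show ?thesis by (simp add: complex_eq_iff)
qed

lemma fourier_odd_imaginary:
  assumes "summable_fun f" "\<And>x. f (- x) = - f x"
  shows "norm (fourier f k) = \<bar>\<integral>x. f x * sin (pairing k x) \<partial>count_space UNIV\<bar>"
proof -
  have "Re (fourier f k) = 0"
    unfolding Re_fourier[OF assms(1)] by (rule integral_odd) (simp add: assms)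
  then show ?thesis by (simp add: cmod_def Im_fourier[OF assms(1)])
qed

text \<open>The difference has vanishing transform, so its values vanish by
  \<open>fourier_coeff_le\<close>.\<close>

lemma fourier_eq_imp_eq:
  fixes f g :: "int ^ 'd::finite \<Rightarrow> real"
  assumes "summable_fun f" "summable_fun g" "\<And>k. fourier f k = fourier g k"
  shows "f x = g x"
proof -
  have "fourier (\<lambda>x. f x - g x) k = 0" for k
    unfolding fourier_def using assms(3)[of k]
    by (simp add: left_diff_distrib integrable_fourier assms fourier_def)
  then have "ennreal \<bar>f x - g x\<bar> \<le> 0"
    using fourier_coeff_le[of "\<lambda>x. f x - g x" x] assms by simp
  then show ?thesis by simp
qed

lemma fourier_delta: "fourier (\<lambda>x. of_bool (x = 0)) k = 1"
proof -
  have "fourier (\<lambda>x. of_bool (x = 0)) k = (\<Sum>x | of_bool (x = 0) * cis (pairing k x) \<noteq> 0. of_bool (x = 0) * cis (pairing k x))"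
    unfolding fourier_def by (subst lebesgue_integral_count_space_finite_support) (auto intro: finite_subset[of _ "{0}"])
  also have "{x. of_bool (x = 0) * cis (pairing k x) \<noteq> 0} = {0}"
    by auto
  finally show ?thesis by simp
qed

abbreviation coord :: "'d \<Rightarrow> int ^ 'd \<Rightarrow> real" where
  "coord j x \<equiv> real_of_int (x $ j)"

lemma summable_coord:
  assumes "summable_fun f" "summable_fun (\<lambda>x. (coord j x)\<^sup>2 * f x)"
  shows "summable_fun (\<lambda>x. coord j x * f x)"
proof (rule summable_fun_bound)
  show "summable_fun (\<lambda>x. \<bar>f x\<bar> + \<bar>(coord j x)\<^sup>2 * f x\<bar>)"
    using assms by simp
  have "\<bar>a\<bar> \<le> 1 + a\<^sup>2" for a :: real
    using sum_squares_bound[of 1 "\<bar>a\<bar>"] by simp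
  then have "\<bar>coord j x\<bar> * \<bar>f x\<bar> \<le> (1 + (coord j x)\<^sup>2) * \<bar>f x\<bar>" for x
    by (intro mult_right_mono) auto
  then show "\<bar>coord j x * f x\<bar> \<le> \<bar>f x\<bar> + \<bar>(coord j x)\<^sup>2 * f x\<bar>" for x
    by (simp add: abs_mult distrib_right)
qed

lemma inj_axis_1: "inj (\<lambda>j::'d::finite. axis j (1::int))"
  by (simp add: inj_def axis_eq_axis)

lemma axis_1_neighbours: "range (\<lambda>j::'d::finite. axis j (1::int)) \<subseteq> neighbours"
  by (auto simp: neighbours_def nearest_neighbour_def axis_def if_distrib cong: if_cong)

lemma card_neighbours_ge: "CARD('d::finite) \<le> card (neighbours :: (int ^ 'd) set)"
  by (rule card_inj_on_le[OF inj_axis_1 axis_1_neighbours finite_neighbours])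

text \<open>
  \<open>J\<close> is the convolution inverse of the Green function \<open>g\<close>, and \<open>P\<close> dominates its deviation from the
  inverse for simple random walk.
\<close>

locale deconvolution =
  fixes g J P :: "int ^ 'd::finite \<Rightarrow> real" and \<beta> m\<^sub>0 m\<^sub>2 N :: real
  assumes g_nonneg: "\<And>x. 0 \<le> g x" and g_0: "1 \<le> g 0" and g_even: "\<And>x. g (- x) = g x"
    and g_summable: "summable_fun g" and g_summable2: "\<And>j. summable_fun (\<lambda>x. (coord j x)\<^sup>2 * g x)"
    and conv_J_g: "\<And>y. conv J g y = of_bool (y = 0)"
    and J_near: "\<And>x. \<bar>J x - (of_bool (x = 0) - \<beta> * of_bool (x \<in> neighbours))\<bar> \<le> P x"
    and P_summable: "summable_fun P" and P_mass: "(\<integral>x. P x \<partial>count_space UNIV) \<le> m\<^sub>0"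
    and P_summable2: "\<And>j. summable_fun (\<lambda>x. (coord j x)\<^sup>2 * P x)"
    and P_mass2: "\<And>j. (\<integral>x. (coord j x)\<^sup>2 * P x \<partial>count_space UNIV) \<le> m\<^sub>2"
    and beta_nonneg: "0 \<le> \<beta>" and N: "N = real (card (neighbours :: (int ^ 'd) set))"
    and m\<^sub>0: "m\<^sub>0 \<le> \<beta> * N / 4" and m\<^sub>2: "real CARD('d) * m\<^sub>2 \<le> \<beta> / 2"
begin

lemma card_le_N: "real CARD('d) \<le> N"
  using card_neighbours_ge by (simp add: N)

lemma N_ge_1: "1 \<le> N"
  using card_le_N by (rule order_trans[rotated]) (simp add: Suc_le_eq)

lemma m\<^sub>2_le: "m\<^sub>2 \<le> \<beta> * N"
proof (cases "m\<^sub>2 \<le> 0")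
  case True
  then show ?thesis using beta_nonneg N_ge_1 by (smt (verit) mult_nonneg_nonneg)
next
  case False
  have "1 \<le> CARD('d)" by (simp add: Suc_le_eq)
  then have "1 * m\<^sub>2 \<le> real CARD('d) * m\<^sub>2" using False by (intro mult_right_mono) auto
  also have "\<dots> \<le> \<beta> * 1" using m\<^sub>2 beta_nonneg by simp
  also have "\<dots> \<le> \<beta> * N" using beta_nonneg N_ge_1 by (intro mult_left_mono)
  finally show ?thesis by simp
qed

lemma integral_neighbours:
  "(\<integral>x. f x * of_bool (x \<in> (neighbours :: (int ^ 'd) set)) \<partial>count_space UNIV) = (\<Sum>e\<in>neighbours. f e)"
  "summable_fun (\<lambda>x. f x * of_bool (x \<in> (neighbours :: (int ^ 'd) set)))"
proof -
  have fin: "finite {x. f x * of_bool (x \<in> (neighbours :: (int ^ 'd) set)) \<noteq> 0}"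
    by (rule finite_subset[OF _ finite_neighbours]) auto
  show "summable_fun (\<lambda>x. f x * of_bool (x \<in> (neighbours :: (int ^ 'd) set)))"
    using fin by (rule summable_fun_finite_support)
  have "(\<integral>x. f x * of_bool (x \<in> (neighbours :: (int ^ 'd) set)) \<partial>count_space UNIV)
      = (\<Sum>x | f x * of_bool (x \<in> (neighbours :: (int ^ 'd) set)) \<noteq> 0. f x * of_bool (x \<in> (neighbours :: (int ^ 'd) set)))"
    using fin by (subst lebesgue_integral_count_space_finite_support) simp_all
  also have "\<dots> = (\<Sum>e\<in>neighbours. f e)"
    by (rule sum.mono_neutral_cong_left) auto
  finally show "(\<integral>x. f x * of_bool (x \<in> (neighbours :: (int ^ 'd) set)) \<partial>count_space UNIV) = (\<Sum>e\<in>neighbours. f e)" .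
qed

lemma integral_delta:
  fixes f :: "int ^ 'd \<Rightarrow> real"
  shows "(\<integral>x. f x * of_bool (x = 0) \<partial>count_space UNIV) = f 0"
  "summable_fun (\<lambda>x::int ^ 'd. f x * of_bool (x = 0))"
proof -
  have fin: "finite {x::int ^ 'd. f x * of_bool (x = 0) \<noteq> 0}"
    by (rule finite_subset[of _ "{0}"]) auto
  show "summable_fun (\<lambda>x::int ^ 'd. f x * of_bool (x = 0))"
    using fin by (rule summable_fun_finite_support)
  have "(\<integral>x. f x * of_bool (x = 0) \<partial>count_space UNIV)
      = (\<Sum>x | f x * of_bool (x = 0) \<noteq> 0. f x * of_bool (x = 0))"
    using fin by (subst lebesgue_integral_count_space_finite_support) simp_all
  also have "\<dots> = (\<Sum>x\<in>{0}. f x * of_bool (x = 0))"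
    by (rule sum.mono_neutral_left) auto
  finally show "(\<integral>x. f x * of_bool (x = 0) \<partial>count_space UNIV) = f 0" by simp
qed

lemma abs_J_le: "\<bar>J x\<bar> \<le> of_bool (x = 0) + \<beta> * of_bool (x \<in> neighbours) + P x"
proof -
  have "0 \<le> \<beta> * of_bool (x \<in> neighbours)" using beta_nonneg by simp
  moreover have "(0::real) \<le> of_bool (x = 0)" by simp
  ultimately show ?thesis using J_near[of x] unfolding abs_le_iff by linarith
qed

lemma P_nonneg: "0 \<le> P x"
  using J_near[of x] by linarith

lemma J_summable: "summable_fun J"
proof (rule summable_fun_bound[OF _ abs_J_le])
  show "summable_fun (\<lambda>x. of_bool (x = 0) + \<beta> * of_bool (x \<in> neighbours) + P x)"
    using integral_delta(2)[of "\<lambda>_. 1"] integral_neighbours(2)[of "\<lambda>_. \<beta>"] P_summable by simp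
qed

lemma coord_sq_J_le:
  "\<bar>(coord j x)\<^sup>2 * J x\<bar> \<le> \<beta> * of_bool (x \<in> neighbours) + (coord j x)\<^sup>2 * P x"
proof -
  have "(coord j x)\<^sup>2 * \<bar>J x\<bar> \<le> (coord j x)\<^sup>2 * (of_bool (x = 0) + \<beta> * of_bool (x \<in> neighbours) + P x)"
    by (intro mult_left_mono abs_J_le) simp
  also have "\<dots> = (coord j x)\<^sup>2 * \<beta> * of_bool (x \<in> neighbours) + (coord j x)\<^sup>2 * P x"
    by (auto simp: algebra_simps)
  also have "(coord j x)\<^sup>2 * \<beta> * of_bool (x \<in> neighbours) \<le> \<beta> * of_bool (x \<in> neighbours)"
  proof (cases "x \<in> neighbours")
    case True
    then have "\<bar>coord j x\<bar> \<le> 1" using neighbours_coord_le[of x j] by linarith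
    then have "(coord j x)\<^sup>2 \<le> 1" by (simp add: abs_square_le_1)
    then show ?thesis using True beta_nonneg by (simp add: mult_right_mono mult_left_le_one_le)
  qed simp
  finally show ?thesis by (simp add: abs_mult)
qed

lemma J_summable2: "summable_fun (\<lambda>x. (coord j x)\<^sup>2 * J x)"
proof (rule summable_fun_bound[OF _ coord_sq_J_le])
  show "summable_fun (\<lambda>x. \<beta> * of_bool (x \<in> neighbours) + (coord j x)\<^sup>2 * P x)"
    using integral_neighbours(2)[of "\<lambda>_. \<beta>"] P_summable2 by simp
qed

lemma J_mass2: "(\<integral>x. \<bar>(coord j x)\<^sup>2 * J x\<bar> \<partial>count_space UNIV) \<le> 2 * \<beta> * N"
proof -
  have "(\<integral>x. \<bar>(coord j x)\<^sup>2 * J x\<bar> \<partial>count_space UNIV)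
      \<le> (\<integral>x. \<beta> * of_bool (x \<in> neighbours) + (coord j x)\<^sup>2 * P x \<partial>count_space UNIV)"
    using integral_neighbours(2)[of "\<lambda>_. \<beta>"] P_summable2 J_summable2
    by (intro integral_mono coord_sq_J_le) auto
  also have "\<dots> = \<beta> * N + (\<integral>x. (coord j x)\<^sup>2 * P x \<partial>count_space UNIV)"
    using integral_neighbours[of "\<lambda>_. \<beta>"] P_summable2 by (simp add: N mult.commute)
  also have "\<dots> \<le> 2 * \<beta> * N"
    using P_mass2[of j] m\<^sub>2_le by linarith
  finally show ?thesis .
qed

section \<open>Positivity and the infrared bound\<close>

lemma fourier_J_g: "fourier J k * fourier g k = 1"
  using fourier_conv(1)[OF J_summable g_summable, of k] fourier_delta[of k]
  by (simp add: conv_J_g[abs_def])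

definition G :: "('d \<Rightarrow> real) \<Rightarrow> real" where "G k = Re (fourier g k)"

lemma fourier_g: "fourier g k = of_real (G k)"
  unfolding G_def using g_summable g_even by (rule fourier_even_real)

lemma G_neq_0: "G k \<noteq> 0"
  using fourier_J_g[of k] by (auto simp: fourier_g)

lemma fourier_J: "fourier J k = of_real (1 / G k)"
  using fourier_J_g[of k] G_neq_0[of k] by (simp add: fourier_g field_simps)

text \<open>The transform of \<open>J\<close> is the inverse of the real \<open>G\<close>, hence
  real, and reflecting a function conjugates its transform. Evenness thus comes from
  \<open>g\<close> and asks for no symmetry of the lace coefficients.\<close>

lemma J_even: "J (- x) = J x"
proof (rule fourier_eq_imp_eq)
  show neg: "summable_fun (\<lambda>x. J (- x))"
    using J_summable integrable_bij_count_space[of uminus UNIV UNIV J]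
    by (simp add: bij_betw_byWitness[where f'=uminus])
  show "summable_fun J" by (rule J_summable)
  fix k
  have "Re (fourier (\<lambda>x. J (- x)) k) = Re (fourier J k)"
    unfolding Re_fourier[OF neg] Re_fourier[OF J_summable]
    using integral_uminus[of "\<lambda>x. J x * cos (pairing k x)"] by simp
  moreover have "Im (fourier (\<lambda>x. J (- x)) k) = - Im (fourier J k)"
    unfolding Im_fourier[OF neg] Im_fourier[OF J_summable]
    using integral_uminus[of "\<lambda>x. J x * sin (pairing k x)"] by simp
  ultimately show "fourier (\<lambda>x. J (- x)) k = fourier J k"
    by (simp add: complex_eq_iff fourier_J)
qed

definition JJ :: "('d \<Rightarrow> real) \<Rightarrow> real" where "JJ k = 1 / G k"

lemma JJ_eq: "JJ k = (\<integral>x. J x * cos (pairing k x) \<partial>count_space UNIV)"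
  using Re_fourier[OF J_summable, of k] by (simp add: fourier_J JJ_def)

lemma summable_cos: "summable_fun f \<Longrightarrow> summable_fun (\<lambda>x. f x * cos (pairing k x))"
  by (rule Bochner_Integration.integrable_bound[of _ f]) (auto simp: abs_mult mult_left_le)

text \<open>At momentum 0 the transform is the susceptibility. This fixes the sign of
  \<open>JJ\<close> at one point, from which \<open>JJ_ge\<close> carries it to all momenta.\<close>

lemma G_0: "1 \<le> G (\<lambda>_. 0)"
proof -
  have "g 0 = (\<integral>x. g x * of_bool (x = 0) \<partial>count_space UNIV)"
    by (rule integral_delta(1)[symmetric])
  also have "\<dots> \<le> (\<integral>x. g x \<partial>count_space UNIV)"
    using g_summable g_nonneg by (intro integral_mono integral_delta(2)) auto
  also have "\<dots> = G (\<lambda>_. 0)"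
    unfolding G_def Re_fourier[OF g_summable] by (simp add: pairing_def)
  finally show ?thesis using g_0 by simp
qed

lemma JJ_near:
  "\<bar>JJ k - (1 - \<beta> * (\<Sum>e\<in>neighbours. cos (pairing k e)))\<bar> \<le> m\<^sub>0"
proof -
  let ?D = "\<lambda>x. J x - (of_bool (x = 0) - \<beta> * of_bool (x \<in> neighbours))"
  have D: "summable_fun ?D"
    by (rule summable_fun_bound[OF P_summable J_near])
  have "JJ k = (\<integral>x. ?D x * cos (pairing k x) + (cos (pairing k x) * of_bool (x = 0)
      - \<beta> * (cos (pairing k x) * of_bool (x \<in> neighbours))) \<partial>count_space UNIV)"
    unfolding JJ_eq by (intro Bochner_Integration.integral_cong) (auto simp: algebra_simps)
  also have "\<dots> = (\<integral>x. ?D x * cos (pairing k x) \<partial>count_space UNIV) + (1 - \<beta> * (\<Sum>e\<in>neighbours. cos (pairing k e)))"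
    using summable_cos[OF D, of k] integral_delta[of "\<lambda>x. cos (pairing k x)"] integral_neighbours[of "\<lambda>x. cos (pairing k x)"]
    by simp
  finally have "JJ k - (1 - \<beta> * (\<Sum>e\<in>neighbours. cos (pairing k e))) = (\<integral>x. ?D x * cos (pairing k x) \<partial>count_space UNIV)"
    by simp
  also have "\<bar>\<dots>\<bar> \<le> (\<integral>x. \<bar>?D x * cos (pairing k x)\<bar> \<partial>count_space UNIV)"
    by (rule integral_abs_bound)
  also have "\<dots> \<le> (\<integral>x. P x \<partial>count_space UNIV)"
  proof (rule integral_mono)
    show "\<bar>?D x * cos (pairing k x)\<bar> \<le> P x" for x
      unfolding abs_mult using J_near[of x] by (smt (verit) abs_cos_le_one abs_ge_zero mult_left_le)
  qed (use summable_cos[OF D] P_summable in auto)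
  also note P_mass
  finally show ?thesis .
qed

text \<open>At momentum 0, \<open>JJ\<close> is nonnegative and at most
  \<open>1 - \<beta> * N + m\<^sub>0\<close>, where \<open>m\<^sub>0\<close> is at most a quarter of
  \<open>\<beta> * N\<close>. The same inequality later shows that the critical point is
  finite.\<close>

lemma beta_N_le: "\<beta> * N \<le> 4 / 3"
proof -
  have "0 \<le> JJ (\<lambda>_. 0)" using G_0 by (simp add: JJ_def)
  then show ?thesis using JJ_near[of "\<lambda>_. 0"] m\<^sub>0 by (simp add: pairing_def N abs_le_iff)
qed

lemma neighbours_energy: "energy (k :: 'd \<Rightarrow> real) \<le> (\<Sum>e\<in>neighbours. 1 - cos (pairing k e))"
proof -
  have "pairing k (axis j 1) = k j" for j
    by (simp add: pairing_def axis_def if_distrib cong: if_cong)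
  then have "energy k = (\<Sum>e\<in>range (\<lambda>j. axis j 1). 1 - cos (pairing k e))"
    using sum.reindex[OF inj_axis_1, of "\<lambda>e. 1 - cos (pairing k e)"] by (simp add: energy_def)
  also have "\<dots> \<le> (\<Sum>e\<in>neighbours. 1 - cos (pairing k e))"
    using axis_1_neighbours by (intro sum_mono2) auto
  finally show ?thesis .
qed

text \<open>In \<open>JJ k - JJ 0\<close> the neighbours contribute at least
  \<open>\<beta> * energy k\<close>, while the deviation dominated by \<open>P\<close> costs at most
  \<open>real CARD('d) * m\<^sub>2 * energy k\<close>. The assumption on \<open>m\<^sub>2\<close>
  lets half of the gain survive.\<close>

lemma JJ_ge: "1 / G (\<lambda>_. 0) + \<beta> / 2 * energy k \<le> JJ k"
proof -
  let ?D = "\<lambda>x. J x - (of_bool (x = 0) - \<beta> * of_bool (x \<in> neighbours))"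
  let ?c = "\<lambda>x. 1 - cos (pairing k x)"
  have D: "summable_fun ?D"
    by (rule summable_fun_bound[OF P_summable J_near])
  have cD: "summable_fun (\<lambda>x. ?D x * ?c x)"
    using summable_cos[OF D, of k] D by (simp only: right_diff_distrib mult_1_right) simp
  have "1 / G (\<lambda>_. 0) - JJ k = (\<integral>x. J x * ?c x \<partial>count_space UNIV)"
    using summable_cos[OF J_summable] J_summable JJ_eq[of "\<lambda>_. 0"]
    by (simp add: JJ_eq right_diff_distrib pairing_def[of "\<lambda>_. 0"] flip: JJ_def)
  also have "\<dots> = (\<integral>x. ?D x * ?c x - \<beta> * (?c x * of_bool (x \<in> neighbours)) \<partial>count_space UNIV)"
    by (intro Bochner_Integration.integral_cong) (auto simp: algebra_simps)
  also have "\<dots> = (\<integral>x. ?D x * ?c x \<partial>count_space UNIV) - \<beta> * (\<Sum>e\<in>neighbours. ?c e)"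
    using cD integral_neighbours[of ?c] by simp
  also have "(\<integral>x. ?D x * ?c x \<partial>count_space UNIV) \<le>
      (\<integral>x. real CARD('d) * (\<Sum>i\<in>UNIV. (coord i x)\<^sup>2 * P x * (1 - cos (k i))) \<partial>count_space UNIV)"
  proof (rule integral_mono)
    fix x
    have "?D x * ?c x \<le> P x * ?c x"
      using J_near[of x] by (intro mult_right_mono) auto
    also have "\<dots> \<le> P x * (real CARD('d) * (\<Sum>i\<in>UNIV. (coord i x)\<^sup>2 * (1 - cos (k i))))"
      by (intro mult_left_mono one_minus_cos_pairing_le P_nonneg)
    finally show "?D x * ?c x \<le> real CARD('d) * (\<Sum>i\<in>UNIV. (coord i x)\<^sup>2 * P x * (1 - cos (k i)))"
      by (simp add: sum_distrib_left mult_ac)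
  qed (use cD P_summable2 in auto)
  also have "\<dots> = real CARD('d) * (\<Sum>i\<in>UNIV. (\<integral>x. (coord i x)\<^sup>2 * P x \<partial>count_space UNIV) * (1 - cos (k i)))"
    using P_summable2 by simp
  also have "\<dots> \<le> real CARD('d) * (\<Sum>i\<in>UNIV. m\<^sub>2 * (1 - cos (k i)))"
    by (intro mult_left_mono sum_mono mult_right_mono P_mass2) auto
  also have "\<dots> = real CARD('d) * m\<^sub>2 * energy k"
    by (simp add: energy_def sum_distrib_left mult_ac)
  also have "\<dots> \<le> \<beta> / 2 * energy k"
    by (intro mult_right_mono m\<^sub>2 energy_nonneg)
  finally show ?thesis
    using mult_left_mono[OF neighbours_energy beta_nonneg, of k] by simp
qed

lemma JJ_pos: "0 < JJ k"
proof -
  have "0 < 1 / G (\<lambda>_. 0)" using G_0 by simp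
  moreover have "0 \<le> \<beta> / 2 * energy k" using beta_nonneg energy_nonneg[of k] by simp
  ultimately show ?thesis using JJ_ge[of k] by linarith
qed

lemma G_pos: "0 < G k"
  using JJ_pos[of k] by (simp add: JJ_def zero_less_divide_iff)

lemma JJ_ge_beta: "\<beta> / 2 * energy k \<le> JJ k"
proof -
  have "0 < 1 / G (\<lambda>_. 0)" using G_0 by simp
  then show ?thesis using JJ_ge[of k] by linarith
qed

text \<open>\<open>JJ_ge\<close> degenerates as \<beta> tends to 0, so small \<beta> is treated
  apart: if \<open>\<beta> * N\<close> is at most 1/4, \<open>JJ_near\<close> gives
  \<open>JJ k \<ge> 1 / 2\<close>, while \<open>energy k \<le> 2 * N\<close>. Otherwise \<beta> is
  at least \<open>1 / (4 * N)\<close>. The constant is therefore uniform in \<beta>.\<close>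

lemma JJ_ge_energy: "energy k / (8 * N) \<le> JJ k"
proof (cases "\<beta> * N \<le> 1 / 4")
  case True
  have "(\<Sum>e\<in>neighbours. cos (pairing k e)) \<le> (\<Sum>e\<in>(neighbours :: (int ^ 'd) set). 1)"
    by (rule sum_mono) simp
  then have "\<beta> * (\<Sum>e\<in>neighbours. cos (pairing k e)) \<le> \<beta> * N"
    using beta_nonneg by (intro mult_left_mono) (simp_all add: N)
  then have "1 / 2 \<le> JJ k" using JJ_near[of k] m\<^sub>0 True by (simp add: abs_le_iff)
  moreover have "energy k / (8 * N) \<le> 1 / 2"
    using energy_le[of k] card_le_N N_ge_1 by (simp add: divide_le_eq)
  ultimately show ?thesis by linarith
next
  case False
  then have "1 \<le> \<beta> * N * 4" by linarith
  then have "1 / (4 * N) \<le> \<beta>" using N_ge_1 by (simp add: divide_le_eq mult_ac)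
  then have "1 / (8 * N) * energy k \<le> \<beta> / 2 * energy k"
    by (intro mult_right_mono energy_nonneg) (simp add: field_simps)
  then show ?thesis using JJ_ge_beta[of k] by simp
qed

lemma G_sq_le: "ennreal ((G k)\<^sup>2) \<le> ennreal (64 * N\<^sup>2) * inverse (ennreal ((energy k)\<^sup>2))"
proof (cases "energy k = 0")
  \<comment> \<open>Here the right side is infinite, since the inverse of 0 in
    \<open>ennreal\<close> is \<open>top\<close>.\<close>
  case True
  then show ?thesis using N_ge_1 by (simp add: ennreal_mult_top)
next
  case False
  then have E: "0 < energy k" using energy_nonneg[of k] by simp
  have "energy k * G k \<le> 8 * N"
    using JJ_ge_energy[of k] G_pos[of k] N_ge_1 by (simp add: JJ_def field_simps)
  then have "G k \<le> 8 * N / energy k" using E by (simp add: field_simps)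
  then have "(G k)\<^sup>2 \<le> (8 * N / energy k)\<^sup>2" using G_pos[of k] by (intro power_mono) auto
  also have "\<dots> = 64 * N\<^sup>2 * inverse ((energy k)\<^sup>2)"
    by (simp add: power_divide power_mult_distrib divide_inverse power_inverse)
  finally show ?thesis
    using E by (simp add: inverse_ennreal ennreal_mult[symmetric] ennreal_leI)
qed

end

definition green_integral :: "'d::finite itself \<Rightarrow> ennreal" where
  "green_integral TYPE('d) = (\<integral>\<^sup>+k. inverse (ennreal ((energy (k :: 'd \<Rightarrow> real))\<^sup>2)) \<partial>torus)"

context deconvolution begin

lemma integral_G_sq_le:
  "(\<integral>\<^sup>+k. ennreal ((G k)\<^sup>2) \<partial>torus) \<le> ennreal (64 * N\<^sup>2) * green_integral TYPE('d)"
proof -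
  have "(\<integral>\<^sup>+k. ennreal ((G k)\<^sup>2) \<partial>torus) \<le> (\<integral>\<^sup>+k. ennreal (64 * N\<^sup>2) * inverse (ennreal ((energy (k :: 'd \<Rightarrow> real))\<^sup>2)) \<partial>torus)"
    by (intro nn_integral_mono G_sq_le)
  also have "\<dots> = ennreal (64 * N\<^sup>2) * green_integral TYPE('d)"
    unfolding green_integral_def by (rule nn_integral_cmult) measurable
  finally show ?thesis .
qed

text \<open>One half of Parseval: by evenness the sum of squares is \<open>conv g g 0\<close>, and
  the transform of \<open>conv g g\<close> is the square of \<open>G\<close>.\<close>

lemma esum_g_sq_le: "(\<Sum>\<^sup>+x. ennreal ((g x)\<^sup>2)) \<le> ennreal (64 * N\<^sup>2) * green_integral TYPE('d)"
proof -
  have sq: "g y * g (0 - y) = (g y)\<^sup>2" for y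
    using g_even[of y] by (simp add: power2_eq_square)
  have int: "summable_fun (\<lambda>y. (g y)\<^sup>2)"
    using fourier_conv(3)[OF g_summable g_summable, of 0] unfolding sq .
  have "(\<Sum>\<^sup>+x. ennreal ((g x)\<^sup>2)) = ennreal (conv g g 0)"
    unfolding esum_def conv_def sq using int by (intro nn_integral_eq_integral) auto
  also have "\<dots> \<le> ennreal \<bar>conv g g 0\<bar>" by (intro ennreal_leI) simp
  also have "\<dots> \<le> (\<integral>\<^sup>+k. ennreal (norm (fourier (conv g g) k)) \<partial>torus)"
    by (intro fourier_coeff_le fourier_conv(2) g_summable)
  also have "\<dots> = (\<integral>\<^sup>+k. ennreal ((G k)\<^sup>2) \<partial>torus)"
    by (simp add: fourier_conv(1)[OF g_summable g_summable] fourier_g norm_mult power2_eq_square)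
  also note integral_G_sq_le
  finally show ?thesis .
qed

section \<open>Second moments of \<open>g\<close> by differentiating the convolution
  identity\<close>

lemma coord_g_summable: "summable_fun (\<lambda>x. coord j x * g x)"
  by (rule summable_coord[OF g_summable g_summable2])

lemma coord_J_summable: "summable_fun (\<lambda>x. coord j x * J x)"
  by (rule summable_coord[OF J_summable J_summable2])

lemma fourier_zero: "fourier (\<lambda>x. 0) k = 0"
  by (simp add: fourier_def)

text \<open>
  Multiplication by a coordinate is a derivation of the convolution algebra. It annihilates
  \<open>conv J g\<close>, which is supported at the origin.
\<close>

lemma fourier_coord:
  "fourier (\<lambda>x. coord j x * J x) k * of_real (G k) + of_real (1 / G k) * fourier (\<lambda>x. coord j x * g x) k = 0"
proof -
  let ?XJ = "\<lambda>x. coord j x * J x" and ?Xg = "\<lambda>x. coord j x * g x"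
  note c1 = fourier_conv[OF coord_J_summable[of j] g_summable]
  note c2 = fourier_conv[OF J_summable coord_g_summable[of j]]
  have "conv ?XJ g x + conv J ?Xg x = coord j x * conv J g x" for x
    using c1(3)[of x] c2(3)[of x] unfolding conv_def
    by (simp add: algebra_simps flip: Bochner_Integration.integral_add integral_mult_right_zero)
  then have "conv ?XJ g x + conv J ?Xg x = 0" for x
    by (cases "x = 0") (simp_all add: conv_J_g)
  then have "fourier (\<lambda>x. conv ?XJ g x + conv J ?Xg x) k = 0"
    by (simp add: fourier_zero)
  then show ?thesis
    using fourier_add[OF c1(2) c2(2), of k] by (simp add: c1(1) c2(1) fourier_g fourier_J)
qed

text \<open>Second-order Leibniz rule, from expanding the square of \<open>y + (x - y)\<close> in
  coordinate \<open>j\<close> inside the convolution.\<close>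

lemma fourier_coord_sq:
  "fourier (\<lambda>x. (coord j x)\<^sup>2 * J x) k * of_real (G k) +
    2 * (fourier (\<lambda>x. coord j x * J x) k * fourier (\<lambda>x. coord j x * g x) k) +
    of_real (1 / G k) * fourier (\<lambda>x. (coord j x)\<^sup>2 * g x) k = 0"
proof -
  let ?XJ = "\<lambda>x. coord j x * J x" and ?Xg = "\<lambda>x. coord j x * g x"
  let ?XXJ = "\<lambda>x. (coord j x)\<^sup>2 * J x" and ?XXg = "\<lambda>x. (coord j x)\<^sup>2 * g x"
  note c1 = fourier_conv[OF J_summable2[of j] g_summable]
  note c2 = fourier_conv[OF coord_J_summable[of j] coord_g_summable[of j]]
  note c3 = fourier_conv[OF J_summable g_summable2[of j]]
  have "conv ?XXJ g x + conv ?XJ ?Xg x + conv ?XJ ?Xg x + conv J ?XXg x = (coord j x)\<^sup>2 * conv J g x" for x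
  proof -
    have "conv ?XXJ g x + conv ?XJ ?Xg x + conv ?XJ ?Xg x + conv J ?XXg x = 
        (\<integral>y. ?XXJ y * g (x - y) + ?XJ y * ?Xg (x - y) + ?XJ y * ?Xg (x - y) + J y * ?XXg (x - y) \<partial>count_space UNIV)"
    proof -
      have "(\<integral>y. a y + b y + b y + c y \<partial>count_space UNIV) = (\<integral>y. a y \<partial>count_space UNIV) +
          (\<integral>y. b y \<partial>count_space UNIV) + (\<integral>y. b y \<partial>count_space UNIV) + (\<integral>y. c y \<partial>count_space UNIV)"
        if "summable_fun a" "summable_fun b" "summable_fun c" for a b c :: "int ^ 'd \<Rightarrow> real"
        using that by simp
      from this[OF c1(3)[of x] c2(3)[of x] c3(3)[of x]] show ?thesis
        unfolding conv_def by (rule sym)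
    qed
    also have "\<dots> = (\<integral>y. (coord j x)\<^sup>2 * (J y * g (x - y)) \<partial>count_space UNIV)"
      by (intro Bochner_Integration.integral_cong) (auto simp: algebra_simps power2_eq_square)
    finally show ?thesis by (simp add: conv_def)
  qed
  then have "conv ?XXJ g x + conv ?XJ ?Xg x + conv ?XJ ?Xg x + conv J ?XXg x = 0" for x
    by (cases "x = 0") (simp_all add: conv_J_g)
  then have "fourier (\<lambda>x. conv ?XXJ g x + conv ?XJ ?Xg x + conv ?XJ ?Xg x + conv J ?XXg x) k = 0"
    by (simp add: fourier_zero)
  moreover have "fourier (\<lambda>x. conv ?XXJ g x + conv ?XJ ?Xg x + conv ?XJ ?Xg x + conv J ?XXg x) k =
      fourier (conv ?XXJ g) k + fourier (conv ?XJ ?Xg) k + fourier (conv ?XJ ?Xg) k + fourier (conv J ?XXg) k"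
    using c1(2) c2(2) c3(2) by (subst fourier_add, simp, simp)+ simp
  ultimately show ?thesis
    by (simp add: c1(1) c2(1) c3(1) fourier_g fourier_J add_ac)
qed

text \<open>As \<open>coord j x * J x\<close> is odd, its transform is a sum against a sine and
  vanishes at momentum 0. The half-angle bound extracts \<open>sin (k i / 2)\<close> together with a
  second factor \<open>\<bar>coord i x\<bar>\<close>, and the product of two coordinates is bounded
  by second moments.\<close>

lemma fourier_coord_J_le:
  "norm (fourier (\<lambda>x. coord j x * J x) k) \<le> 4 * \<beta> * N * (\<Sum>i\<in>UNIV. \<bar>sin (k i / 2)\<bar>)"
proof -
  have "norm (fourier (\<lambda>x. coord j x * J x) k) = \<bar>\<integral>x. coord j x * J x * sin (pairing k x) \<partial>count_space UNIV\<bar>"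
    using coord_J_summable by (rule fourier_odd_imaginary) (simp add: J_even)
  also have "\<dots> \<le> (\<integral>x. \<bar>coord j x * J x * sin (pairing k x)\<bar> \<partial>count_space UNIV)"
    by (rule integral_abs_bound)
  also have "\<dots> \<le> (\<integral>x. (\<Sum>i\<in>UNIV. \<bar>sin (k i / 2)\<bar> * (\<bar>(coord j x)\<^sup>2 * J x\<bar> + \<bar>(coord i x)\<^sup>2 * J x\<bar>)) \<partial>count_space UNIV)"
  proof (rule integral_mono)
    have "summable_fun (\<lambda>x. coord j x * J x * sin (pairing k x))"
      by (rule Bochner_Integration.integrable_bound[OF coord_J_summable[of j]]) (auto simp: abs_mult mult_left_le)
    then show "summable_fun (\<lambda>x. \<bar>coord j x * J x * sin (pairing k x)\<bar>)"
      by simp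
    show "summable_fun (\<lambda>x. \<Sum>i\<in>UNIV. \<bar>sin (k i / 2)\<bar> * (\<bar>(coord j x)\<^sup>2 * J x\<bar> + \<bar>(coord i x)\<^sup>2 * J x\<bar>))"
      using J_summable2 by (intro Bochner_Integration.integrable_sum integrable_mult_right Bochner_Integration.integrable_add integrable_abs)
    fix x
    have "\<bar>sin (pairing k x)\<bar> \<le> 2 * \<bar>sin (pairing k x / 2)\<bar>"
      using sin_double[of "pairing k x / 2"] by (simp add: abs_mult mult_left_le)
    also have "\<dots> \<le> 2 * (\<Sum>i\<in>UNIV. \<bar>coord i x\<bar> * \<bar>sin (k i / 2)\<bar>)"
      using sin_half_pairing_le[of k x] by simp
    finally have "\<bar>coord j x * J x\<bar> * \<bar>sin (pairing k x)\<bar> \<le> \<bar>coord j x * J x\<bar> * (2 * (\<Sum>i\<in>UNIV. \<bar>coord i x\<bar> * \<bar>sin (k i / 2)\<bar>))"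
      by (intro mult_left_mono) auto
    also have "\<dots> = (\<Sum>i\<in>UNIV. \<bar>sin (k i / 2)\<bar> * (2 * \<bar>coord j x\<bar> * \<bar>coord i x\<bar> * \<bar>J x\<bar>))"
      by (simp add: sum_distrib_left abs_mult mult_ac)
    also have "\<dots> \<le> (\<Sum>i\<in>UNIV. \<bar>sin (k i / 2)\<bar> * (((coord j x)\<^sup>2 + (coord i x)\<^sup>2) * \<bar>J x\<bar>))"
      using sum_squares_bound[of "\<bar>coord j x\<bar>" "\<bar>coord _ x\<bar>"]
      by (intro sum_mono mult_left_mono mult_right_mono) auto
    finally show "\<bar>coord j x * J x * sin (pairing k x)\<bar> \<le> (\<Sum>i\<in>UNIV. \<bar>sin (k i / 2)\<bar> * (\<bar>(coord j x)\<^sup>2 * J x\<bar> + \<bar>(coord i x)\<^sup>2 * J x\<bar>))"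
      by (simp add: abs_mult distrib_right)
  qed
  also have "\<dots> = (\<Sum>i\<in>UNIV. \<bar>sin (k i / 2)\<bar> * ((\<integral>x. \<bar>(coord j x)\<^sup>2 * J x\<bar> \<partial>count_space UNIV) + (\<integral>x. \<bar>(coord i x)\<^sup>2 * J x\<bar> \<partial>count_space UNIV)))"
    using J_summable2 by simp
  also have "\<dots> \<le> (\<Sum>i\<in>UNIV. \<bar>sin (k i / 2)\<bar> * (2 * \<beta> * N + 2 * \<beta> * N))"
    by (intro sum_mono mult_left_mono add_mono J_mass2) auto
  finally show ?thesis
    by (simp add: sum_distrib_left mult_ac)
qed

text \<open>Of the two factors \<beta> in the square, one joins the sines to form
  \<open>\<beta> / 2 * energy k\<close>, which is at most \<open>JJ k\<close>; the other is bounded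
  by \<open>beta_N_le\<close>, and 16 times 4/3 is below 22.\<close>

lemma fourier_coord_J_sq_le: "(norm (fourier (\<lambda>x. coord j x * J x) k))\<^sup>2 \<le> 22 * N\<^sup>2 * JJ k"
proof -
  let ?s = "\<Sum>i\<in>UNIV. (sin (k i / 2))\<^sup>2"
  have "(norm (fourier (\<lambda>x. coord j x * J x) k))\<^sup>2 \<le> (4 * \<beta> * N * (\<Sum>i\<in>UNIV. \<bar>sin (k i / 2)\<bar>))\<^sup>2"
    by (intro power_mono fourier_coord_J_le) simp
  also have "\<dots> = 16 * (\<beta> * N)\<^sup>2 * (\<Sum>i\<in>UNIV. \<bar>sin (k i / 2)\<bar>)\<^sup>2"
    by (simp add: power_mult_distrib)
  also have "\<dots> \<le> 16 * (\<beta> * N)\<^sup>2 * (real CARD('d) * ?s)"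
    using sum_squared_le[of "\<lambda>i. \<bar>sin (k i / 2)\<bar>"] by (intro mult_left_mono) auto
  also have "\<dots> \<le> 16 * (\<beta> * N)\<^sup>2 * (N * ?s)"
    by (intro mult_left_mono mult_right_mono card_le_N sum_nonneg) auto
  also have "\<dots> = 16 * (\<beta> * N) * N\<^sup>2 * (\<beta> / 2 * energy k)"
    by (simp add: energy_eq power2_eq_square)
  also have "\<dots> \<le> 16 * (\<beta> * N) * N\<^sup>2 * JJ k"
    using beta_nonneg N_ge_1 by (intro mult_left_mono JJ_ge_beta) auto
  also have "\<dots> \<le> 22 * N\<^sup>2 * JJ k"
  proof (intro mult_right_mono)
    show "16 * (\<beta> * N) \<le> 22" using beta_N_le by linarith
  qed (use JJ_pos[of k] in auto)
  finally show ?thesis .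
qed

text \<open>\<open>fourier_coord\<close> is solved for the first moment of \<open>g\<close> and
  inserted into \<open>fourier_coord_sq\<close>. In the cubic term the factor
  \<open>JJ k = 1 / G k\<close> lowers the power of \<open>G\<close> to 2 and leaves 2 times 22; the
  other term adds 3, an upper bound for \<open>2 * \<beta> * N\<close>.\<close>

lemma fourier_coord_sq_g_le: "norm (fourier (\<lambda>x. (coord j x)\<^sup>2 * g x) k) \<le> 47 * N\<^sup>2 * (G k)\<^sup>2"
proof -
  let ?A = "fourier (\<lambda>x. (coord j x)\<^sup>2 * J x) k" and ?B = "fourier (\<lambda>x. coord j x * J x) k"
  let ?C = "fourier (\<lambda>x. coord j x * g x) k" and ?D = "fourier (\<lambda>x. (coord j x)\<^sup>2 * g x) k"
  let ?G = "complex_of_real (G k)"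
  have G: "?G \<noteq> 0" using G_neq_0 by simp
  have C: "?C = - (?G\<^sup>2 * ?B)"
    using fourier_coord[of j k] G by (simp add: field_simps power2_eq_square eq_neg_iff_add_eq_0)
  have "?D = 2 * ?G ^ 3 * ?B\<^sup>2 - ?G\<^sup>2 * ?A"
  proof -
    have "?A * ?G + 2 * (?B * ?C) + 1 / ?G * ?D = 0"
      using fourier_coord_sq[of j k] by simp
    then have "?G * (?A * ?G + 2 * (?B * ?C) + 1 / ?G * ?D) = 0" by simp
    then have "?A * ?G\<^sup>2 + 2 * (?B * ?C) * ?G + ?D = 0"
      using G by (simp add: distrib_left power2_eq_square mult_ac)
    then show ?thesis
      unfolding C by (simp add: algebra_simps power2_eq_square power3_eq_cube eq_neg_iff_add_eq_0)
  qed
  then have "norm ?D \<le> norm (2 * ?G ^ 3 * ?B\<^sup>2) + norm (?G\<^sup>2 * ?A)"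
    using norm_triangle_ineq4 by simp
  also have "\<dots> = 2 * (G k) ^ 3 * (norm ?B)\<^sup>2 + (G k)\<^sup>2 * norm ?A"
    using G_pos[of k] by (simp add: norm_mult norm_power)
  also have "\<dots> \<le> 2 * (G k) ^ 3 * (22 * N\<^sup>2 * JJ k) + (G k)\<^sup>2 * (3 * N\<^sup>2)"
  proof (intro add_mono mult_left_mono fourier_coord_J_sq_le)
    have "norm ?A \<le> 2 * \<beta> * N" using norm_fourier_le J_mass2 by (rule order_trans)
    also have "\<dots> \<le> 3 * 1" using beta_N_le by simp
    also have "\<dots> \<le> 3 * N\<^sup>2" using N_ge_1 by (intro mult_left_mono) auto
    finally show "norm ?A \<le> 3 * N\<^sup>2" .
  qed (use G_pos[of k] in auto)
  also have "2 * (G k) ^ 3 * (22 * N\<^sup>2 * JJ k) = 44 * N\<^sup>2 * (G k)\<^sup>2"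
    using G_pos[of k] by (simp add: JJ_def field_simps power2_eq_square power3_eq_cube)
  finally show ?thesis by simp
qed

lemma coord_sq_g_le:
  "ennreal ((coord j x)\<^sup>2 * g x) \<le> ennreal (3008 * N ^ 4) * green_integral TYPE('d)"
proof -
  have "ennreal ((coord j x)\<^sup>2 * g x) = ennreal \<bar>(coord j x)\<^sup>2 * g x\<bar>"
    using g_nonneg by simp
  also have "\<dots> \<le> (\<integral>\<^sup>+k. ennreal (norm (fourier (\<lambda>x. (coord j x)\<^sup>2 * g x) k)) \<partial>torus)"
    using g_summable2 by (rule fourier_coeff_le)
  also have "\<dots> \<le> (\<integral>\<^sup>+k. ennreal (47 * N\<^sup>2) * (ennreal (64 * N\<^sup>2) * inverse (ennreal ((energy (k :: 'd \<Rightarrow> real))\<^sup>2))) \<partial>torus)"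
  proof (rule nn_integral_mono)
    fix k :: "'d \<Rightarrow> real"
    have "ennreal (norm (fourier (\<lambda>x. (coord j x)\<^sup>2 * g x) k)) \<le> ennreal (47 * N\<^sup>2 * (G k)\<^sup>2)"
      by (intro ennreal_leI fourier_coord_sq_g_le)
    also have "\<dots> = ennreal (47 * N\<^sup>2) * ennreal ((G k)\<^sup>2)"
      by (simp add: ennreal_mult)
    also have "\<dots> \<le> ennreal (47 * N\<^sup>2) * (ennreal (64 * N\<^sup>2) * inverse (ennreal ((energy k)\<^sup>2)))"
      by (intro mult_left_mono G_sq_le) simp
    finally show "ennreal (norm (fourier (\<lambda>x. (coord j x)\<^sup>2 * g x) k)) \<le>
        ennreal (47 * N\<^sup>2) * (ennreal (64 * N\<^sup>2) * inverse (ennreal ((energy k)\<^sup>2)))" .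
  qed
  also have "\<dots> = ennreal (47 * N\<^sup>2) * (ennreal (64 * N\<^sup>2) * green_integral TYPE('d))"
  proof -
    have "(\<lambda>k :: 'd \<Rightarrow> real. inverse (ennreal ((energy k)\<^sup>2))) \<in> borel_measurable torus" by measurable
    then show ?thesis by (simp add: green_integral_def nn_integral_cmult)
  qed
  \<comment> \<open>47 times 64 is 3008.\<close>
  also have "\<dots> = ennreal (3008 * N ^ 4) * green_integral TYPE('d)"
    by (simp add: mult.assoc[symmetric] ennreal_mult[symmetric] power2_eq_square power4_eq_xxxx)
  finally show ?thesis .
qed

end

section \<open>Smallness of the lace coefficients\<close>

lemma esum_even_odd: "esum f = (\<Sum>\<^sup>+n::nat. f (2 * n)) + (\<Sum>\<^sup>+n. f (2 * n + 1))"
proof -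
  have "(\<Sum>\<^sup>+n. f (2 * n)) = (\<Sum>\<^sup>+n. f n * of_bool (n \<in> range (\<lambda>n. 2 * n)))"
    by (rule esum_inj) (simp add: inj_def)
  moreover have "(\<Sum>\<^sup>+n. f (2 * n + 1)) = (\<Sum>\<^sup>+n. f n * of_bool (n \<in> range (\<lambda>n. 2 * n + 1)))"
    by (rule esum_inj) (simp add: inj_def)
  moreover have "f n = f n * of_bool (n \<in> range (\<lambda>n. 2 * n)) + f n * of_bool (n \<in> range (\<lambda>n. 2 * n + 1))" for n
  proof -
    have "n \<in> range (\<lambda>n. 2 * n) \<longleftrightarrow> even n" by auto
    moreover have "n \<in> range (\<lambda>n. 2 * n + 1) \<longleftrightarrow> odd n" by (auto elim: oddE)
    ultimately show ?thesis by simp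
  qed
  then have "esum f = (\<Sum>\<^sup>+n. f n * of_bool (n \<in> range (\<lambda>n. 2 * n)) + f n * of_bool (n \<in> range (\<lambda>n. 2 * n + 1)))"
    by (rule esum_cong)
  ultimately show ?thesis by (simp only: esum_add)
qed

lemma esum_geometric_half: "(\<Sum>\<^sup>+n. inverse 2 ^ n) = 2"
proof -
  have "(\<lambda>n. (1 / 2) ^ n) sums (1 / (1 - 1 / 2 :: real))"
    by (rule geometric_sums) simp
  then have "(\<Sum>n. ennreal ((1 / 2) ^ n)) = ennreal (1 / (1 - 1 / 2))"
    by (intro suminf_ennreal_eq) auto
  then show ?thesis by (simp add: esum_nat flip: ennreal_power)
qed

lemma esum_eq_integral:
  assumes "(\<Sum>\<^sup>+x. f x) < \<infinity>"
  shows "summable_fun (\<lambda>x. enn2real (f x))" "ennreal (\<integral>x. enn2real (f x) \<partial>count_space UNIV) = esum f"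
    "ennreal (enn2real (f x)) = f x"
proof -
  have fin: "f x < \<infinity>" for x
    using esum_ge[of f x] assms by (rule le_less_trans)
  then have eq: "ennreal (enn2real (f x)) = f x" for x by simp
  then show "ennreal (enn2real (f x)) = f x" .
  show s: "summable_fun (\<lambda>x. enn2real (f x))"
    using assms by (simp add: summable_fun_iff eq)
  have "ennreal (\<integral>x. enn2real (f x) \<partial>count_space UNIV) = (\<Sum>\<^sup>+x. ennreal (enn2real (f x)))"
    unfolding esum_def by (rule nn_integral_eq_integral[symmetric]) (use s in auto)
  then show "ennreal (\<integral>x. enn2real (f x) \<partial>count_space UNIV) = esum f"
    by (simp only: eq)
qed

context wsaw begin

text \<open>All coefficients except the random-walk term, summed without signs. This majorant of Pi
  plays the part of \<open>P\<close> in the deconvolution.\<close>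

definition lace_tail :: "int ^ 'd::finite \<Rightarrow> ennreal" where
  "lace_tail x = (\<Sum>\<^sup>+n. lace_coeff (Suc n) x)"

lemma lace_tail_eq: "lace_tail x = lace_odd x + (\<Sum>\<^sup>+n. lace_coeff (Suc (2 * n + 1)) x)"
  unfolding lace_tail_def lace_odd_def by (subst esum_even_odd) simp

lemma lace_even_eq: "lace_even x = ennreal \<beta> * of_bool (x \<in> neighbours) + (\<Sum>\<^sup>+n. lace_coeff (Suc (2 * n + 1)) x)"
  unfolding lace_even_def by (subst esum_nat_Suc) (simp add: lace_coeff_0)

lemma esum_neighbours: "(\<Sum>\<^sup>+e::int ^ 'd::finite. of_bool (e \<in> neighbours)) = ennreal (real (card (neighbours :: (int ^ 'd) set)))"
proof -
  have "(\<Sum>\<^sup>+e::int ^ 'd. of_bool (e \<in> neighbours)) = (\<Sum>e\<in>(neighbours :: (int ^ 'd) set). of_bool (e \<in> neighbours))"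
    by (rule esum_finite_support) auto
  then show ?thesis by (simp add: ennreal_of_nat_eq_real_of_nat)
qed

text \<open>One statement for mass and second moment: it is applied with \<open>f = 1\<close> and
  with \<open>f = sq j\<close>. The leading 2 is the sum of the geometric series of ratio
  1/2.\<close>

lemma esum_lace_tail_le:
  fixes f :: "int ^ 'd::finite \<Rightarrow> ennreal"
  assumes "\<And>n e. (\<Sum>\<^sup>+x. f x * diagram n e 0 x) \<le> ennreal H * ennreal (1 / 2) ^ n" and "0 \<le> H"
  shows "(\<Sum>\<^sup>+x. f x * lace_tail x) \<le> ennreal (2 * (\<beta> * lam * real (card (neighbours :: (int ^ 'd) set)) * H))"
proof -
  let ?N = "real (card (neighbours :: (int ^ 'd) set))"
  have "(\<Sum>\<^sup>+x. f x * lace_coeff (Suc n) x) \<le> ennreal (\<beta> * lam) * (ennreal ?N * (ennreal H * ennreal (1 / 2) ^ n))" for n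
  proof -
    have "(\<Sum>\<^sup>+x. f x * lace_coeff (Suc n) x) \<le> (\<Sum>\<^sup>+x. f x * (ennreal (\<beta> * lam) * (\<Sum>\<^sup>+e. of_bool (e \<in> neighbours) * diagram n e 0 x)))"
      by (intro esum_mono mult_left_mono lace_coeff_Suc_le) simp
    also have "\<dots> = (\<Sum>\<^sup>+x. \<Sum>\<^sup>+e. ennreal (\<beta> * lam) * (of_bool (e \<in> neighbours) * (f x * diagram n e 0 x)))"
      unfolding esum_cmult[symmetric] by (simp only: mult_ac)
    also have "\<dots> = (\<Sum>\<^sup>+e. \<Sum>\<^sup>+x. ennreal (\<beta> * lam) * (of_bool (e \<in> neighbours) * (f x * diagram n e 0 x)))"
      by (rule esum_swap)
    also have "\<dots> = ennreal (\<beta> * lam) * (\<Sum>\<^sup>+e. of_bool (e \<in> neighbours) * (\<Sum>\<^sup>+x. f x * diagram n e 0 x))"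
      by (simp only: esum_cmult)
    also have "\<dots> \<le> ennreal (\<beta> * lam) * (\<Sum>\<^sup>+e::int ^ 'd. of_bool (e \<in> neighbours) * (ennreal H * ennreal (1 / 2) ^ n))"
      by (intro mult_left_mono esum_mono assms) auto
    finally show ?thesis
      by (simp only: esum_multc esum_neighbours)
  qed
  then have "(\<Sum>\<^sup>+n. \<Sum>\<^sup>+x. f x * lace_coeff (Suc n) x) \<le> (\<Sum>\<^sup>+n. ennreal (\<beta> * lam) * (ennreal ?N * (ennreal H * ennreal (1 / 2) ^ n)))"
    by (rule esum_mono)
  also have "\<dots> = ennreal (2 * (\<beta> * lam * ?N * H))"
    using lam beta \<open>0 \<le> H\<close>
    by (simp add: esum_cmult esum_geometric_half ennreal_mult mult_ac)
  finally have "(\<Sum>\<^sup>+n. \<Sum>\<^sup>+x. f x * lace_coeff (Suc n) x) \<le> ennreal (2 * (\<beta> * lam * ?N * H))" .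
  moreover have "(\<Sum>\<^sup>+x. f x * lace_tail x) = (\<Sum>\<^sup>+n. \<Sum>\<^sup>+x. f x * lace_coeff (Suc n) x)"
    unfolding lace_tail_def esum_cmult[symmetric] by (rule esum_swap)
  ultimately show ?thesis by simp
qed

lemma sq_eq: "sq j x = ennreal ((coord j x)\<^sup>2)"
  by (simp add: sq_def)

text \<open>The three smallness conditions have separate purposes: the first makes the weighted
  ratio \<open>3 * rate\<close> at most 1/2, the second is the bound required of
  \<open>m\<^sub>0\<close>, the third the one required of \<open>m\<^sub>2\<close>.\<close>

lemma deconvolution_wsaw:
  fixes C :: real
  defines "N \<equiv> real (card (neighbours :: (int ^ 'd::finite) set))"
  assumes chi: "(\<Sum>\<^sup>+x::int ^ 'd. green 0 x) < \<infinity>"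
    and chi2: "\<And>j. (\<Sum>\<^sup>+x::int ^ 'd. sq j x * green 0 x) < \<infinity>"
    and C: "0 \<le> C" "bubble TYPE('d) \<le> ennreal C" "\<And>j (x :: int ^ 'd). sq j x * green 0 x \<le> ennreal C"
    and small: "12 * lam * C \<le> 1" "8 * lam * (1 + C) \<le> 1" "4 * real CARD('d) * lam * N * C \<le> 1"
  shows "deconvolution (\<lambda>x :: int ^ 'd. enn2real (green 0 x))
    (\<lambda>x. of_bool (x = 0) + enn2real (lace_odd x) - enn2real (lace_even x))
    (\<lambda>x. enn2real (lace_tail x)) \<beta> (2 * (\<beta> * lam * N * (1 + C))) (2 * (\<beta> * lam * N * C)) N"
proof -
  let ?g = "\<lambda>x :: int ^ 'd. enn2real (green 0 x)" and ?P = "\<lambda>x :: int ^ 'd. enn2real (lace_tail x)"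
  have N: "0 \<le> N" by (simp add: N_def)
  have rate: "3 * rate TYPE('d) \<le> ennreal (1 / 2)"
  proof -
    have "3 * rate TYPE('d) \<le> 3 * (ennreal lam * (2 * ennreal C))"
      unfolding rate_def by (intro mult_left_mono C) auto
    also have "\<dots> = ennreal (6 * lam * C)"
      using lam C by (simp add: ennreal_mult mult_ac)
    also have "\<dots> \<le> ennreal (1 / 2)"
      using small by (intro ennreal_leI) simp
    finally show ?thesis .
  qed
  have rate1: "rate TYPE('d) \<le> ennreal (1 / 2)"
  proof -
    have "1 * rate TYPE('d) \<le> 3 * rate TYPE('d)" by (intro mult_right_mono) auto
    then show ?thesis using rate by simp
  qed
  have "(\<Sum>\<^sup>+x::int ^ 'd. 1 * lace_tail x) \<le> ennreal (2 * (\<beta> * lam * N * (1 + C)))"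
    unfolding N_def
  proof (rule esum_lace_tail_le)
    fix n and e :: "int ^ 'd"
    have "(\<Sum>\<^sup>+x. 1 * diagram n e 0 x) \<le> rate TYPE('d) ^ n * (1 + bubble TYPE('d))"
      using order_trans[OF esum_diagram_le mass_le] by simp
    also have "\<dots> \<le> ennreal (1 / 2) ^ n * (1 + ennreal C)"
      by (intro mult_mono power_mono add_left_mono rate1 C) auto
    finally show "(\<Sum>\<^sup>+x. 1 * diagram n e 0 x) \<le> ennreal (1 + C) * ennreal (1 / 2) ^ n"
      using C by (simp add: mult_ac)
  qed (use C in simp)
  then have tail: "esum (lace_tail :: int ^ 'd \<Rightarrow> ennreal) \<le> ennreal (2 * (\<beta> * lam * N * (1 + C)))"
    by simp
  have tail2: "(\<Sum>\<^sup>+x::int ^ 'd. sq j x * lace_tail x) \<le> ennreal (2 * (\<beta> * lam * N * C))" for j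
    unfolding N_def
  proof (rule esum_lace_tail_le)
    fix n and e :: "int ^ 'd"
    have "(\<Sum>\<^sup>+x. sq j x * diagram n e 0 x) \<le> ennreal C * (3 * rate TYPE('d)) ^ n"
      \<comment> \<open>The weight is measured from the origin, the second endpoint of the diagram,
        so the second half of the lemma applies.\<close>
      using weighted_diagram_le[OF C(3), of j e n 0] by simp
    also have "\<dots> \<le> ennreal C * ennreal (1 / 2) ^ n"
      by (intro mult_left_mono power_mono rate) auto
    finally show "(\<Sum>\<^sup>+x. sq j x * diagram n e 0 x) \<le> ennreal C * ennreal (1 / 2) ^ n" .
  qed (use C in simp)
  have tail_fin: "esum (lace_tail :: int ^ 'd \<Rightarrow> ennreal) < \<infinity>"
    using tail by (rule le_less_trans) simp
  have tail2_fin: "(\<Sum>\<^sup>+x::int ^ 'd. sq j x * lace_tail x) < \<infinity>" for j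
    using tail2 by (rule le_less_trans) simp
  note g = esum_eq_integral[OF chi] and P = esum_eq_integral[OF tail_fin]
  have g2: "summable_fun (\<lambda>x. (coord j x)\<^sup>2 * ?g x)" for j
    using esum_eq_integral(1)[OF chi2[of j]] by (simp add: sq_eq enn2real_mult)
  have P2: "summable_fun (\<lambda>x. (coord j x)\<^sup>2 * ?P x)"
    "ennreal (\<integral>x. (coord j x)\<^sup>2 * ?P x \<partial>count_space UNIV) \<le> ennreal (2 * (\<beta> * lam * N * C))" for j
    using esum_eq_integral(1,2)[OF tail2_fin[of j]] tail2[of j] by (simp_all add: sq_eq enn2real_mult)
  have odd_le: "lace_odd x \<le> lace_tail x" for x :: "int ^ 'd"
    unfolding lace_tail_eq by simp
  have even_le: "lace_even x \<le> ennreal \<beta> * of_bool (x \<in> neighbours) + lace_tail x" for x :: "int ^ 'd"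
    unfolding lace_tail_eq lace_even_eq by (intro add_left_mono) simp
  have odd_fin: "esum (lace_odd :: int ^ 'd \<Rightarrow> ennreal) < \<infinity>"
    using esum_mono[OF odd_le] tail_fin by (rule le_less_trans)
  have even_fin: "esum (lace_even :: int ^ 'd \<Rightarrow> ennreal) < \<infinity>"
  proof -
    have "esum (lace_even :: int ^ 'd \<Rightarrow> ennreal) \<le> (\<Sum>\<^sup>+x::int ^ 'd. ennreal \<beta> * of_bool (x \<in> neighbours) + lace_tail x)"
      by (intro esum_mono even_le)
    also have "\<dots> = ennreal \<beta> * ennreal N + esum (lace_tail :: int ^ 'd \<Rightarrow> ennreal)"
      by (simp add: esum_add esum_cmult esum_neighbours N_def)
    also have "\<dots> < \<infinity>" using tail_fin by (simp add: ennreal_mult_less_top)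
    finally show ?thesis .
  qed
  \<comment> \<open>Transfer from \<open>ennreal\<close> to real convolutions: a summable kernel
    against a Green function whose values are at most the finite susceptibility.\<close>
  have convolve: "summable_fun (\<lambda>x. enn2real (a x) * ?g (y - x)) \<and>
      ennreal (\<integral>x. enn2real (a x) * ?g (y - x) \<partial>count_space UNIV) = (\<Sum>\<^sup>+x. a x * green x y)"
    if a: "esum a < \<infinity>" for a and y :: "int ^ 'd"
  proof -
    have "(\<Sum>\<^sup>+x. a x * green x y) \<le> (\<Sum>\<^sup>+x. a x * (\<Sum>\<^sup>+x::int ^ 'd. green 0 x))"
      unfolding green_translate[of _ y] by (intro esum_mono mult_left_mono esum_ge) auto
    also have "\<dots> < \<infinity>" using a chi by (simp add: esum_multc ennreal_mult_less_top)
    finally have "(\<Sum>\<^sup>+x. a x * green x y) < \<infinity>" .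
    from esum_eq_integral(1,2)[OF this] show ?thesis
      by (simp add: enn2real_mult green_translate[of _ y])
  qed
  show ?thesis
  proof
    show "0 \<le> ?g x" for x by simp
    have "1 \<le> green 0 (0 :: int ^ 'd)"
      unfolding green_eq_delta_plus[of 0] by simp
    then have "ennreal 1 \<le> ennreal (?g 0)" unfolding g(3) by simp
    then show "1 \<le> ?g 0" by (subst (asm) ennreal_le_iff) auto
    show "?g (- x) = ?g x" for x by (simp add: green_uminus)
    show "summable_fun ?g" by (rule g)
    show "summable_fun (\<lambda>x. (coord j x)\<^sup>2 * ?g x)" for j by (rule g2)
    show "conv (\<lambda>x. of_bool (x = 0) + enn2real (lace_odd x) - enn2real (lace_even x)) ?g y = of_bool (y = 0)" for y
    proof -
      let ?O = "\<integral>x. enn2real (lace_odd x) * ?g (y - x) \<partial>count_space UNIV"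
      let ?E = "\<integral>x. enn2real (lace_even x) * ?g (y - x) \<partial>count_space UNIV"
      note O = convolve[OF odd_fin, of y] and E = convolve[OF even_fin, of y]
      have nonneg: "0 \<le> ?O" "0 \<le> ?E" by (auto intro!: integral_nonneg_AE)
      have "ennreal (?g y + ?O) = ennreal (of_bool (y = 0) + ?E)"
        using lace_expansion[of y] O E nonneg g(3)[of y] by (cases "y = 0") auto
      then have eq: "?g y + ?O = of_bool (y = 0) + ?E"
        using nonneg by (subst (asm) ennreal_inj) auto
      have delta: "summable_fun (\<lambda>x. of_bool (x = 0) * ?g (y - x))"
        "(\<integral>x. of_bool (x = 0) * ?g (y - x) \<partial>count_space UNIV) = ?g y"
      proof -
        have fin: "finite {x. of_bool (x = 0) * ?g (y - x) \<noteq> 0}"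
          by (rule finite_subset[of _ "{0}"]) auto
        then show "summable_fun (\<lambda>x. of_bool (x = 0) * ?g (y - x))"
          by (rule summable_fun_finite_support)
        have "(\<integral>x. of_bool (x = 0) * ?g (y - x) \<partial>count_space UNIV)
            = (\<Sum>x | of_bool (x = 0) * ?g (y - x) \<noteq> 0. of_bool (x = 0) * ?g (y - x))"
          using fin by (subst lebesgue_integral_count_space_finite_support) simp_all
        also have "\<dots> = (\<Sum>x\<in>{0}. of_bool (x = 0) * ?g (y - x))"
          by (rule sum.mono_neutral_left) auto
        finally show "(\<integral>x. of_bool (x = 0) * ?g (y - x) \<partial>count_space UNIV) = ?g y" by simp
      qed
      have "conv (\<lambda>x. of_bool (x = 0) + enn2real (lace_odd x) - enn2real (lace_even x)) ?g y =
          (\<integral>x. of_bool (x = 0) * ?g (y - x) + enn2real (lace_odd x) * ?g (y - x) - enn2real (lace_even x) * ?g (y - x) \<partial>count_space UNIV)"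
        unfolding conv_def by (simp only: distrib_right left_diff_distrib)
      also have "\<dots> = ?g y + ?O - ?E"
      proof -
        have "(\<integral>x. a x + b x - c x \<partial>count_space UNIV) = (\<integral>x. a x \<partial>count_space UNIV) +
            (\<integral>x. b x \<partial>count_space UNIV) - (\<integral>x. c x \<partial>count_space UNIV)"
          if "summable_fun a" "summable_fun b" "summable_fun c" for a b c :: "int ^ 'd \<Rightarrow> real"
          using that by simp
        from this[OF delta(1) O[THEN conjunct1] E[THEN conjunct1]] show ?thesis
          by (simp only: delta(2))
      qed
      finally show ?thesis using eq by simp
    qed
    show "\<bar>of_bool (x = 0) + enn2real (lace_odd x) - enn2real (lace_even x) - (of_bool (x = 0) - \<beta> * of_bool (x \<in> neighbours))\<bar> \<le> ?P x" for x
    proof -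
      let ?e = "\<Sum>\<^sup>+n. lace_coeff (Suc (2 * n + 1)) x"
      have fin: "lace_tail x < \<infinity>"
        using esum_ge[of lace_tail x] tail_fin by (rule le_less_trans)
      then have "lace_odd x < \<infinity>" "?e < \<infinity>"
        unfolding lace_tail_eq by auto
      \<comment> \<open>Up to sign the deviation is the odd part minus the even part from index 2
        on, whereas the tail is the sum of the two.\<close>
      then have "?P x = enn2real (lace_odd x) + enn2real ?e"
        "enn2real (lace_even x) = \<beta> * of_bool (x \<in> neighbours) + enn2real ?e"
        using beta unfolding lace_tail_eq lace_even_eq
        by (simp_all add: enn2real_plus ennreal_mult_less_top enn2real_mult)
      then show ?thesis by (simp add: abs_le_iff)
    qed
    show "summable_fun ?P" by (rule P)
    have nn: "0 \<le> \<beta> * lam * N * (1 + C)" "0 \<le> \<beta> * lam * N * C" using beta lam N C by auto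
    show "(\<integral>x. ?P x \<partial>count_space UNIV) \<le> 2 * (\<beta> * lam * N * (1 + C))"
      using tail nn unfolding P(2)[symmetric] by (subst (asm) ennreal_le_iff) auto
    show "summable_fun (\<lambda>x. (coord j x)\<^sup>2 * ?P x)" for j by (rule P2)
    show "(\<integral>x. (coord j x)\<^sup>2 * ?P x \<partial>count_space UNIV) \<le> 2 * (\<beta> * lam * N * C)" for j
      using P2(2)[of j] nn by (subst (asm) ennreal_le_iff) auto
    show "0 \<le> \<beta>" by (rule beta)
    show "N = real (card (neighbours :: (int ^ 'd) set))" by (simp add: N_def)
    have "(8 * lam * (1 + C)) * (\<beta> * N / 4) \<le> 1 * (\<beta> * N / 4)"
      using small(2) beta N by (intro mult_right_mono) auto
    then show "2 * (\<beta> * lam * N * (1 + C)) \<le> \<beta> * N / 4" by (simp add: algebra_simps)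
    have "(4 * real CARD('d) * lam * N * C) * (\<beta> / 2) \<le> 1 * (\<beta> / 2)"
      using small(3) beta by (intro mult_right_mono) auto
    then show "real CARD('d) * (2 * (\<beta> * lam * N * C)) \<le> \<beta> / 2" by (simp add: algebra_simps)
  qed
qed

end

section \<open>Continuity in the fugacity\<close>

lemma displacement_le:
  "w \<noteq> [] \<Longrightarrow> successively nearest_neighbour w \<Longrightarrow> \<bar>last w $ j - hd w $ j\<bar> \<le> int (num_edges w)"
proof (induction w rule: induct_list012)
  case (3 a b w)
  have "\<bar>a $ j - b $ j\<bar> \<le> (\<Sum>i\<in>UNIV. \<bar>a $ i - b $ i\<bar>)"
    by (rule member_le_sum) auto
  also have "\<dots> = 1" using 3 by (simp add: nearest_neighbour_def)
  finally have "\<bar>b $ j - a $ j\<bar> \<le> 1" by linarith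
  moreover have "\<bar>last (b # w) $ j - b $ j\<bar> \<le> int (num_edges (b # w))"
    using 3 by simp
  ultimately show ?case by simp
qed auto

text \<open>General length weights in place of powers of \<beta> allow different values of \<beta>,
  their increments and moments in the path length to be compared path by path.\<close>

definition path_sum :: "real \<Rightarrow> (nat \<Rightarrow> real) \<Rightarrow> int ^ 'd::finite \<Rightarrow> ennreal" where
  "path_sum lam a x = (\<Sum>\<^sup>+w. of_bool (w \<noteq> [] \<and> successively nearest_neighbour w \<and> hd w = 0 \<and> last w = x) *
     ennreal (a (num_edges w) * wsaw_weight lam w))"

lemma (in wsaw) green_eq_path_sum: "green 0 x = path_sum lam (\<lambda>n. \<beta> ^ n) x"
  unfolding green_def path_sum_def wt_def by (intro esum_cong) (auto simp: of_bool_def)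

lemma wsaw_weight_nonneg: "0 \<le> lam \<Longrightarrow> lam \<le> 1 \<Longrightarrow> 0 \<le> wsaw_weight lam w"
  by (rule wsaw.weight_01[THEN conjunct1, of lam 0]) (simp add: wsaw_def)

lemma path_sum_mono:
  assumes "0 \<le> lam" "lam \<le> 1" "\<And>n. a n \<le> b n"
  shows "path_sum lam a x \<le> path_sum lam b x"
  unfolding path_sum_def using assms
  by (intro esum_mono mult_left_mono ennreal_leI mult_right_mono wsaw_weight_nonneg) auto

lemma path_sum_add:
  assumes "0 \<le> lam" "lam \<le> 1" "\<And>n. 0 \<le> a n" "\<And>n. 0 \<le> b n"
  shows "path_sum lam (\<lambda>n. a n + b n) x = path_sum lam a x + path_sum lam b x"
  unfolding path_sum_def esum_add[symmetric]
  using assms by (simp add: distrib_right distrib_left wsaw_weight_nonneg)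

lemma path_sum_cmult:
  assumes "0 \<le> c"
  shows "path_sum lam (\<lambda>n. c * a n) x = ennreal c * path_sum lam a x"
  unfolding path_sum_def esum_cmult[symmetric]
  using assms by (simp add: ennreal_mult' mult_ac)

lemma sq_path_sum_le:
  assumes "0 \<le> lam" "lam \<le> 1" "\<And>n. 0 \<le> a n"
  shows "sq j x * path_sum lam a x \<le> path_sum lam (\<lambda>n. (real n)\<^sup>2 * a n) x"
  unfolding path_sum_def esum_cmult[symmetric]
proof (rule esum_mono)
  fix w
  let ?P = "w \<noteq> [] \<and> successively nearest_neighbour w \<and> hd w = 0 \<and> last w = x"
  show "sq j x * (of_bool ?P * ennreal (a (num_edges w) * wsaw_weight lam w))
      \<le> of_bool ?P * ennreal ((real (num_edges w))\<^sup>2 * a (num_edges w) * wsaw_weight lam w)"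
  proof (cases ?P)
    case True
    then have "\<bar>x $ j\<bar> \<le> int (num_edges w)" using displacement_le[of w j] by simp
    then have "\<bar>coord j x\<bar> \<le> real (num_edges w)" by linarith
    then have "(coord j x)\<^sup>2 \<le> (real (num_edges w))\<^sup>2" by (metis abs_ge_zero power2_abs power_mono)
    then have "(coord j x)\<^sup>2 * (a (num_edges w) * wsaw_weight lam w) \<le> (real (num_edges w))\<^sup>2 * (a (num_edges w) * wsaw_weight lam w)"
      using assms by (intro mult_right_mono) (auto simp: wsaw_weight_nonneg)
    then show ?thesis using True assms
      by (simp add: sq_def ennreal_mult[symmetric] wsaw_weight_nonneg ennreal_leI mult_ac)
  qed auto
qed

lemma cubic_times_power_le:
  assumes "0 \<le> b" "b < b1"
  shows "\<exists>D>0. \<forall>n. (1 + (real n)\<^sup>2) * (1 + real n) * b ^ n \<le> D * b1 ^ n"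
proof -
  \<comment> \<open>The cube root distributes the decay of \<open>b / b1\<close> over three factors,
    each of which absorbs one factor \<open>1 + real n\<close>.\<close>
  define s where "s = root 3 (b / b1)"
  have s: "0 \<le> s" "s < 1" "s ^ 3 = b / b1"
    using assms by (auto simp: s_def real_root_lt_1_iff)
  have "(\<lambda>n. real n * s ^ n) \<longlonglongrightarrow> 0"
    using powser_times_n_limit_0[of s] s by simp
  then have "Bseq (\<lambda>n. real n * s ^ n)"
    by (intro convergent_imp_Bseq convergentI)
  then obtain M where M: "0 < M" "\<And>n. norm (real n * s ^ n) \<le> M"
    by (auto elim: BseqE)
  have "(1 + (real n)\<^sup>2) * (1 + real n) * b ^ n \<le> (1 + M) ^ 3 * b1 ^ n" for n
  proof -
    have "(1 + real n) * s ^ n \<le> 1 + M"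
      using M(2)[of n] s power_le_one[of s n] by (simp add: distrib_right)
    then have *: "((1 + real n) * s ^ n) ^ 3 \<le> (1 + M) ^ 3"
      using s by (intro power_mono) auto
    have "b ^ n = s ^ n * s ^ n * s ^ n * b1 ^ n"
    proof -
      have "b = s ^ 3 * b1" using assms s by simp
      then show ?thesis by (simp add: power_mult_distrib power3_eq_cube)
    qed
    moreover have "(1 + (real n)\<^sup>2) * (1 + real n) \<le> (1 + real n) ^ 3"
      by (simp add: power3_eq_cube power2_eq_square algebra_simps)
    ultimately have "(1 + (real n)\<^sup>2) * (1 + real n) * b ^ n \<le> (1 + real n) ^ 3 * (s ^ n * s ^ n * s ^ n * b1 ^ n)"
      using s assms by (simp add: mult_right_mono)
    also have "\<dots> = ((1 + real n) * s ^ n) ^ 3 * b1 ^ n"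
      by (simp add: power3_eq_cube)
    also have "\<dots> \<le> (1 + M) ^ 3 * b1 ^ n"
      using * assms by (intro mult_right_mono) auto
    finally show ?thesis .
  qed
  then show ?thesis using M(1) by (intro exI[of _ "(1 + M) ^ 3"]) auto
qed

text \<open>Mean value bound for powers, multiplied by \<open>b\<close> so that the exponent
  \<open>n - 1\<close> does not occur.\<close>

lemma power_increment_le:
  fixes b x y :: real
  assumes "0 \<le> x" "x \<le> y" "y \<le> b"
  shows "y ^ n * b \<le> x ^ n * b + (y - x) * (real n * b ^ n)"
proof (induction n)
  case (Suc n)
  have "y ^ Suc n * b = y * (y ^ n * b)" by simp
  also have "\<dots> \<le> y * (x ^ n * b + (y - x) * (real n * b ^ n))"
    using Suc assms by (intro mult_left_mono) auto
  also have "\<dots> = x ^ Suc n * b + (y - x) * (x ^ n * b + y * (real n * b ^ n))"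
    by (simp add: algebra_simps)
  also have "\<dots> \<le> x ^ Suc n * b + (y - x) * (b ^ n * b + b * (real n * b ^ n))"
    using assms by (intro add_left_mono mult_left_mono add_mono mult_right_mono power_mono) auto
  also have "\<dots> = x ^ Suc n * b + (y - x) * (real (Suc n) * b ^ Suc n)"
    by (simp add: algebra_simps)
  finally show ?case .
qed simp

definition chi :: "'d::finite itself \<Rightarrow> real \<Rightarrow> real \<Rightarrow> ennreal" where
  "chi TYPE('d) lam \<beta> = (\<Sum>\<^sup>+x::int ^ 'd. path_sum lam (\<lambda>n. \<beta> ^ n) x)"

definition controlled :: "'d::finite itself \<Rightarrow> real \<Rightarrow> real \<Rightarrow> real \<Rightarrow> bool" where
  "controlled TYPE('d) lam \<beta> C \<longleftrightarrow>
    (\<Sum>\<^sup>+x::int ^ 'd. (path_sum lam (\<lambda>n. \<beta> ^ n) x)\<^sup>2) \<le> ennreal C \<and>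
    (\<forall>j (x :: int ^ 'd). sq j x * path_sum lam (\<lambda>n. \<beta> ^ n) x \<le> ennreal C)"

lemma esum_weighted_finite:
  assumes lam: "0 \<le> lam" "lam \<le> 1" and b: "0 \<le> b" "b < b1" and fin: "chi TYPE('d::finite) lam b1 < \<infinity>"
  shows "chi TYPE('d) lam b < \<infinity>" "(\<Sum>\<^sup>+x::int ^ 'd. sq j x * path_sum lam (\<lambda>n. b ^ n) x) < \<infinity>"
proof -
  obtain D where D: "D > 0" "\<And>n. (1 + (real n)\<^sup>2) * (1 + real n) * b ^ n \<le> D * b1 ^ n"
    using cubic_times_power_le[OF b] by blast
  have bound: "(\<Sum>\<^sup>+x::int ^ 'd. path_sum lam a x) < \<infinity>" if "\<And>n. a n \<le> D * b1 ^ n" for a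
  proof -
    have "(\<Sum>\<^sup>+x::int ^ 'd. path_sum lam a x) \<le> (\<Sum>\<^sup>+x::int ^ 'd. path_sum lam (\<lambda>n. D * b1 ^ n) x)"
      using that by (intro esum_mono path_sum_mono lam)
    also have "\<dots> = ennreal D * chi TYPE('d) lam b1"
      using D(1) by (simp add: path_sum_cmult esum_cmult chi_def)
    also have "\<dots> < \<infinity>" using fin by (simp add: ennreal_mult_less_top)
    finally show ?thesis .
  qed
  have le: "1 * b ^ n \<le> (1 + (real n)\<^sup>2) * (1 + real n) * b ^ n"
    "(real n)\<^sup>2 * b ^ n \<le> (1 + (real n)\<^sup>2) * (1 + real n) * b ^ n" for n
    using b by (intro mult_right_mono; simp add: algebra_simps)+
  show "chi TYPE('d) lam b < \<infinity>"
    unfolding chi_def using order_trans[OF le(1) D(2)] by (intro bound) simp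
  have "(\<Sum>\<^sup>+x::int ^ 'd. sq j x * path_sum lam (\<lambda>n. b ^ n) x) \<le> (\<Sum>\<^sup>+x::int ^ 'd. path_sum lam (\<lambda>n. (real n)\<^sup>2 * b ^ n) x)"
    using b by (intro esum_mono sq_path_sum_le lam) auto
  also have "\<dots> < \<infinity>"
    using order_trans[OF le(2) D(2)] by (intro bound) simp
  finally show "(\<Sum>\<^sup>+x::int ^ 'd. sq j x * path_sum lam (\<lambda>n. b ^ n) x) < \<infinity>" .
qed

text \<open>The same \<delta> serves all pairs in \<open>[0, b]\<close>, so finitely many steps
  reach \<open>b\<close>. Only the upward direction is stated, since the bootstrap moves from 0
  upwards.\<close>

lemma controlled_continuity:
  assumes lam: "0 \<le> lam" "lam \<le> 1" and b: "0 < b" "b < b1" and fin: "chi TYPE('d::finite) lam b1 < \<infinity>" and K: "0 < K"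
  shows "\<exists>\<delta>>0. \<forall>x y. 0 \<le> x \<longrightarrow> x \<le> y \<longrightarrow> y \<le> b \<longrightarrow> y \<le> x + \<delta> \<longrightarrow>
    controlled TYPE('d) lam x K \<longrightarrow> controlled TYPE('d) lam y (2 * K)"
proof -
  obtain D where D: "D > 0" "\<And>n. (1 + (real n)\<^sup>2) * (1 + real n) * b ^ n \<le> D * b1 ^ n"
    using cubic_times_power_le[of b b1] b by auto
  define c where "c = enn2real (chi TYPE('d) lam b1)"
  have c: "chi TYPE('d) lam b1 = ennreal c" "0 \<le> c" using fin by (simp_all add: c_def)
  let ?G = "\<lambda>\<beta> (x :: int ^ 'd). path_sum lam (\<lambda>n. \<beta> ^ n) x"
  \<comment> \<open>Majorant of the increment up to the factor \<epsilon>. The division by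
    \<open>1 + (real n)\<^sup>2\<close> leaves room for the weight \<open>sq j\<close>, so the
    weighted increment is still below the Green function at \<open>b1\<close>, uniformly in the
    endpoint.\<close>
  let ?e = "\<lambda>x :: int ^ 'd. path_sum lam (\<lambda>n. b1 ^ n / (1 + (real n)\<^sup>2)) x"
  have G1_le: "?G b1 x \<le> ennreal c" for x
    using esum_ge[of "?G b1" x] unfolding chi_def[symmetric] c(1) .
  have e_le: "?e x \<le> ?G b1 x" for x
  proof (intro path_sum_mono lam)
    fix n
    have "0 < 1 + (real n)\<^sup>2" by (simp add: add_pos_nonneg)
    then have "b1 ^ n / (1 + (real n)\<^sup>2) \<le> b1 ^ n / 1"
      using b by (intro divide_left_mono) auto
    then show "b1 ^ n / (1 + (real n)\<^sup>2) \<le> b1 ^ n" by simp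
  qed
  have sq_e_le: "sq j x * ?e x \<le> ?G b1 x" for j x
  proof -
    have "sq j x * ?e x \<le> path_sum lam (\<lambda>n. (real n)\<^sup>2 * (b1 ^ n / (1 + (real n)\<^sup>2))) x"
      using b by (intro sq_path_sum_le lam) auto
    also have "\<dots> \<le> ?G b1 x"
    proof (intro path_sum_mono lam)
      fix n
      have "(real n)\<^sup>2 * b1 ^ n \<le> (1 + (real n)\<^sup>2) * b1 ^ n"
        using b by (intro mult_right_mono) auto
      then have "(real n)\<^sup>2 * b1 ^ n / (1 + (real n)\<^sup>2) \<le> b1 ^ n"
        by (simp add: divide_le_eq add_pos_nonneg mult.commute)
      then show "(real n)\<^sup>2 * (b1 ^ n / (1 + (real n)\<^sup>2)) \<le> b1 ^ n" by simp
    qed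
    finally show ?thesis .
  qed
  have B1: "(\<Sum>\<^sup>+x::int ^ 'd. (?G b1 x)\<^sup>2) \<le> ennreal (c * c)"
  proof -
    have "(\<Sum>\<^sup>+x::int ^ 'd. (?G b1 x)\<^sup>2) \<le> (\<Sum>\<^sup>+x::int ^ 'd. ennreal c * ?G b1 x)"
      unfolding power2_eq_square by (intro esum_mono mult_right_mono G1_le) simp
    also have "\<dots> = ennreal (c * c)"
      using c by (simp add: esum_cmult chi_def[symmetric] ennreal_mult)
    finally show ?thesis .
  qed
  \<comment> \<open>Collects the two errors per unit of \<epsilon>: \<open>c\<close> for the
    weighted supremum and \<open>3 * (c * c)\<close> for the bubble; the 1 makes it
    positive.\<close>
  define L where "L = c + 3 * (c * c) + 1"
  have L: "0 < L" using c(2) by (simp add: L_def add_nonneg_pos)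
  \<comment> \<open>Chosen so that \<open>\<epsilon> = (y - x) * D / b\<close> is at most 1 and
    \<open>\<epsilon> * L\<close> at most \<open>K\<close>.\<close>
  define \<delta> where "\<delta> = min 1 (K / L) * b / D"
  have "\<delta> > 0" using K L b D by (simp add: \<delta>_def)
  moreover have "controlled TYPE('d) lam y (2 * K)"
    if xy: "0 \<le> x" "x \<le> y" "y \<le> b" "y \<le> x + \<delta>" and x: "controlled TYPE('d) lam x K" for x y
  proof -
    define \<epsilon> where "\<epsilon> = (y - x) * D / b"
    have eps: "0 \<le> \<epsilon>" using xy b D by (simp add: \<epsilon>_def)
    have "\<epsilon> \<le> \<delta> * D / b" unfolding \<epsilon>_def using xy b D by (intro divide_right_mono mult_right_mono) auto
    then have "\<epsilon> \<le> min 1 (K / L)" using b D by (simp add: \<delta>_def)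
    then have eps1: "\<epsilon> \<le> 1" and eps2: "\<epsilon> * L \<le> K" using L by (simp_all add: field_simps)
    have G_le: "?G y z \<le> ?G x z + ennreal \<epsilon> * ?e z" for z
    proof -
      have "y ^ n \<le> x ^ n + \<epsilon> * (b1 ^ n / (1 + (real n)\<^sup>2))" for n
      proof -
        have p: "0 < 1 + (real n)\<^sup>2" by (simp add: add_pos_nonneg)
        have "(1 + (real n)\<^sup>2) * real n * b ^ n \<le> (1 + (real n)\<^sup>2) * (1 + real n) * b ^ n"
          using b by (intro mult_right_mono mult_left_mono) auto
        also have "\<dots> \<le> D * b1 ^ n" by (rule D)
        finally have "real n * b ^ n \<le> D * b1 ^ n / (1 + (real n)\<^sup>2)"
          using p by (simp add: pos_le_divide_eq mult_ac)
        then have "(y - x) * (real n * b ^ n) \<le> (y - x) * (D * b1 ^ n / (1 + (real n)\<^sup>2))"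
          using xy by (intro mult_left_mono) auto
        with power_increment_le[OF xy(1-3), of n]
        have "y ^ n * b \<le> x ^ n * b + (y - x) * (D * b1 ^ n / (1 + (real n)\<^sup>2))" by linarith
        also have "\<dots> = (x ^ n + \<epsilon> * (b1 ^ n / (1 + (real n)\<^sup>2))) * b"
          using b by (simp add: \<epsilon>_def distrib_right)
        finally show ?thesis using b by simp
      qed
      then have "?G y z \<le> path_sum lam (\<lambda>n. x ^ n + \<epsilon> * (b1 ^ n / (1 + (real n)\<^sup>2))) z"
        by (intro path_sum_mono lam)
      also have "\<dots> = ?G x z + path_sum lam (\<lambda>n. \<epsilon> * (b1 ^ n / (1 + (real n)\<^sup>2))) z"
        using xy eps b by (intro path_sum_add lam) auto
      also have "path_sum lam (\<lambda>n. \<epsilon> * (b1 ^ n / (1 + (real n)\<^sup>2))) z = ennreal \<epsilon> * ?e z"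
        by (rule path_sum_cmult[OF eps])
      finally show ?thesis .
    qed
    have Gx_le: "?G x z \<le> ?G b1 z" for z
      using xy b by (intro path_sum_mono lam power_mono) auto
    have "sq j z * ?G y z \<le> ennreal (2 * K)" for j z
    proof -
      have "sq j z * ?G y z \<le> sq j z * (?G x z + ennreal \<epsilon> * ?e z)"
        by (intro mult_left_mono G_le) simp
      also have "\<dots> = sq j z * ?G x z + ennreal \<epsilon> * (sq j z * ?e z)"
        by (simp add: distrib_left mult_ac)
      also have "\<dots> \<le> ennreal K + ennreal \<epsilon> * ennreal c"
        using x by (intro add_mono mult_left_mono order_trans[OF sq_e_le G1_le]) (auto simp: controlled_def)
      also have "\<dots> = ennreal (K + \<epsilon> * c)"
        using K eps c by (simp add: ennreal_mult)
      also have "\<dots> \<le> ennreal (2 * K)"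
      proof (rule ennreal_leI)
        have "\<epsilon> * c \<le> \<epsilon> * L" using eps c(2) by (intro mult_left_mono) (auto simp: L_def)
        then show "K + \<epsilon> * c \<le> 2 * K" using eps2 by linarith
      qed
      finally show ?thesis .
    qed
    moreover have "(\<Sum>\<^sup>+z. (?G y z)\<^sup>2) \<le> ennreal (2 * K)"
    proof -
      have "(\<Sum>\<^sup>+z. (?G y z)\<^sup>2) \<le> (\<Sum>\<^sup>+z. (?G x z)\<^sup>2 + ennreal (3 * \<epsilon>) * (?G b1 z)\<^sup>2)"
      proof (rule esum_mono)
        fix z
        have "(?G y z)\<^sup>2 \<le> (?G x z + ennreal \<epsilon> * ?e z)\<^sup>2"
          by (intro power_mono G_le) simp
        also have "\<dots> = (?G x z)\<^sup>2 + (2 * ennreal \<epsilon> * (?G x z * ?e z) + ennreal \<epsilon> * ennreal \<epsilon> * (?e z * ?e z))"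
          by (simp add: power2_eq_square distrib_left distrib_right mult_ac add_ac mult_2)
        \<comment> \<open>The condition that \<epsilon> is at most 1 makes its square linear, so
          cross term and square together cost \<open>3 * \<epsilon>\<close>.\<close>
        also have "\<dots> \<le> (?G x z)\<^sup>2 + (2 * ennreal \<epsilon> * (?G b1 z * ?G b1 z) + ennreal \<epsilon> * 1 * (?G b1 z * ?G b1 z))"
          using eps1 by (intro add_left_mono add_mono mult_mono Gx_le e_le order_refl) auto
        also have "2 * ennreal \<epsilon> * (?G b1 z * ?G b1 z) + ennreal \<epsilon> * 1 * (?G b1 z * ?G b1 z) = ennreal (3 * \<epsilon>) * (?G b1 z)\<^sup>2"
        proof -
          have "ennreal (3 * \<epsilon>) = 2 * ennreal \<epsilon> + ennreal \<epsilon> * 1"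
            using eps by (simp add: ennreal_mult' flip: distrib_right) (metis distrib_right mult_1 numeral_plus_one semiring_norm(5))
          then show ?thesis by (simp only: distrib_right power2_eq_square)
        qed
        finally show "(?G y z)\<^sup>2 \<le> (?G x z)\<^sup>2 + ennreal (3 * \<epsilon>) * (?G b1 z)\<^sup>2" .
      qed
      also have "\<dots> \<le> ennreal K + ennreal (3 * \<epsilon>) * ennreal (c * c)"
        unfolding esum_add esum_cmult
        using x by (intro add_mono mult_left_mono B1) (auto simp: controlled_def)
      also have "\<dots> = ennreal (K + 3 * \<epsilon> * (c * c))"
        using K eps c by (simp add: ennreal_mult)
      also have "\<dots> \<le> ennreal (2 * K)"
      proof (rule ennreal_leI)
        have "\<epsilon> * (3 * (c * c)) \<le> \<epsilon> * L" using eps c(2) by (intro mult_left_mono) (auto simp: L_def)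
        then show "K + 3 * \<epsilon> * (c * c) \<le> 2 * K" using eps2 by simp
      qed
      finally show ?thesis .
    qed
    ultimately show ?thesis by (simp add: controlled_def)
  qed
  ultimately show ?thesis by blast
qed

section \<open>The bootstrap\<close>

text \<open>The constant \<open>C\<close> enters only through the smallness conditions;
  \<open>K\<close> is constrained by \<open>N\<close> and the Green integral alone. The second
  conclusion is a by-product from which boundedness of the subcritical set follows.\<close>

lemma bootstrap_step:
  fixes C K :: real
  defines "N \<equiv> real (card (neighbours :: (int ^ 'd::finite) set))"
  assumes lam: "0 \<le> lam" "lam \<le> 1" and beta: "0 \<le> \<beta>"
    and chi: "chi TYPE('d) lam \<beta> < \<infinity>"
    and chi2: "\<And>j. (\<Sum>\<^sup>+x::int ^ 'd. sq j x * path_sum lam (\<lambda>n. \<beta> ^ n) x) < \<infinity>"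
    and C: "0 \<le> C" "controlled TYPE('d) lam \<beta> C"
    and small: "12 * lam * C \<le> 1" "8 * lam * (1 + C) \<le> 1" "4 * real CARD('d) * lam * N * C \<le> 1"
    and K: "ennreal (64 * N\<^sup>2) * green_integral TYPE('d) \<le> ennreal K"
      "ennreal (3008 * N ^ 4) * green_integral TYPE('d) \<le> ennreal K"
  shows "controlled TYPE('d) lam \<beta> K" "\<beta> * N \<le> 4 / 3"
proof -
  interpret wsaw lam \<beta> by standard (use lam beta in auto)
  have fin: "(\<Sum>\<^sup>+x::int ^ 'd. green 0 x) < \<infinity>"
    using chi by (simp add: chi_def green_eq_path_sum)
  have fin2: "(\<Sum>\<^sup>+x::int ^ 'd. sq j x * green 0 x) < \<infinity>" for j
    using chi2[of j] by (simp add: green_eq_path_sum)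
  interpret D: deconvolution "\<lambda>x :: int ^ 'd. enn2real (green 0 x)"
    "\<lambda>x. of_bool (x = 0) + enn2real (lace_odd x) - enn2real (lace_even x)"
    "\<lambda>x. enn2real (lace_tail x)" \<beta> "2 * (\<beta> * lam * N * (1 + C))" "2 * (\<beta> * lam * N * C)" N
    unfolding N_def
  proof (rule deconvolution_wsaw[OF fin fin2])
    show "bubble TYPE('d) \<le> ennreal C" "\<And>j (x :: int ^ 'd). sq j x * green 0 x \<le> ennreal C"
      using C(2) by (simp_all add: controlled_def bubble_def green_eq_path_sum)
  qed (use C(1) small in \<open>simp_all add: N_def\<close>)
  have green: "ennreal (enn2real (green 0 x)) = green 0 x" for x :: "int ^ 'd"
    by (rule esum_eq_integral(3)[OF fin])
  have "(\<Sum>\<^sup>+x::int ^ 'd. (green 0 x)\<^sup>2) = (\<Sum>\<^sup>+x::int ^ 'd. ennreal ((enn2real (green 0 x))\<^sup>2))"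
    by (simp add: green flip: ennreal_power)
  also have "\<dots> \<le> ennreal K"
    using D.esum_g_sq_le K(1) by (rule order_trans)
  finally have 1: "(\<Sum>\<^sup>+x::int ^ 'd. (green 0 x)\<^sup>2) \<le> ennreal K" .
  have 2: "sq j x * green 0 x \<le> ennreal K" for j and x :: "int ^ 'd"
  proof -
    have "sq j x * green 0 x = ennreal ((coord j x)\<^sup>2 * enn2real (green 0 x))"
      by (simp add: sq_def ennreal_mult green)
    also have "\<dots> \<le> ennreal K"
      using D.coord_sq_g_le K(2) by (rule order_trans)
    finally show ?thesis .
  qed
  show "controlled TYPE('d) lam \<beta> K"
    unfolding controlled_def using 1 2 by (simp add: green_eq_path_sum)
  show "\<beta> * N \<le> 4 / 3" by (rule D.beta_N_le)
qed

lemma controlled_0: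
  assumes lam: "0 \<le> lam" "lam \<le> 1" and K: "1 \<le> K"
  shows "controlled TYPE('d::finite) lam 0 K"
proof -
  interpret wsaw lam 0 by standard (use lam in auto)
  have green: "path_sum lam (\<lambda>n. 0 ^ n) x = of_bool (x = 0)" for x :: "int ^ 'd"
    using green_eq_delta_plus[of x] by (simp add: green_eq_path_sum rem_coeff_def)
  have "(\<Sum>\<^sup>+x::int ^ 'd. (of_bool (x = 0))\<^sup>2) = (\<Sum>\<^sup>+x::int ^ 'd. of_bool (x = 0) :: ennreal)"
    by (intro esum_cong) auto
  then have "(\<Sum>\<^sup>+x::int ^ 'd. (of_bool (x = 0))\<^sup>2) \<le> ennreal K"
    using K by (simp add: ennreal_1[symmetric] ennreal_leI del: ennreal_1)
  moreover have "sq j x * of_bool (x = 0) \<le> ennreal K" for j and x :: "int ^ 'd"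
    by auto
  ultimately show ?thesis by (simp add: controlled_def green)
qed

text \<open>The smallness conditions are those of \<open>bootstrap_step\<close> at
  \<open>C = 2 * K\<close>. Continuity weakens \<open>K\<close> to \<open>2 * K\<close> over one
  step of length \<delta>, the bootstrap restores \<open>K\<close>, and induction on the number of
  steps starts at \<beta> = 0.\<close>

lemma controlled_subcritical:
  fixes K :: real
  defines "N \<equiv> real (card (neighbours :: (int ^ 'd::finite) set))"
  assumes lam: "0 \<le> lam" "lam \<le> 1" and beta: "0 \<le> \<beta>" "\<beta> < b1"
    and chi: "chi TYPE('d) lam b1 < \<infinity>"
    and small: "24 * lam * K \<le> 1" "8 * lam * (1 + 2 * K) \<le> 1" "8 * real CARD('d) * lam * N * K \<le> 1"
    and K: "1 \<le> K" "ennreal (64 * N\<^sup>2) * green_integral TYPE('d) \<le> ennreal K"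
      "ennreal (3008 * N ^ 4) * green_integral TYPE('d) \<le> ennreal K"
  shows "controlled TYPE('d) lam \<beta> K" "\<beta> * N \<le> 4 / 3"
proof -
  \<comment> \<open>The midpoint leaves a gap below \<open>b1\<close>, which continuity and the
    finiteness of second moments both need.\<close>
  define b where "b = (\<beta> + b1) / 2"
  have b: "0 < b" "b < b1" "\<beta> \<le> b" using beta by (auto simp: b_def)
  have step: "controlled TYPE('d) lam x K \<and> x * N \<le> 4 / 3"
    if x: "0 \<le> x" "x \<le> b" "controlled TYPE('d) lam x (2 * K)" for x
    unfolding N_def
    using bootstrap_step[OF lam x(1) esum_weighted_finite[OF lam x(1) _ chi] _ x(3), of K] x(2) b small K
    by (simp add: N_def)
  obtain \<delta> where \<delta>: "\<delta> > 0" "\<And>x y. 0 \<le> x \<Longrightarrow> x \<le> y \<Longrightarrow> y \<le> b \<Longrightarrow> y \<le> x + \<delta> \<Longrightarrow>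
      controlled TYPE('d) lam x K \<Longrightarrow> controlled TYPE('d) lam y (2 * K)"
    using controlled_continuity[OF lam b(1,2) chi, of K] K by auto
  have "controlled TYPE('d) lam x K" if "0 \<le> x" "x \<le> b" "x \<le> real n * \<delta>" for x n
    using that
  proof (induction n arbitrary: x)
    case 0
    then show ?case using controlled_0[OF lam K(1)] by simp
  next
    case (Suc n)
    \<comment> \<open>Truncation at 0 keeps the previous point in the interval when the first step
      is shorter than \<delta>.\<close>
    let ?y = "max 0 (x - \<delta>)"
    have "controlled TYPE('d) lam ?y K"
      using Suc.prems \<delta>(1) by (intro Suc.IH) (auto simp: algebra_simps)
    then have "controlled TYPE('d) lam x (2 * K)"
      using Suc.prems \<delta>(1) by (intro \<delta>(2)[of ?y]) auto
    then show ?case using step Suc.prems by blast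
  qed
  moreover obtain n where "\<beta> / \<delta> \<le> real n"
    using real_arch_simple by blast
  ultimately have *: "controlled TYPE('d) lam \<beta> K"
    using \<delta>(1) beta b(3) by (simp add: divide_le_eq)
  then show "controlled TYPE('d) lam \<beta> K" .
  \<comment> \<open>Continuity with equal endpoints weakens \<open>K\<close> to
    \<open>2 * K\<close>.\<close>
  have "controlled TYPE('d) lam \<beta> (2 * K)"
    using \<delta>(2)[OF _ _ _ _ *, of \<beta>] \<delta>(1) beta b(3) by simp
  then show "\<beta> * N \<le> 4 / 3" using step beta b(3) by blast
qed

section \<open>Passage to the critical point by monotone convergence\<close>

lemma ennreal_SUP_power2:
  fixes f :: "nat \<Rightarrow> ennreal"
  assumes "incseq f"
  shows "(SUP n. f n)\<^sup>2 = (SUP n. (f n)\<^sup>2)"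
proof (rule antisym)
  have "(SUP n. f n)\<^sup>2 = (SUP n. SUP m. f m * f n)"
    by (simp add: power2_eq_square SUP_mult_left_ennreal SUP_mult_right_ennreal)
  also have "\<dots> \<le> (SUP n. (f n)\<^sup>2)"
  proof (intro SUP_least)
    fix m n
    have "f m * f n \<le> (f (max m n))\<^sup>2"
      unfolding power2_eq_square using assms by (intro mult_mono) (auto simp: incseq_def)
    also have "\<dots> \<le> (SUP n. (f n)\<^sup>2)" by (rule SUP_upper) simp
    finally show "f m * f n \<le> (SUP n. (f n)\<^sup>2)" .
  qed
  finally show "(SUP n. f n)\<^sup>2 \<le> (SUP n. (f n)\<^sup>2)" .
  show "(SUP n. (f n)\<^sup>2) \<le> (SUP n. f n)\<^sup>2"
    by (intro SUP_least power_mono SUP_upper) auto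
qed

lemma path_sum_SUP:
  fixes x :: "int ^ 'd::finite"
  assumes lam: "0 \<le> lam" "lam \<le> 1" and b: "\<And>k. 0 \<le> b k" "incseq b" "b \<longlonglongrightarrow> \<beta>"
  shows "path_sum lam (\<lambda>n. \<beta> ^ n) x = (SUP k. path_sum lam (\<lambda>n. b k ^ n) x)"
proof -
  let ?P = "\<lambda>w. w \<noteq> [] \<and> successively nearest_neighbour w \<and> hd w = 0 \<and> last w = x"
  let ?F = "\<lambda>k w. of_bool (?P w) * ennreal (b k ^ num_edges w * wsaw_weight lam w)"
  have inc: "incseq ?F"
    using b lam by (auto simp: incseq_def le_fun_def intro!: mult_left_mono ennreal_leI mult_right_mono power_mono wsaw_weight_nonneg)
  have "of_bool (?P w) * ennreal (\<beta> ^ num_edges w * wsaw_weight lam w) = (SUP k. ?F k w)" for w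
  proof -
    have "(\<lambda>k. ennreal (b k ^ num_edges w * wsaw_weight lam w)) \<longlonglongrightarrow> ennreal (\<beta> ^ num_edges w * wsaw_weight lam w)"
      by (intro tendsto_ennrealI tendsto_intros b)
    moreover have "incseq (\<lambda>k. ennreal (b k ^ num_edges w * wsaw_weight lam w))"
      using b lam by (auto simp: incseq_def intro!: ennreal_leI mult_right_mono power_mono wsaw_weight_nonneg)
    ultimately have "ennreal (\<beta> ^ num_edges w * wsaw_weight lam w) = (SUP k. ennreal (b k ^ num_edges w * wsaw_weight lam w))"
      using LIMSEQ_SUP LIMSEQ_unique by blast
    then show ?thesis by (simp add: SUP_mult_left_ennreal)
  qed
  then show ?thesis
    unfolding path_sum_def by (simp only: esum_SUP[OF inc])
qed

theorem corollary1p3: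
  assumes "CARD('d::finite) > 4"
  shows "\<exists>lam0>0. \<forall>lam. 0 \<le> lam \<and> lam \<le> 1 \<and> lam < lam0 \<longrightarrow>
           wsaw_bubble TYPE('d) lam (wsaw_critical TYPE('d) lam) < \<infinity>"
proof -
  define N where "N = real (card (neighbours :: (int ^ 'd) set))"
  define I where "I = enn2real (green_integral TYPE('d))"
  have I: "green_integral TYPE('d) = ennreal I" "0 \<le> I"
    using integral_inverse_energy_finite[OF assms] by (simp_all add: I_def green_integral_def)
  \<comment> \<open>It depends on the dimension only. The summand 1 covers \<beta> = 0, where the
    bubble equals 1.\<close>
  define K where "K = 1 + 64 * N\<^sup>2 * I + 3008 * N ^ 4 * I"
  have N: "0 \<le> N" by (simp add: N_def)
  have K: "1 \<le> K" "ennreal (64 * N\<^sup>2) * green_integral TYPE('d) \<le> ennreal K"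
    "ennreal (3008 * N ^ 4) * green_integral TYPE('d) \<le> ennreal K"
    using I(2) by (auto simp: K_def I(1) ennreal_mult[symmetric] intro!: ennreal_leI)
  \<comment> \<open>The sum of the coefficients of \<open>lam\<close> in the three smallness
    conditions, so that \<open>lam * L \<le> 1\<close> implies each of them.\<close>
  define L where "L = 24 * K + 8 * (1 + 2 * K) + 8 * real CARD('d) * N * K"
  have L: "24 * K \<le> L" "8 * (1 + 2 * K) \<le> L" "8 * real CARD('d) * N * K \<le> L" "0 < L"
    using K(1) N by (auto simp: L_def intro!: add_pos_nonneg)
  show ?thesis
  proof (intro exI[of _ "1 / L"] conjI allI impI)
    show "0 < 1 / L" using L by simp
    fix lam assume "0 \<le> lam \<and> lam \<le> 1 \<and> lam < 1 / L"
    then have lam: "0 \<le> lam" "lam \<le> 1" and "lam * L \<le> 1"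
      using L(4) by (auto simp: field_simps)
    have small: "24 * lam * K \<le> 1" "8 * lam * (1 + 2 * K) \<le> 1" "8 * real CARD('d) * lam * N * K \<le> 1"
      using \<open>lam * L \<le> 1\<close> mult_left_mono[OF L(1) lam(1)] mult_left_mono[OF L(2) lam(1)] mult_left_mono[OF L(3) lam(1)]
      by (simp_all add: mult_ac)
    have green: "wsaw_green lam \<beta> 0 x = path_sum lam (\<lambda>n. \<beta> ^ n) x" if "0 \<le> \<beta>" for \<beta> and x :: "int ^ 'd"
    proof -
      interpret wsaw lam \<beta> by standard (use lam that in auto)
      show ?thesis by (simp add: wsaw_green_eq green_eq_path_sum)
    qed
    define S where "S = {\<beta>. 0 \<le> \<beta> \<and> chi TYPE('d) lam \<beta> < \<infinity>}"
    have "wsaw_susceptibility TYPE('d) lam \<beta> = chi TYPE('d) lam \<beta>" if "0 \<le> \<beta>" for \<beta>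
      unfolding wsaw_susceptibility_def infsum_eq_esum chi_def by (rule esum_cong) (rule green[OF that])
    then have S: "{\<beta>. 0 \<le> \<beta> \<and> wsaw_susceptibility TYPE('d) lam \<beta> < \<infinity>} = S"
      by (auto simp: S_def)
    note sub = controlled_subcritical[where 'd='d, folded N_def, OF lam _ _ _ small K]
    have "0 \<in> S"
    proof -
      interpret wsaw lam 0 by standard (use lam in auto)
      have "path_sum lam (\<lambda>n. 0 ^ n) x = of_bool (x = 0)" for x :: "int ^ 'd"
        using green_eq_delta_plus[of x] by (simp add: green_eq_path_sum rem_coeff_def)
      then have "chi TYPE('d) lam 0 = (\<Sum>\<^sup>+x::int ^ 'd. of_bool (x = 0))"
        unfolding chi_def by (rule esum_cong)
      then show ?thesis by (simp add: S_def)
    qed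
    \<comment> \<open>Needed for \<open>Sup S\<close> to be a genuine supremum. The bound on
      \<open>\<beta> * N\<close> is known strictly below each point of \<open>S\<close>, and density
      extends it to the point itself.\<close>
    have bdd: "bdd_above S"
    proof (rule bdd_aboveI)
      fix b1 assume b1: "b1 \<in> S"
      have "0 < N"
        using card_neighbours_ge[where 'd='d] assms by (simp add: N_def)
      show "b1 \<le> 4 / (3 * N)"
      proof (rule dense_le)
        fix \<beta> assume "\<beta> < b1"
        show "\<beta> \<le> 4 / (3 * N)"
        proof (cases "0 \<le> \<beta>")
          case True
          then have "\<beta> * N \<le> 4 / 3" using sub(2)[of \<beta> b1] b1 \<open>\<beta> < b1\<close> by (simp add: S_def)
          then show ?thesis using \<open>0 < N\<close> by (simp add: field_simps)
        next
          case False
          then have "\<beta> \<le> 0" by simp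
          also have "0 \<le> 4 / (3 * N)" using \<open>0 < N\<close> by simp
          finally show ?thesis .
        qed
      qed
    qed
    define bc where "bc = Sup S"
    have bc: "wsaw_critical TYPE('d) lam = bc"
      unfolding wsaw_critical_def bc_def S ..
    have bc0: "0 \<le> bc" unfolding bc_def by (rule cSup_upper[OF \<open>0 \<in> S\<close> bdd])
    \<comment> \<open>The bound is obtained only for \<beta> strictly below \<open>bc\<close>,
      because the susceptibility may be infinite at \<open>bc\<close> itself.\<close>
    have below: "controlled TYPE('d) lam \<beta> K" if nonneg: "0 \<le> \<beta>" and less: "\<beta> < bc" for \<beta>
    proof -
      obtain b1 where "b1 \<in> S" "\<beta> < b1"
        using less less_cSup_iff[OF _ bdd, of \<beta>] \<open>0 \<in> S\<close> by (auto simp: bc_def)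
      then show ?thesis using sub(1)[of \<beta> b1] nonneg by (simp add: S_def)
    qed
    have "(\<Sum>\<^sup>+x::int ^ 'd. (path_sum lam (\<lambda>n. bc ^ n) x)\<^sup>2) \<le> ennreal K"
    proof (cases "bc = 0")
      case True
      then show ?thesis using controlled_0[where 'd='d, OF lam K(1)] by (simp add: controlled_def)
    next
      case False
      then have pos: "0 < bc" using bc0 by simp
      \<comment> \<open>Starts at 0, stays strictly below \<open>bc\<close> and increases to it;
        this requires \<open>bc\<close> to be positive, so \<open>bc = 0\<close> was treated
        apart.\<close>
      define b where "b k = bc * (1 - 1 / real (Suc k))" for k
      have b: "0 \<le> b k" "b k < bc" for k
        using pos by (auto simp: b_def)
      have inc: "incseq b"
        unfolding incseq_def b_def using pos by (auto intro!: mult_left_mono divide_left_mono)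
      have lim: "b \<longlonglongrightarrow> bc"
        unfolding b_def[abs_def] using tendsto_mult[OF tendsto_const[of bc] tendsto_diff[OF tendsto_const[of 1] LIMSEQ_inverse_real_of_nat]]
        by (simp add: inverse_eq_divide)
      have incp: "incseq (\<lambda>k. path_sum lam (\<lambda>n. b k ^ n) x)" for x :: "int ^ 'd"
        using inc b by (auto simp: incseq_def intro!: path_sum_mono lam power_mono)
      have "(\<Sum>\<^sup>+x::int ^ 'd. (path_sum lam (\<lambda>n. bc ^ n) x)\<^sup>2) = (\<Sum>\<^sup>+x::int ^ 'd. SUP k. (path_sum lam (\<lambda>n. b k ^ n) x)\<^sup>2)"
        by (simp only: path_sum_SUP[OF lam b(1) inc lim] ennreal_SUP_power2[OF incp])
      also have "\<dots> = (SUP k. \<Sum>\<^sup>+x::int ^ 'd. (path_sum lam (\<lambda>n. b k ^ n) x)\<^sup>2)"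
        using incp by (intro esum_SUP) (auto simp: incseq_def le_fun_def intro!: power_mono)
      also have "\<dots> \<le> ennreal K"
        using below[OF b] by (intro SUP_least) (simp add: controlled_def)
      finally show ?thesis .
    qed
    then have "wsaw_bubble TYPE('d) lam bc \<le> ennreal K"
      by (simp add: wsaw_bubble_def infsum_eq_esum green[OF bc0])
    then show "wsaw_bubble TYPE('d) lam (wsaw_critical TYPE('d) lam) < \<infinity>"
      unfolding bc by (rule le_less_trans) simp
  qed
qed

end
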